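(* Let $W\subset\mathbb{H}$ be an axially symmetric open set and let $U$ be a bounded slice Cauchy domain such that $\overline{U}\subset W$. Let $J\in\mathbb{S}$ and $ds_J=ds(-J)$. (1) If $f\in\mathcal{SH}_L(W)$, then the function $\breve f^0(q)=\overline{\mathcal{D}}f(q)$ is (left) polyanalytic of order $2$, and it admits the integral representation $$\breve f^0(q)=-\frac{1}{2\pi}\sum_{k=0}^{1}(-q_0)^k\int_{\partial(U\cap\mathbb{C}_J)}F_L(s,q)\,s^{1-k}\,ds_J\,f(s)\qquad\text{for all } q\in U.$$ (2) If $f\in\mathcal{SH}_R(W)$, then the function $\breve f^0(q)=f(q)\overline{\mathcal{D}}$ is (right) polyanalytic of order $2$, and it admits the integral representation $$\breve f^0(q)=-\frac{1}{2\pi}\sum_{k=0}^{1}(-q_0)^k\int_{\partial(U\cap\mathbb{C}_J)}f(s)\,ds_J\,s^{1-k}F_R(s,q)\qquad\text{for all } q\in U.$$ The integrals depend neither on $U$ (among bounded slice Cauchy domains containing $q$ with closure in $W$) nor on the imaginary unit $J\in\mathbb{S}$.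
   Context: $\mathbb{H}$ is the skew field of quaternions $q=q_0+q_1e_1+q_2e_2+q_3e_3$ ($q_i\in\mathbb{R}$), with $e_1^2=e_2^2=e_3^2=-1$, $e_1e_2=-e_2e_1=e_3$, $e_2e_3=-e_3e_2=e_1$, $e_3e_1=-e_1e_3=e_2$; $\operatorname{Re}(q)=q_0$, $\underline q=q_1e_1+q_2e_2+q_3e_3$, $\bar q=q_0-\underline q$, $|q|=\sqrt{q\bar q}$. $\mathbb{S}=\{q\in\mathbb{H}:\operatorname{Re}(q)=0,\ |q|=1\}$, and $\mathbb{C}_J=\{u+Jv:u,v\in\mathbb{R}\}$ for $J\in\mathbb{S}$. A set $U\subset\mathbb{H}$ is axially symmetric if $u+Iv\in U$ for some $I\in\mathbb{S}$ implies $u+Jv\in U$ for all $J\in\mathbb{S}$. A slice Cauchy domain is an axially symmetric open set $U$ such that for every $J\in\mathbb{S}$ the boundary $\partial(U\cap\mathbb{C}_J)$ is a finite union of nonintersecting piecewise continuously differentiable Jordan curves in $\mathbb{C}_J$; this boundary is positively oriented. Let $U$ be an axially symmetric open set and $\mathcal{U}=\{(u,v)\in\mathbb{R}^2: u+\mathbb{S}v\subset U\}$. A function $f:U\to\mathbb{H}$ is left slice hyperholomorphic, $f\in\mathcal{SH}_L(U)$ (resp. right slice hyperholomorphic, $f\in\mathcal{SH}_R(U)$), if $f(u+Jv)=\alpha(u,v)+J\beta(u,v)$ (resp. $f(u+Jv)=\alpha(u,v)+\beta(u,v)J$) for all $(u,v)\in\mathcal{U}$, $J\in\mathbb{S}$,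 where $\alpha,\beta:\mathcal U\to\mathbb{H}$ are differentiable, $\alpha(u,v)=\alpha(u,-v)$, $\beta(u,v)=-\beta(u,-v)$, and $\partial_u\alpha-\partial_v\beta=0$, $\partial_v\alpha+\partial_u\beta=0$. The Fueter operator and its conjugate are $\mathcal{D}=\partial_{q_0}+\sum_{i=1}^3e_i\partial_{q_i}$ and $\overline{\mathcal{D}}=\partial_{q_0}-\sum_{i=1}^3e_i\partial_{q_i}$; acting from the right, $f\mathcal{D}=\partial_{q_0}f+\sum_{i=1}^3(\partial_{q_i}f)e_i$ and $f\overline{\mathcal{D}}=\partial_{q_0}f-\sum_{i=1}^3(\partial_{q_i}f)e_i$. A function $g$ is left (resp. right) polyanalytic of order $2$ if $\mathcal{D}^2g=0$ (resp. $g\mathcal{D}^2=0$). The $\mathcal{F}$-kernels are $$F_L(s,q)=-4(s-\bar q)(s^2-2\operatorname{Re}(q)s+|q|^2)^{-2},\qquad F_R(s,q)=-4(s^2-2\operatorname{Re}(q)s+|q|^2)^{-2}(s-\bar q).$$ *)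

theory Defs
  imports "HOL-Complex_Analysis.Complex_Analysis"
begin

section \<open>The skew field of quaternions\<close>

codatatype quat = Quat (Q0: real) (Q1: real) (Q2: real) (Q3: real)

lemma quat_eq_iff: "p = q \<longleftrightarrow> Q0 p = Q0 q \<and> Q1 p = Q1 q \<and> Q2 p = Q2 q \<and> Q3 p = Q3 q"
  by (auto intro: quat.expand)

instantiation quat :: ab_group_add
begin

primcorec zero_quat where
  "Q0 0 = 0" | "Q1 0 = 0" | "Q2 0 = 0" | "Q3 0 = 0"

primcorec plus_quat where
  "Q0 (p + q) = Q0 p + Q0 q"
| "Q1 (p + q) = Q1 p + Q1 q"
| "Q2 (p + q) = Q2 p + Q2 q"
| "Q3 (p + q) = Q3 p + Q3 q"

primcorec minus_quat where
  "Q0 (p - q) = Q0 p - Q0 q"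
| "Q1 (p - q) = Q1 p - Q1 q"
| "Q2 (p - q) = Q2 p - Q2 q"
| "Q3 (p - q) = Q3 p - Q3 q"

primcorec uminus_quat where
  "Q0 (- q) = - Q0 q"
| "Q1 (- q) = - Q1 q"
| "Q2 (- q) = - Q2 q"
| "Q3 (- q) = - Q3 q"

instance
  by standard (simp_all add: quat_eq_iff)

end

instantiation quat :: real_vector
begin

primcorec scaleR_quat where
  "Q0 (r *\<^sub>R q) = r * Q0 q"
| "Q1 (r *\<^sub>R q) = r * Q1 q"
| "Q2 (r *\<^sub>R q) = r * Q2 q"
| "Q3 (r *\<^sub>R q) = r * Q3 q"

instance
  by standard (simp_all add: quat_eq_iff algebra_simps)

end

lemma quotients:
  fixes a b c d n :: real
  assumes "a * a + b * b + c * c + d * d = n" and "n \<noteq> 0"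
  shows "a / n * a - - b / n * b - - c / n * c - - d / n * d = 1"
    and "a * (a / n) - b * (- b / n) - c * (- c / n) - d * (- d / n) = 1"
  using assms by (simp_all add: field_simps)

lemma four_squares:
  fixes a b c d e f g h :: real
  shows "(a * e - b * f - c * g - d * h)\<^sup>2 + (a * f + b * e + c * h - d * g)\<^sup>2 +
         (a * g - b * h + c * e + d * f)\<^sup>2 + (a * h + b * g - c * f + d * e)\<^sup>2 =
         (a\<^sup>2 + b\<^sup>2 + c\<^sup>2 + d\<^sup>2) * (e\<^sup>2 + f\<^sup>2 + g\<^sup>2 + h\<^sup>2)"
  by algebra

instantiation quat :: real_div_algebra
begin

primcorec one_quat where
  "Q0 1 = 1" | "Q1 1 = 0" | "Q2 1 = 0" | "Q3 1 = 0"

primcorec times_quat where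
  "Q0 (p * q) = Q0 p * Q0 q - Q1 p * Q1 q - Q2 p * Q2 q - Q3 p * Q3 q"
| "Q1 (p * q) = Q0 p * Q1 q + Q1 p * Q0 q + Q2 p * Q3 q - Q3 p * Q2 q"
| "Q2 (p * q) = Q0 p * Q2 q - Q1 p * Q3 q + Q2 p * Q0 q + Q3 p * Q1 q"
| "Q3 (p * q) = Q0 p * Q3 q + Q1 p * Q2 q - Q2 p * Q1 q + Q3 p * Q0 q"

primcorec inverse_quat where
  "Q0 (inverse q) = Q0 q / ((Q0 q)\<^sup>2 + (Q1 q)\<^sup>2 + (Q2 q)\<^sup>2 + (Q3 q)\<^sup>2)"
| "Q1 (inverse q) = - Q1 q / ((Q0 q)\<^sup>2 + (Q1 q)\<^sup>2 + (Q2 q)\<^sup>2 + (Q3 q)\<^sup>2)"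
| "Q2 (inverse q) = - Q2 q / ((Q0 q)\<^sup>2 + (Q1 q)\<^sup>2 + (Q2 q)\<^sup>2 + (Q3 q)\<^sup>2)"
| "Q3 (inverse q) = - Q3 q / ((Q0 q)\<^sup>2 + (Q1 q)\<^sup>2 + (Q2 q)\<^sup>2 + (Q3 q)\<^sup>2)"

definition "p div q = p * inverse q" for p q :: quat

instance
proof
  fix p q r :: quat and a :: real
  show "(p * q) * r = p * (q * r)" by (simp add: quat_eq_iff algebra_simps)
  show "(p + q) * r = p * r + q * r" by (simp add: quat_eq_iff algebra_simps)
  show "p * (q + r) = p * q + p * r" by (simp add: quat_eq_iff algebra_simps)
  show "1 * p = p" "p * 1 = p" by (simp_all add: quat_eq_iff)
  show "(0::quat) \<noteq> 1" by (simp add: quat_eq_iff)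
  show "a *\<^sub>R p * q = a *\<^sub>R (p * q)" by (simp add: quat_eq_iff algebra_simps)
  show "p * a *\<^sub>R q = a *\<^sub>R (p * q)" by (simp add: quat_eq_iff algebra_simps)
  show "p div q = p * inverse q" by (rule divide_quat_def)
  show "inverse (0::quat) = 0" by (simp add: quat_eq_iff)
  assume "p \<noteq> 0"
  define n where "n = (Q0 p)\<^sup>2 + (Q1 p)\<^sup>2 + (Q2 p)\<^sup>2 + (Q3 p)\<^sup>2"
  have n0: "n \<noteq> 0"
    using \<open>p \<noteq> 0\<close> by (auto simp: n_def quat_eq_iff add_nonneg_eq_0_iff)
  have n: "Q0 p * Q0 p + Q1 p * Q1 p + Q2 p * Q2 p + Q3 p * Q3 p = n"
    by (simp add: n_def power2_eq_square)
  have inv: "Q0 (inverse p) = Q0 p / n" "Q1 (inverse p) = - Q1 p / n"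
    "Q2 (inverse p) = - Q2 p / n" "Q3 (inverse p) = - Q3 p / n"
    by (simp_all add: n_def)
  show "inverse p * p = 1" "p * inverse p = 1"
    unfolding quat_eq_iff times_quat.sel one_quat.sel inv
    using quotients [OF n n0] by simp_all
qed

end

instantiation quat :: real_normed_div_algebra
begin

definition norm_quat_def:
  "norm q = sqrt ((Q0 q)\<^sup>2 + (Q1 q)\<^sup>2 + (Q2 q)\<^sup>2 + (Q3 q)\<^sup>2)" for q :: quat

definition sgn_quat_def: "sgn q = q /\<^sub>R norm q" for q :: quat

definition dist_quat_def: "dist p q = norm (p - q)" for p q :: quat

definition uniformity_quat_def [code del]:
  "(uniformity :: (quat \<times> quat) filter) = (INF e\<in>{0 <..}. principal {(p, q). dist p q < e})"

definition open_quat_def [code del]: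
  "open (U :: quat set) \<longleftrightarrow> (\<forall>p\<in>U. eventually (\<lambda>(p', q). p' = p \<longrightarrow> q \<in> U) uniformity)"

instance
proof
  fix r :: real and p q :: quat and U :: "quat set"
  have pair: "norm q = norm ((Q0 q, Q1 q), (Q2 q, Q3 q))" for q :: quat
    by (simp only: norm_quat_def norm_prod_def fst_conv snd_conv add.assoc real_sqrt_pow2_iff
          sum_power2_ge_zero real_norm_def power2_abs real_sqrt_pow2)
  show "norm (p + q) \<le> norm p + norm q"
    using norm_triangle_ineq [of "((Q0 p, Q1 p), (Q2 p, Q3 p))" "((Q0 q, Q1 q), (Q2 q, Q3 q))"]
    unfolding pair by simp
  show "(norm q = 0) = (q = 0)"
    unfolding pair norm_eq_zero by (simp add: quat_eq_iff zero_prod_def)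
  show "norm (r *\<^sub>R q) = \<bar>r\<bar> * norm q"
    using norm_scaleR [of r "((Q0 q, Q1 q), (Q2 q, Q3 q))"] unfolding pair scaleR_Pair by simp
  show "norm (p * q) = norm p * norm q"
    unfolding norm_quat_def times_quat.sel real_sqrt_mult [symmetric] four_squares ..
qed (rule sgn_quat_def dist_quat_def open_quat_def uniformity_quat_def)+

end

instantiation quat :: real_inner
begin

definition inner_quat_def:
  "inner p q = Q0 p * Q0 q + Q1 p * Q1 q + Q2 p * Q2 q + Q3 p * Q3 q" for p q :: quat

instance
proof
  fix p q r :: quat and a :: real
  show "inner p q = inner q p" by (simp add: inner_quat_def algebra_simps)
  show "inner (p + q) r = inner p r + inner q r" by (simp add: inner_quat_def algebra_simps)
  show "inner (a *\<^sub>R p) q = a * inner p q" by (simp add: inner_quat_def algebra_simps)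
  show "0 \<le> inner p p" by (simp add: inner_quat_def)
  show "(inner p p = 0) = (p = 0)"
    by (auto simp: inner_quat_def quat_eq_iff add_nonneg_eq_0_iff)
  show "norm p = sqrt (inner p p)" by (simp add: inner_quat_def norm_quat_def power2_eq_square)
qed

end

definition e1 :: quat where "e1 = Quat 0 1 0 0"
definition e2 :: quat where "e2 = Quat 0 0 1 0"
definition e3 :: quat where "e3 = Quat 0 0 0 1"

lemma e_sel [simp]:
  "Q0 e1 = 0" "Q1 e1 = 1" "Q2 e1 = 0" "Q3 e1 = 0"
  "Q0 e2 = 0" "Q1 e2 = 0" "Q2 e2 = 1" "Q3 e2 = 0"
  "Q0 e3 = 0" "Q1 e3 = 0" "Q2 e3 = 0" "Q3 e3 = 1"
  by (simp_all add: e1_def e2_def e3_def)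

instantiation quat :: euclidean_space
begin

definition Basis_quat_def: "Basis = {1, e1, e2, e3}"

instance
proof
  show "(Basis :: quat set) \<noteq> {}" "finite (Basis :: quat set)"
    by (simp_all add: Basis_quat_def)
next
  fix u v :: quat
  have "1 \<noteq> e1" "1 \<noteq> e2" "1 \<noteq> e3" "e1 \<noteq> e2" "e1 \<noteq> e3" "e2 \<noteq> e3"
    by (simp_all add: quat_eq_iff)
  moreover assume "u \<in> Basis" "v \<in> Basis"
  ultimately show "inner u v = (if u = v then 1 else 0)"
    unfolding Basis_quat_def by (elim insertE emptyE) (simp_all add: inner_quat_def)
next
  fix x :: quat
  show "(\<forall>u\<in>Basis. inner x u = 0) \<longleftrightarrow> x = 0"
    unfolding quat_eq_iff [of x 0] by (simp add: Basis_quat_def inner_quat_def)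
qed

end

definition qcnj :: "quat \<Rightarrow> quat" where
  "qcnj q = Quat (Q0 q) (- Q1 q) (- Q2 q) (- Q3 q)"

lemma e_mult:
  "e1 * e1 = -1" "e2 * e2 = -1" "e3 * e3 = -1"
  "e1 * e2 = e3" "e2 * e1 = - e3" "e2 * e3 = e1" "e3 * e2 = - e1" "e3 * e1 = e2" "e1 * e3 = - e2"
  by (simp_all add: quat_eq_iff)

lemma quat_of_real_sel [simp]:
  "Q0 (of_real r) = r" "Q1 (of_real r) = 0" "Q2 (of_real r) = 0" "Q3 (of_real r) = 0"
  by (simp_all add: of_real_def)

lemma quat_expansion:
  "q = of_real (Q0 q) + of_real (Q1 q) * e1 + of_real (Q2 q) * e2 + of_real (Q3 q) * e3"
  by (simp add: quat_eq_iff)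

lemma mult_qcnj: "q * qcnj q = of_real ((norm q)\<^sup>2)"
  by (simp add: quat_eq_iff qcnj_def norm_quat_def) (simp add: power2_eq_square)

definition imag_units :: "quat set" where
  "imag_units = {q. Q0 q = 0 \<and> norm q = 1}"


section \<open>Slice hyperholomorphic functions\<close>

definition axially_symmetric :: "quat set \<Rightarrow> bool" where
  "axially_symmetric U \<longleftrightarrow>
     (\<forall>u v. (\<exists>I\<in>imag_units. of_real u + I * of_real v \<in> U) \<longrightarrow>
            (\<forall>J\<in>imag_units. of_real u + J * of_real v \<in> U))"

definition slice_domain :: "quat set \<Rightarrow> (real \<times> real) set" where
  "slice_domain U = {(u, v). \<forall>I\<in>imag_units. of_real u + I * of_real v \<in> U}"

definition partial_deriv ::
    "'a::real_normed_vector \<Rightarrow> ('a \<Rightarrow> 'b::real_normed_vector) \<Rightarrow> 'a \<Rightarrow> 'b" where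
  "partial_deriv e f p = vector_derivative (\<lambda>t. f (p + t *\<^sub>R e)) (at 0)"

text \<open>
  The conditions on the components \<open>\<alpha>\<close>, \<open>\<beta>\<close> that are common to left and right slice
  hyperholomorphic functions. Functions are total, and only their values on the domain in question
  matter; all domains are open, so the derivatives below do not see values outside.
\<close>

definition slice_components ::
    "quat set \<Rightarrow> (real \<times> real \<Rightarrow> quat) \<Rightarrow> (real \<times> real \<Rightarrow> quat) \<Rightarrow> bool" where
  "slice_components U \<alpha> \<beta> \<longleftrightarrow>
     (\<forall>u v. (u, v) \<in> slice_domain U \<longrightarrow>
        \<alpha> differentiable (at (u, v)) \<and> \<beta> differentiable (at (u, v)) \<and>
        \<alpha> (u, v) = \<alpha> (u, - v) \<and> \<beta> (u, v) = - \<beta> (u, - v) \<and>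
        partial_deriv (1, 0) \<alpha> (u, v) - partial_deriv (0, 1) \<beta> (u, v) = 0 \<and>
        partial_deriv (0, 1) \<alpha> (u, v) + partial_deriv (1, 0) \<beta> (u, v) = 0)"

definition SH_L :: "quat set \<Rightarrow> (quat \<Rightarrow> quat) set" where
  "SH_L U = {f. \<exists>\<alpha> \<beta>. slice_components U \<alpha> \<beta> \<and>
     (\<forall>u v. (u, v) \<in> slice_domain U \<longrightarrow>
        (\<forall>J\<in>imag_units. f (of_real u + J * of_real v) = \<alpha> (u, v) + J * \<beta> (u, v)))}"

definition SH_R :: "quat set \<Rightarrow> (quat \<Rightarrow> quat) set" where
  "SH_R U = {f. \<exists>\<alpha> \<beta>. slice_components U \<alpha> \<beta> \<and>
     (\<forall>u v. (u, v) \<in> slice_domain U \<longrightarrow>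
        (\<forall>J\<in>imag_units. f (of_real u + J * of_real v) = \<alpha> (u, v) + \<beta> (u, v) * J))}"


section \<open>Fueter operators and polyanalytic functions\<close>

definition fueter_left :: "(quat \<Rightarrow> quat) \<Rightarrow> quat \<Rightarrow> quat" where
  "fueter_left f q = partial_deriv 1 f q
     + (e1 * partial_deriv e1 f q + e2 * partial_deriv e2 f q + e3 * partial_deriv e3 f q)"

definition fueter_conj_left :: "(quat \<Rightarrow> quat) \<Rightarrow> quat \<Rightarrow> quat" where
  "fueter_conj_left f q = partial_deriv 1 f q
     - (e1 * partial_deriv e1 f q + e2 * partial_deriv e2 f q + e3 * partial_deriv e3 f q)"

definition fueter_right :: "(quat \<Rightarrow> quat) \<Rightarrow> quat \<Rightarrow> quat" where
  "fueter_right f q = partial_deriv 1 f q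
     + (partial_deriv e1 f q * e1 + partial_deriv e2 f q * e2 + partial_deriv e3 f q * e3)"

definition fueter_conj_right :: "(quat \<Rightarrow> quat) \<Rightarrow> quat \<Rightarrow> quat" where
  "fueter_conj_right f q = partial_deriv 1 f q
     - (partial_deriv e1 f q * e1 + partial_deriv e2 f q * e2 + partial_deriv e3 f q * e3)"

text \<open>
  \<open>C_diff n U g\<close>: all partial derivatives of \<open>g\<close> of order at most \<open>n\<close> exist and are continuous
  on the open set \<open>U\<close>. It is part of the definition of polyanalyticity because
  \<^const>\<open>vector_derivative\<close> is also defined, without meaning, at points of nondifferentiability.
\<close>

fun C_diff :: "nat \<Rightarrow> quat set \<Rightarrow> (quat \<Rightarrow> quat) \<Rightarrow> bool" where
  "C_diff 0 U g \<longleftrightarrow> continuous_on U g"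
| "C_diff (Suc n) U g \<longleftrightarrow> continuous_on U g \<and>
     (\<forall>e\<in>{1, e1, e2, e3}. (\<forall>q\<in>U. (\<lambda>t::real. g (q + t *\<^sub>R e)) differentiable (at 0)) \<and>
        C_diff n U (partial_deriv e g))"

definition left_polyanalytic2 :: "quat set \<Rightarrow> (quat \<Rightarrow> quat) \<Rightarrow> bool" where
  "left_polyanalytic2 U g \<longleftrightarrow> C_diff 2 U g \<and> (\<forall>q\<in>U. fueter_left (fueter_left g) q = 0)"

definition right_polyanalytic2 :: "quat set \<Rightarrow> (quat \<Rightarrow> quat) \<Rightarrow> bool" where
  "right_polyanalytic2 U g \<longleftrightarrow> C_diff 2 U g \<and> (\<forall>q\<in>U. fueter_right (fueter_right g) q = 0)"


section \<open>Slice Cauchy domains and integrals over their boundaries\<close>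

text \<open>
  The plane $\mathbb{C}_J$ is parametrised by the complex numbers via $u + iv \mapsto u + Jv$;
  this isometry also fixes the orientation of $\mathbb{C}_J$. A subset of $\mathbb{C}_J$ is
  treated through its preimage.
\<close>

definition in_slice :: "quat \<Rightarrow> complex \<Rightarrow> quat" where
  "in_slice J z = of_real (Re z) + J * of_real (Im z)"

definition slice :: "quat set \<Rightarrow> quat \<Rightarrow> complex set" where
  "slice U J = {z. in_slice J z \<in> U}"

text \<open>
  \<open>\<Gamma>\<close> is a family of parametrisations of the curves that make up $\partial(U \cap \mathbb{C}_J)$,
  positively oriented with respect to $U \cap \mathbb{C}_J$: outer boundary curves run
  counterclockwise and boundary curves of holes run clockwise. For several curves this is expressed
  by the total winding number, which is 1 about points of the domain and 0 about points off its
  closure.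
\<close>

definition pos_boundary :: "quat set \<Rightarrow> quat \<Rightarrow> (real \<Rightarrow> complex) set \<Rightarrow> bool" where
  "pos_boundary U J \<Gamma> \<longleftrightarrow>
     finite \<Gamma> \<and>
     (\<forall>\<gamma>\<in>\<Gamma>. valid_path \<gamma> \<and> simple_path \<gamma> \<and> pathfinish \<gamma> = pathstart \<gamma>) \<and>
     pairwise (\<lambda>\<gamma> \<delta>. path_image \<gamma> \<inter> path_image \<delta> = {}) \<Gamma> \<and>
     (\<Union>\<gamma>\<in>\<Gamma>. path_image \<gamma>) = frontier (slice U J) \<and>
     (\<forall>z\<in>slice U J. (\<Sum>\<gamma>\<in>\<Gamma>. winding_number \<gamma> z) = 1) \<and>
     (\<forall>z. z \<notin> closure (slice U J) \<longrightarrow> (\<Sum>\<gamma>\<in>\<Gamma>. winding_number \<gamma> z) = 0)"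

definition slice_Cauchy_domain :: "quat set \<Rightarrow> bool" where
  "slice_Cauchy_domain U \<longleftrightarrow>
     axially_symmetric U \<and> open U \<and> (\<forall>J\<in>imag_units. \<exists>\<Gamma>. pos_boundary U J \<Gamma>)"

text \<open>
  The integral of $G(s)\,ds_J\,H(s)$ with $ds_J = ds\,(-J)$ over the curves in \<open>\<Gamma>\<close>; the order of
  the factors matters.
\<close>

definition slice_integrand ::
    "quat \<Rightarrow> (real \<Rightarrow> complex) \<Rightarrow> (quat \<Rightarrow> quat) \<Rightarrow> (quat \<Rightarrow> quat) \<Rightarrow> real \<Rightarrow> quat" where
  "slice_integrand J \<gamma> G H t =
     (let s = in_slice J \<circ> \<gamma>
      in G (s t) * (vector_derivative s (at t within {0..1}) * (- J)) * H (s t))"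

definition slice_integrable ::
    "quat \<Rightarrow> (real \<Rightarrow> complex) set \<Rightarrow> (quat \<Rightarrow> quat) \<Rightarrow> (quat \<Rightarrow> quat) \<Rightarrow> bool" where
  "slice_integrable J \<Gamma> G H \<longleftrightarrow> (\<forall>\<gamma>\<in>\<Gamma>. slice_integrand J \<gamma> G H integrable_on {0..1})"

definition slice_integral ::
    "quat \<Rightarrow> (real \<Rightarrow> complex) set \<Rightarrow> (quat \<Rightarrow> quat) \<Rightarrow> (quat \<Rightarrow> quat) \<Rightarrow> quat" where
  "slice_integral J \<Gamma> G H = (\<Sum>\<gamma>\<in>\<Gamma>. integral {0..1} (slice_integrand J \<gamma> G H))"


section \<open>The F-kernels\<close>

definition F_L :: "quat \<Rightarrow> quat \<Rightarrow> quat" where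
  "F_L s q = - 4 * (s - qcnj q) *
     (s ^ 2 - 2 * of_real (Q0 q) * s + of_real ((norm q)\<^sup>2)) powi (- 2)"

definition F_R :: "quat \<Rightarrow> quat \<Rightarrow> quat" where
  "F_R s q = - 4 * (s ^ 2 - 2 * of_real (Q0 q) * s + of_real ((norm q)\<^sup>2)) powi (- 2) *
     (s - qcnj q)"

end

theory Submission
  imports Defs
begin

text \<open>
  Write \<open>q = q\<^sub>0 + I y\<close> with \<open>y \<ge> 0\<close>, and let \<open>f(u + Jv) = \<alpha>(u, v) + J \<beta>(u, v)\<close> be left slice
  hyperholomorphic. For each of the four coordinates \<open>b\<close> the function \<open>F\<^sub>b = \<alpha>\<^sub>b + \<i> \<beta>\<^sub>b\<close> is holomorphic
  on a planar domain \<open>D\<close> symmetric about the real axis, and \<open>F\<^sub>b\<close> commutes with conjugation. With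
  \<open>Q\<^sub>q(\<zeta>) = (\<zeta> - q\<^sub>0)\<^sup>2 + y\<^sup>2\<close>, Cauchy's formula at the two points \<open>q\<^sub>0 \<plusminus> \<i> y\<close> says that
  \<open>f(q) = M\<^sub>1\<^sub>1(q) - qcnj q M\<^sub>1\<^sub>0(q)\<close>, where \<open>M\<^sub>n\<^sub>j(q)\<close> is the quaternion whose coordinates are the moments
  \<open>(1 / 2 \<pi> \<i>) \<integral> \<zeta>\<^sup>j F\<^sub>b(\<zeta>) Q\<^sub>q(\<zeta>)\<^sup>-\<^sup>n d\<zeta>\<close>. All quaternionic noncommutativity is now in the factor \<open>qcnj q\<close>.

  Two rules are all that is needed to compute with moments. Differentiating \<open>Q\<^sub>q\<^sup>-\<^sup>n\<close> under the integral,
  the derivative of \<open>M\<^sub>n\<^sub>j\<close> in direction \<open>e\<close> is \<open>2n (Re(e) M\<^sub>n\<^sub>+\<^sub>1\<^sub>,\<^sub>j\<^sub>+\<^sub>1 - (q \<bullet> e) M\<^sub>n\<^sub>+\<^sub>1\<^sub>,\<^sub>j)\<close>; cancelling one factor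
  \<open>Q\<^sub>q(\<zeta>) = \<zeta>\<^sup>2 - 2 q\<^sub>0 \<zeta> + |q|\<^sup>2\<close> gives \<open>M\<^sub>n\<^sub>j = M\<^sub>n\<^sub>+\<^sub>1\<^sub>,\<^sub>j\<^sub>+\<^sub>2 - 2 q\<^sub>0 M\<^sub>n\<^sub>+\<^sub>1\<^sub>,\<^sub>j\<^sub>+\<^sub>1 + |q|\<^sup>2 M\<^sub>n\<^sub>+\<^sub>1\<^sub>,\<^sub>j\<close>. Hence moments are
  smooth, and the Fueter operators act on \<open>f\<close> by pure algebra:
  the conjugate operator gives \<open>4 (M\<^sub>2\<^sub>2 - (q\<^sub>0 + qcnj q) M\<^sub>2\<^sub>1 + q\<^sub>0 qcnj q M\<^sub>2\<^sub>0)\<close>, the Fueter operator maps this to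
  \<open>- 4 (M\<^sub>2\<^sub>1 - qcnj q M\<^sub>2\<^sub>0)\<close>, and a second application gives \<open>0\<close>
  (lemmas \<open>fueter_conj_left_cauchy\<close>, \<open>fueter_left_conj_cauchy\<close>, \<open>fueter_left_F\<close>). This is polyanalyticity of order 2.

  For the integrals, everything in \<open>F_L(s, q) s\<^sup>m ds\<^sub>J f(s)\<close> lies in the plane of \<open>J\<close> except \<open>qcnj q\<close> and the
  coordinate vectors, which stand to the left and right of the remaining factors. The integral is therefore
  assembled from images of complex contour integrals, and equals \<open>- 8 \<pi> (M\<^sub>2\<^sub>,\<^sub>m\<^sub>+\<^sub>1 - qcnj q M\<^sub>2\<^sub>,\<^sub>m)\<close>, because moments are real
  (lemmas \<open>moment_real\<close>, \<open>slice_integral_F_L\<close>). This value depends on \<open>f\<close> and \<open>q\<close> alone, and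
  combining \<open>m = 1\<close> with \<open>m = 0\<close> reproduces the expression for the conjugate Fueter operator.
  Right slice hyperholomorphic functions are treated by the mirror image of these computations.

  A boundary may consist of several curves around different components, and the derivative of a piecewise
  continuously differentiable curve may be unbounded near a breakpoint, so limits under the integral are
  not taken on it. The moments are instead defined as sums of residues. A residue theorem for cycles
  (\<open>residue_theorem_cycle\<close>) identifies them with the integral over any enclosing family of closed curves:
  over the given boundary for the representation formula, and over small circles for differentiation.
\<close>

section \<open>The residue theorem for cycles\<close>

definition cycle_in :: "complex set \<Rightarrow> (real \<Rightarrow> complex) set \<Rightarrow> bool" where
  "cycle_in S \<Gamma> \<longleftrightarrow> finite \<Gamma> \<and>
     (\<forall>\<gamma>\<in>\<Gamma>. valid_path \<gamma> \<and> pathfinish \<gamma> = pathstart \<gamma> \<and> path_image \<gamma> \<subseteq> S)"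

definition cycle_winding :: "(real \<Rightarrow> complex) set \<Rightarrow> complex \<Rightarrow> complex" where
  "cycle_winding \<Gamma> z = (\<Sum>\<gamma>\<in>\<Gamma>. winding_number \<gamma> z)"

text \<open>
  Connect each further loop to the one obtained so far by an auxiliary path and run along it forth and back: the
  two passes cancel, so one closed path carries the integrals of the whole family.
\<close>

lemma join_cycle:
  assumes S: "open S" "connected S" and \<Gamma>: "cycle_in S \<Gamma>" "\<Gamma> \<noteq> {}"
  shows "\<exists>g. valid_path g \<and> pathfinish g = pathstart g \<and> path_image g \<subseteq> S \<and>
           (\<forall>h. h holomorphic_on S \<longrightarrow>
              contour_integral g h = (\<Sum>\<gamma>\<in>\<Gamma>. contour_integral \<gamma> h))"
proof -
  have "finite \<Gamma>" using \<Gamma>(1) by (simp add: cycle_in_def)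
  then show ?thesis using \<Gamma>(2,1)
  proof (induction rule: finite_ne_induct)
    case (singleton \<gamma>)
    then show ?case by (intro exI[of _ \<gamma>]) (auto simp: cycle_in_def)
  next
    case (insert \<gamma> \<Gamma>)
    then have \<gamma>: "valid_path \<gamma>" "pathfinish \<gamma> = pathstart \<gamma>" "path_image \<gamma> \<subseteq> S"
      and "cycle_in S \<Gamma>"
      by (auto simp: cycle_in_def)
    with insert obtain g where g: "valid_path g" "pathfinish g = pathstart g" "path_image g \<subseteq> S"
      and gh: "\<And>h. h holomorphic_on S \<Longrightarrow>
                 contour_integral g h = (\<Sum>\<gamma>\<in>\<Gamma>. contour_integral \<gamma> h)"
      by blast
    have "pathstart g \<in> S" "pathstart \<gamma> \<in> S"
      using g \<gamma> by (meson pathstart_in_path_image subsetD)+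
    then obtain p where p: "polynomial_function p" "path_image p \<subseteq> S"
        "pathstart p = pathstart g" "pathfinish p = pathstart \<gamma>"
      using connected_open_polynomial_connected[OF S] by blast
    have vp: "valid_path p" by (rule valid_path_polynomial_function[OF p(1)])
    (* The loop at the end of p, reached along p and left along its reverse. *)
    define c where "c = g +++ (p +++ (\<gamma> +++ reversepath p))"
    have "valid_path c" "pathfinish c = pathstart c" "path_image c \<subseteq> S"
      using g \<gamma> p vp by (auto simp: c_def path_image_join valid_path_join)
    moreover have "contour_integral c h = (\<Sum>\<gamma>\<in>insert \<gamma> \<Gamma>. contour_integral \<gamma> h)"
      if h: "h holomorphic_on S" for h
    proof -
      note I = contour_integrable_holomorphic_simple[OF h S(1)]
      have I': "h contour_integrable_on g" "h contour_integrable_on p" "h contour_integrable_on \<gamma>"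
          "h contour_integrable_on reversepath p"
        using g \<gamma> p vp by (auto intro!: I)
      show ?thesis
        unfolding c_def using g \<gamma> p vp I' gh[OF h] insert.hyps
        by (simp add: contour_integral_reversepath contour_integrable_joinI valid_path_join)
    qed
    ultimately show ?case by blast
  qed
qed

text \<open>
  The vanishing of a total winding number off a disjoint union of two open sets splits into two separate
  statements. Outside \<open>C\<close> the winding number of \<open>\<Gamma>\<close> is continuous; inside \<open>C\<close> the negative
  of that of \<open>\<Gamma>'\<close> is, and the two agree off \<open>C \<union> C'\<close>. Glued together they form a continuous
  integer-valued function on the whole plane, which is constant and vanishes near infinity.
\<close>

lemma cycle_winding_separate:
  assumes C: "open C" "open C'" "C \<inter> C' = {}"
    and \<Gamma>: "cycle_in C \<Gamma>" and \<Gamma>': "cycle_in C' \<Gamma>'"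
    and off: "\<And>z. z \<notin> C \<union> C' \<Longrightarrow> cycle_winding \<Gamma> z + cycle_winding \<Gamma>' z = 0"
    and z: "z \<notin> C"
  shows "cycle_winding \<Gamma> z = 0"
proof -
  define n where "n = cycle_winding \<Gamma>"
  define n' where "n' = cycle_winding \<Gamma>'"
  define h where "h = (\<lambda>a. if a \<in> C then - n' a else n a)"
  have cont: "isCont (cycle_winding \<Delta>) a" if "cycle_in D \<Delta>" "a \<notin> D" for D \<Delta> a
    unfolding cycle_winding_def using that
    by (intro continuous_intros continuous_at_winding_number)
       (auto simp: cycle_in_def valid_path_imp_path)
  have n: "isCont n a" if "a \<notin> C" for a using cont[OF \<Gamma> that] by (simp add: n_def)
  have n': "isCont n' a" if "a \<notin> C'" for a using cont[OF \<Gamma>' that] by (simp add: n'_def)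
  have Z: "cycle_winding \<Delta> a \<in> \<int>" if "cycle_in D \<Delta>" "a \<notin> D" for D \<Delta> a
    unfolding cycle_winding_def using that
    by (intro Ints_sum integer_winding_number) (auto simp: cycle_in_def valid_path_imp_path)
  have hZ: "h a \<in> \<int>" for a
    using Z[OF \<Gamma>] Z[OF \<Gamma>'] C(3) by (auto simp: h_def n_def n'_def)
  have hcont: "isCont h a" for a
  proof (cases "a \<in> C")
    case True
    then have "isCont (\<lambda>a. - n' a) a" using n'[of a] C(3) by (intro continuous_intros) auto
    moreover have "eventually (\<lambda>b. h b = - n' b) (nhds a)"
      using eventually_nhds_in_open[OF C(1) True] by eventually_elim (simp add: h_def)
    ultimately show ?thesis by (subst isCont_cong)
  next
    case aC: False
    show ?thesis
    proof (cases "a \<in> C'")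
      case True
      have "eventually (\<lambda>b. h b = n b) (nhds a)"
        using eventually_nhds_in_open[OF C(2) True] by eventually_elim (use C(3) in \<open>auto simp: h_def\<close>)
      then show ?thesis using n[OF aC] by (subst isCont_cong)
    next
      case False
      then have eq: "- n' a = n a" using off[of a] aC by (simp add: n_def n'_def add_eq_0_iff)
      have "((\<lambda>b. - n' b) \<longlongrightarrow> h a) (at a)"
        using n'[OF False] aC eq by (auto simp: isCont_def h_def intro: tendsto_eq_intros)
      moreover have "(n \<longlongrightarrow> h a) (at a)"
        using n[OF aC] aC by (simp add: isCont_def h_def)
      ultimately show ?thesis
        unfolding isCont_def by (subst h_def) (rule filterlim_at_If; auto intro: tendsto_mono[OF at_le])
    qed
  qed
  have "h constant_on UNIV"
  proof (rule continuous_discrete_range_constant)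
    show "continuous_on UNIV h" using hcont by (simp add: continuous_at_imp_continuous_on)
    have "1 \<le> norm (h b - h a)" if "h b \<noteq> h a" for a b
    proof -
      from Ints_diff[OF hZ hZ] obtain k where k: "h b - h a = of_int k" by (blast elim: Ints_cases)
      with that have "k \<noteq> 0" by auto
      then show ?thesis by (simp add: k)
    qed
    then show "\<exists>e>0. \<forall>y. y \<in> UNIV \<and> h y \<noteq> h x \<longrightarrow> e \<le> norm (h y - h x)" for x
      by (intro exI[of _ 1]) auto
  qed auto
  moreover have "\<exists>a. h a = 0"
  proof -
    have "\<exists>B. \<forall>z. B \<le> norm z \<longrightarrow> cycle_winding \<Delta> z = 0" if "cycle_in D \<Delta>" for D \<Delta>
    proof -
      have "\<forall>\<^sub>F z in at_infinity. winding_number \<gamma> z = 0" if "\<gamma> \<in> \<Delta>" for \<gamma>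
        using winding_number_zero_at_infinity[of \<gamma>] that \<open>cycle_in D \<Delta>\<close>
        by (auto simp: cycle_in_def valid_path_imp_path eventually_at_infinity)
      then have "\<forall>\<^sub>F z in at_infinity. \<forall>\<gamma>\<in>\<Delta>. winding_number \<gamma> z = 0"
        using that by (intro eventually_ball_finite) (auto simp: cycle_in_def)
      then have "\<forall>\<^sub>F z in at_infinity. cycle_winding \<Delta> z = 0"
        by eventually_elim (simp add: cycle_winding_def)
      then show ?thesis by (simp add: eventually_at_infinity)
    qed
    from this[OF \<Gamma>] this[OF \<Gamma>'] obtain B B' where
      B: "\<And>z. B \<le> norm z \<Longrightarrow> n z = 0" and B': "\<And>z. B' \<le> norm z \<Longrightarrow> n' z = 0"
      unfolding n_def n'_def by blast
    show ?thesis
      by (intro exI[of _ "of_real (max \<bar>B\<bar> \<bar>B'\<bar>)"]) (auto simp: h_def intro!: B B')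
  qed
  ultimately have "h z = 0" unfolding constant_on_def by auto
  then show ?thesis using z by (simp add: h_def n_def)
qed

text \<open>
  The poles are removed before joining, so that the joining paths avoid them and the winding numbers about the
  poles are preserved as well.
\<close>

lemma residue_theorem_connected_cycle:
  assumes S: "open S" "connected S" and pts: "finite pts" and h: "h holomorphic_on S - pts"
    and \<Gamma>: "cycle_in (S - pts) \<Gamma>" and off: "\<And>z. z \<notin> S \<Longrightarrow> cycle_winding \<Gamma> z = 0"
  shows "(\<Sum>\<gamma>\<in>\<Gamma>. contour_integral \<gamma> h) =
           2 * pi * \<i> * (\<Sum>p\<in>pts. cycle_winding \<Gamma> p * residue h p)"
proof (cases "\<Gamma> = {}")
  case True
  then show ?thesis by (simp add: cycle_winding_def)
next
  case False
  have oc: "open (S - pts)" "connected (S - pts)"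
    using S pts by (auto intro: open_Diff finite_imp_closed connected_open_delete_finite)
  obtain g where g: "valid_path g" "pathfinish g = pathstart g" "path_image g \<subseteq> S - pts"
    and gh: "\<And>h. h holomorphic_on (S - pts) \<Longrightarrow>
               contour_integral g h = (\<Sum>\<gamma>\<in>\<Gamma>. contour_integral \<gamma> h)"
    using join_cycle[OF oc \<Gamma> False] by blast
  have w: "winding_number g a = cycle_winding \<Gamma> a" if "a \<notin> S - pts" for a
  proof -
    have "winding_number \<gamma> a = 1/(2*pi*\<i>) * contour_integral \<gamma> (\<lambda>w. 1/(w - a))" if "\<gamma> \<in> \<Gamma>" for \<gamma>
      using that \<open>a \<notin> S - pts\<close> \<Gamma> by (intro winding_number_valid_path) (auto simp: cycle_in_def)
    moreover have "(\<lambda>w. 1/(w - a)) holomorphic_on S - pts"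
      using that by (auto intro!: holomorphic_intros)
    moreover have "winding_number g a = 1/(2*pi*\<i>) * contour_integral g (\<lambda>w. 1/(w - a))"
      using that g by (intro winding_number_valid_path) auto
    ultimately show ?thesis
      by (simp add: gh cycle_winding_def sum_distrib_left del: mult_eq_0_iff)
  qed
  have "contour_integral g h = 2 * pi * \<i> * (\<Sum>p\<in>pts. winding_number g p * residue h p)"
    by (rule Residue_theorem[OF S pts h g]) (use off w in auto)
  then show ?thesis by (simp add: gh[OF h] w)
qed

text \<open>
  In a disconnected domain no single closed path replaces the cycle. The cycle is sorted by connected
  components instead; \<open>cycle_winding_separate\<close>, applied to one component and the union of the others, shows that each
  part is again null-homologous in its own component.
\<close>

theorem residue_theorem_cycle:
  assumes S: "open S" and pts: "finite pts" and h: "h holomorphic_on S - pts"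
    and \<Gamma>: "cycle_in (S - pts) \<Gamma>" and off: "\<And>z. z \<notin> S \<Longrightarrow> cycle_winding \<Gamma> z = 0"
  shows "(\<Sum>\<gamma>\<in>\<Gamma>. contour_integral \<gamma> h) =
           2 * pi * \<i> * (\<Sum>p\<in>pts. cycle_winding \<Gamma> p * residue h p)"
proof -
  define comp where "comp \<gamma> = connected_component_set S (pathstart \<gamma>)" for \<gamma>
  define \<Gamma>C where "\<Gamma>C C = {\<gamma>\<in>\<Gamma>. comp \<gamma> = C}" for C
  have fin: "finite \<Gamma>" using \<Gamma> by (simp add: cycle_in_def)
  have in_comp: "path_image \<gamma> \<subseteq> comp \<gamma>" if "\<gamma> \<in> \<Gamma>" for \<gamma>
    unfolding comp_def using that \<Gamma>
    by (intro connected_component_maximal)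
       (auto simp: cycle_in_def connected_path_image valid_path_imp_path)
  have part: "(\<Sum>\<gamma>\<in>\<Gamma>. u \<gamma>) = (\<Sum>C\<in>comp ` \<Gamma>. \<Sum>\<gamma>\<in>\<Gamma>C C. u \<gamma>)" for u :: "_ \<Rightarrow> complex"
    unfolding \<Gamma>C_def by (rule sum.group[symmetric]) (use fin in auto)
  have one: "(\<Sum>\<gamma>\<in>\<Gamma>C C. contour_integral \<gamma> h) =
      2 * pi * \<i> * (\<Sum>p\<in>pts. cycle_winding (\<Gamma>C C) p * residue h p)" if C_in: "C \<in> comp ` \<Gamma>" for C
  proof (rule residue_theorem_connected_cycle)
    obtain \<gamma> where \<gamma>: "\<gamma> \<in> \<Gamma>" "C = comp \<gamma>" using C_in by blast
    then have C: "C = connected_component_set S (pathstart \<gamma>)" by (simp add: comp_def)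
    show oC: "open C" and "connected C" unfolding C using S by (auto intro: open_connected_component)
    show "finite pts" by fact
    have sub: "C \<subseteq> S" unfolding C by (rule connected_component_subset)
    show "h holomorphic_on C - pts" using h sub by (meson Diff_mono holomorphic_on_subset order_refl)
    show cyc: "cycle_in (C - pts) (\<Gamma>C C)"
      using \<Gamma> in_comp by (auto simp: cycle_in_def \<Gamma>C_def)
    (* The union of the other components is open because each of them is. *)
    define C' where "C' = S - C"
    have "C' = \<Union> (connected_component_set S ` C')"
    proof -
      have "connected_component_set S x \<subseteq> C'" if "x \<in> C'" for x
      proof -
        have "connected_component_set S x \<inter> C = {}"
          using that unfolding C C'_def
          by (metis Diff_iff connected_component_disjoint connected_component_eq connected_component_refl_eq mem_Collect_eq)
        then show ?thesis using connected_component_subset[of S x] by (auto simp: C'_def)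
      qed
      moreover have "x \<in> connected_component_set S x" if "x \<in> C'" for x
        using that by (simp add: C'_def connected_component_refl)
      ultimately show ?thesis by blast
    qed
    moreover have "open (\<Union> (connected_component_set S ` C'))"
      using S by (auto intro: open_connected_component)
    ultimately have oC': "open C'" by simp
    have cyc': "cycle_in C' (\<Gamma> - \<Gamma>C C)"
    proof -
      have "path_image \<delta> \<subseteq> C'" if "\<delta> \<in> \<Gamma>" "comp \<delta> \<noteq> C" for \<delta>
      proof -
        have "comp \<delta> \<inter> C = {}"
          using that(2) unfolding C comp_def
          by (metis connected_component_eq connected_component_disjoint mem_Collect_eq)
        moreover have "comp \<delta> \<subseteq> S" unfolding comp_def by (rule connected_component_subset)
        ultimately show ?thesis using in_comp[OF that(1)] by (auto simp: C'_def)
      qed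
      then show ?thesis using \<Gamma> by (auto simp: cycle_in_def \<Gamma>C_def)
    qed
    show "cycle_winding (\<Gamma>C C) z = 0" if "z \<notin> C" for z
    proof (rule cycle_winding_separate[OF oC oC' _ _ cyc' _ that])
      show "C \<inter> C' = {}" by (auto simp: C'_def)
      show "cycle_in C (\<Gamma>C C)" using cyc by (auto simp: cycle_in_def)
      have "cycle_winding \<Gamma> a = cycle_winding (\<Gamma>C C) a + cycle_winding (\<Gamma> - \<Gamma>C C) a" for a
        unfolding cycle_winding_def using fin
        by (subst sum.subset_diff[of "\<Gamma>C C" \<Gamma>]) (auto simp: \<Gamma>C_def)
      then show "cycle_winding (\<Gamma>C C) a + cycle_winding (\<Gamma> - \<Gamma>C C) a = 0" if "a \<notin> C \<union> C'" for a
        using off[of a] that by (simp add: C'_def)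
    qed
  qed
  have "(\<Sum>\<gamma>\<in>\<Gamma>. contour_integral \<gamma> h) =
      (\<Sum>C\<in>comp ` \<Gamma>. 2 * pi * \<i> * (\<Sum>p\<in>pts. cycle_winding (\<Gamma>C C) p * residue h p))"
    unfolding part by (rule sum.cong) (use one in auto)
  also have "\<dots> = 2 * pi * \<i> * (\<Sum>C\<in>comp ` \<Gamma>. \<Sum>p\<in>pts. cycle_winding (\<Gamma>C C) p * residue h p)"
    by (simp add: sum_distrib_left)
  also have "(\<Sum>C\<in>comp ` \<Gamma>. \<Sum>p\<in>pts. cycle_winding (\<Gamma>C C) p * residue h p) =
      (\<Sum>p\<in>pts. cycle_winding \<Gamma> p * residue h p)"
    by (subst sum.swap) (simp add: cycle_winding_def part[of "\<lambda>\<gamma>. winding_number \<gamma> _"] sum_distrib_right)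
  finally show ?thesis .
qed

section \<open>Circle integrals depending on a parameter\<close>

text \<open>
  Compactness of \<open>C\<close> makes continuity in the parameter uniform over \<open>C\<close>; this is what permits limits
  under the integral sign.
\<close>

lemma uniform_limit_compact_parameter:
  fixes f :: "'a::topological_space \<Rightarrow> 'b::topological_space \<Rightarrow> 'c::metric_space"
  assumes "continuous_on (V \<times> C) (\<lambda>(x, t). f x t)" "compact C" "open V" "x0 \<in> V"
  shows "uniform_limit C f (f x0) (at x0)"
proof (rule uniform_limitI)
  fix e :: real assume "e > 0"
  then have e2: "e / 2 > 0" by simp
  obtain X0 where X0: "x0 \<in> X0" "open X0"
      "\<forall>x\<in>X0 \<inter> V. \<forall>t\<in>C. dist ((\<lambda>(x, t). f x t) (x, t)) ((\<lambda>(x, t). f x t) (x0, t)) \<le> e / 2"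
    by (rule continuous_on_prod_compactE[OF assms(1,2,4) e2])
  have "\<forall>\<^sub>F x in at x0. x \<in> X0 \<inter> V"
    by (rule eventually_at_in_open') (use X0 assms in auto)
  then show "\<forall>\<^sub>F x in at x0. \<forall>t\<in>C. dist (f x t) (f x0 t) < e"
  proof eventually_elim
    case (elim x)
    have "dist (f x t) (f x0 t) < e" if "t \<in> C" for t
    proof -
      have "dist (f x t) (f x0 t) \<le> e / 2" using X0(3) elim that by simp
      with e2 show ?thesis by linarith
    qed
    then show ?case by blast
  qed
qed

lemma circle_integral_continuous_parameter:
  fixes f :: "'a::t2_space \<Rightarrow> complex \<Rightarrow> complex"
  assumes c: "continuous_on (V \<times> sphere z r) (\<lambda>(x, \<zeta>). f x \<zeta>)" and V: "open V" "x0 \<in> V" and r: "r > 0"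
  shows "isCont (\<lambda>x. contour_integral (circlepath z r) (f x)) x0"
proof (cases "at x0 = bot")
  case False
  have "\<forall>\<^sub>F x in at x0. x \<in> V" by (rule eventually_at_in_open'[OF V])
  then have "\<forall>\<^sub>F x in at x0. f x contour_integrable_on circlepath z r"
  proof eventually_elim
    case (elim x)
    have "continuous_on (sphere z r) (\<lambda>\<zeta>. (\<lambda>(x, \<zeta>). f x \<zeta>) (x, \<zeta>))"
      by (rule continuous_on_compose2[OF c]) (use elim in \<open>auto intro!: continuous_intros\<close>)
    then show ?case using r by (intro contour_integrable_continuous_circlepath) simp
  qed
  then show ?thesis unfolding isCont_def
    by (rule contour_integral_uniform_limit_circlepath(2))
       (use False r uniform_limit_compact_parameter[OF c compact_sphere V] in auto)
qed (simp add: isCont_def)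

text \<open>
  The form of the derivative that matches a limit of difference quotients of integrals.
\<close>

lemma has_vector_derivativeI_quotient:
  fixes f :: "real \<Rightarrow> 'a::real_normed_vector"
  assumes "((\<lambda>t. (f t - f x) /\<^sub>R (t - x)) \<longlongrightarrow> D) (at x)"
  shows "(f has_vector_derivative D) (at x)"
proof -
  have eq: "norm ((f t - f x) /\<^sub>R (t - x) - D) = norm (f t - f x - (t - x) *\<^sub>R D) / norm (t - x)"
    if "t \<noteq> x" for t
  proof -
    define a where "a = t - x"
    have a: "a \<noteq> 0" using that by (simp add: a_def)
    have "f t - f x - a *\<^sub>R D = a *\<^sub>R ((f t - f x) /\<^sub>R a - D)"
      using a by (simp add: scaleR_diff_right del: scaleR_left_diff_distrib)
    then show ?thesis using a unfolding a_def[symmetric] by simp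
  qed
  have "((\<lambda>t. norm ((f t - f x) /\<^sub>R (t - x) - D)) \<longlongrightarrow> 0) (at x)"
    by (rule tendsto_norm_zero, rule LIM_zero) fact
  moreover have "\<forall>\<^sub>F t in at x. norm ((f t - f x) /\<^sub>R (t - x) - D) = norm (f t - f x - (t - x) *\<^sub>R D) / norm (t - x)"
    unfolding eventually_at_filter using eq by (intro always_eventually) blast
  ultimately have "((\<lambda>t. norm (f t - f x - (t - x) *\<^sub>R D) / norm (t - x)) \<longlongrightarrow> 0) (at x)"
    by (rule Lim_transform_eventually)
  then show ?thesis
    unfolding has_vector_derivative_def has_derivative_iff_norm by (simp add: bounded_linear_scaleR_left)
qed

text \<open>
  The mean value inequality bounds the distance of the difference quotient from the derivative of the integrand by the
  oscillation of that derivative, which is uniformly small along the circle.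
\<close>

lemma circle_integral_has_vector_derivative:
  fixes f f' :: "real \<Rightarrow> complex \<Rightarrow> complex"
  assumes T: "open T" "0 \<in> T" and r: "r > 0"
    and f: "\<And>t \<zeta>. t \<in> T \<Longrightarrow> \<zeta> \<in> sphere z r \<Longrightarrow> ((\<lambda>t. f t \<zeta>) has_vector_derivative f' t \<zeta>) (at t)"
    and cf: "\<And>t. t \<in> T \<Longrightarrow> continuous_on (sphere z r) (f t)"
    and cf': "continuous_on (T \<times> sphere z r) (\<lambda>(t, \<zeta>). f' t \<zeta>)"
  shows "((\<lambda>t. contour_integral (circlepath z r) (f t)) has_vector_derivative
            contour_integral (circlepath z r) (f' 0)) (at 0)"
proof -
  define d where "d t \<zeta> = (f t \<zeta> - f 0 \<zeta>) / of_real t" for t \<zeta>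
  have int: "f t contour_integrable_on circlepath z r" if "t \<in> T" for t
    using cf[OF that] r by (intro contour_integrable_continuous_circlepath) simp
  have "uniform_limit (sphere z r) d (f' 0) (at 0)"
  proof (rule uniform_limitI)
    fix e :: real assume e: "e > 0"
    have "\<forall>\<^sub>F t in at 0. t \<in> T \<and> (\<forall>\<zeta>\<in>sphere z r. dist (f' t \<zeta>) (f' 0 \<zeta>) < e/2)"
      using eventually_at_in_open'[OF T]
        uniform_limitD[OF uniform_limit_compact_parameter[OF cf' compact_sphere T], of "e/2"] e
      by (auto intro: eventually_conj)
    then obtain \<delta> where \<delta>: "\<delta> > 0" "\<And>t. t \<noteq> 0 \<Longrightarrow> dist t 0 < \<delta> \<Longrightarrow> t \<in> T"
      "\<And>t \<zeta>. t \<noteq> 0 \<Longrightarrow> dist t 0 < \<delta> \<Longrightarrow> \<zeta> \<in> sphere z r \<Longrightarrow> dist (f' t \<zeta>) (f' 0 \<zeta>) < e/2"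
      unfolding eventually_at by blast
    have bound: "norm (f' t \<zeta> - f' 0 \<zeta>) \<le> e/2" if "dist t 0 < \<delta>" "\<zeta> \<in> sphere z r" for t \<zeta>
      using \<delta>(3)[of t \<zeta>] that e by (cases "t = 0") (auto simp: dist_norm)
    have "dist (d t \<zeta>) (f' 0 \<zeta>) < e" if t: "t \<noteq> 0" "dist t 0 < \<delta>" and \<zeta>: "\<zeta> \<in> sphere z r" for t \<zeta>
    proof -
      have "norm (f t \<zeta> - f 0 \<zeta> - (t - 0) *\<^sub>R f' 0 \<zeta>) \<le> norm (t - 0) * (e/2)"
      proof (rule vector_differentiable_bound_linearization[where S="ball 0 \<delta>" and f'="\<lambda>t. f' t \<zeta>"])
        show "((\<lambda>t. f t \<zeta>) has_vector_derivative f' x \<zeta>) (at x within ball 0 \<delta>)" if "x \<in> ball 0 \<delta>" for x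
          using f[of x \<zeta>] \<delta>(2)[of x] that \<zeta> T
          by (cases "x = 0") (auto intro: has_vector_derivative_at_within simp: dist_commute)
        show "closed_segment 0 t \<subseteq> ball 0 \<delta>"
          using t \<delta>(1) by (intro closed_segment_subset convex_ball) (auto simp: dist_commute)
      qed (use \<delta>(1) bound \<zeta> in \<open>auto simp: dist_commute\<close>)
      moreover have "f t \<zeta> - f 0 \<zeta> - t *\<^sub>R f' 0 \<zeta> = of_real t * (d t \<zeta> - f' 0 \<zeta>)"
        using t by (simp add: d_def field_simps scaleR_conv_of_real)
      ultimately have "\<bar>t\<bar> * norm (d t \<zeta> - f' 0 \<zeta>) \<le> \<bar>t\<bar> * (e/2)"
        by (simp add: norm_mult)
      then show ?thesis using t(1) e by (simp add: dist_norm)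
    qed
    then show "\<forall>\<^sub>F t in at 0. \<forall>\<zeta>\<in>sphere z r. dist (d t \<zeta>) (f' 0 \<zeta>) < e"
      unfolding eventually_at using \<delta>(1) by blast
  qed
  moreover have "\<forall>\<^sub>F t in at 0. d t contour_integrable_on circlepath z r"
    using eventually_at_in_open'[OF T]
  proof eventually_elim
    case (elim t)
    then show ?case unfolding d_def using int T
      by (intro contour_integrable_div contour_integrable_diff) auto
  qed
  ultimately have "((\<lambda>t. contour_integral (circlepath z r) (d t)) \<longlongrightarrow>
                      contour_integral (circlepath z r) (f' 0)) (at 0)"
    using r by (intro contour_integral_uniform_limit_circlepath(2)) auto
  moreover have "\<forall>\<^sub>F t in at 0. contour_integral (circlepath z r) (d t) =
      (contour_integral (circlepath z r) (f t) - contour_integral (circlepath z r) (f 0)) /\<^sub>R (t - 0)"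
    using eventually_at_in_open'[OF T]
  proof eventually_elim
    case (elim t)
    then show ?case unfolding d_def using int T
      by (simp add: contour_integral_diff contour_integral_div contour_integrable_diff
          scaleR_conv_of_real field_simps)
  qed
  ultimately have "((\<lambda>t. (contour_integral (circlepath z r) (f t) -
      contour_integral (circlepath z r) (f 0)) /\<^sub>R (t - 0)) \<longlongrightarrow>
                      contour_integral (circlepath z r) (f' 0)) (at 0)"
    by (rule Lim_transform_eventually)
  then show ?thesis by (rule has_vector_derivativeI_quotient)
qed

lemma inverse_power_has_vector_derivative:
  fixes f :: "real \<Rightarrow> 'a::real_normed_field"
  assumes "(f has_vector_derivative f') (at t)" "f t \<noteq> 0"
  shows "((\<lambda>t. c / f t ^ n) has_vector_derivative - of_nat n * f' * c / f t ^ Suc n) (at t)"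
proof -
  have "((\<lambda>w. c / w ^ n) has_field_derivative - of_nat n * c / f t ^ Suc n) (at (f t))"
  proof (cases n)
    case (Suc m)
    have "((\<lambda>w. c / w ^ n) has_field_derivative
            - (c * (of_nat n * f t ^ m)) / (f t ^ n * f t ^ n)) (at (f t))"
    proof -
      have "((\<lambda>w. w ^ n) has_field_derivative of_nat n * f t ^ m) (at (f t))"
        using DERIV_power[OF DERIV_ident, where x = "f t" and n = n] by (simp add: Suc del: power_Suc)
      from DERIV_divide[OF DERIV_const this, of c] assms(2) show ?thesis by simp
    qed
    also have "- (c * (of_nat n * f t ^ m)) / (f t ^ n * f t ^ n) = - of_nat n * c / f t ^ Suc n"
      using assms(2) by (simp add: Suc divide_simps) (simp add: algebra_simps)
    finally show ?thesis .
  qed simp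
  from field_vector_diff_chain_at[OF assms(1) this] show ?thesis
    by (simp add: o_def mult_ac)
qed

section \<open>The characteristic polynomial of a quaternion\<close>

text \<open>
  The representative in the closed upper half plane of the sphere of quaternions that share their real part and the
  norm of their imaginary part with \<open>q\<close>.
\<close>

definition upper_pt :: "quat \<Rightarrow> complex" where
  "upper_pt q = Complex (Q0 q) (sqrt ((Q1 q)\<^sup>2 + (Q2 q)\<^sup>2 + (Q3 q)\<^sup>2))"

text \<open>
  The real quadratic polynomial that vanishes at \<open>q\<close>. The denominators of the F-kernels are its powers.
\<close>

definition qchar :: "quat \<Rightarrow> complex \<Rightarrow> complex" where
  "qchar q \<zeta> = (\<zeta> - of_real (Q0 q))\<^sup>2 + of_real ((Q1 q)\<^sup>2 + (Q2 q)\<^sup>2 + (Q3 q)\<^sup>2)"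

text \<open>
  The quaternions both of whose planar representatives lie in \<open>D\<close>. A symmetric \<open>D\<close> yields the axially symmetric
  set with this slice.
\<close>

definition double_domain :: "complex set \<Rightarrow> quat set" where
  "double_domain D = {q. upper_pt q \<in> D \<and> cnj (upper_pt q) \<in> D}"

lemma bounded_linear_Q [simp]:
  "bounded_linear Q0" "bounded_linear Q1" "bounded_linear Q2" "bounded_linear Q3"
proof -
  have "Q0 = (\<lambda>q. inner q 1)" "Q1 = (\<lambda>q. inner q e1)" "Q2 = (\<lambda>q. inner q e2)" "Q3 = (\<lambda>q. inner q e3)"
    by (simp_all add: fun_eq_iff inner_quat_def)
  then show "bounded_linear Q0" "bounded_linear Q1" "bounded_linear Q2" "bounded_linear Q3"
    using bounded_linear_inner_left by metis+
qed

lemmas continuous_on_Q [continuous_intros] =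
  bounded_linear_Q [THEN bounded_linear.continuous_on]

lemma Im_upper_pt: "Im (upper_pt q) = sqrt ((Q1 q)\<^sup>2 + (Q2 q)\<^sup>2 + (Q3 q)\<^sup>2)"
  and Re_upper_pt [simp]: "Re (upper_pt q) = Q0 q"
  by (simp_all add: upper_pt_def)

lemma Im_upper_pt_nonneg: "0 \<le> Im (upper_pt q)"
  by (simp add: Im_upper_pt)

lemma Im_upper_pt_square: "(Im (upper_pt q))\<^sup>2 = (Q1 q)\<^sup>2 + (Q2 q)\<^sup>2 + (Q3 q)\<^sup>2"
  by (simp add: Im_upper_pt)

lemma qchar_factor: "qchar q \<zeta> = (\<zeta> - upper_pt q) * (\<zeta> - cnj (upper_pt q))"
  unfolding qchar_def Im_upper_pt_square[symmetric]
  by (simp add: complex_eq_iff power2_eq_square algebra_simps)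

lemma qchar_eq: "qchar q \<zeta> = \<zeta>\<^sup>2 - 2 * of_real (Q0 q) * \<zeta> + of_real ((norm q)\<^sup>2)"
  by (simp add: qchar_def norm_quat_def power2_eq_square algebra_simps)

lemma qchar_eq_0_iff: "qchar q \<zeta> = 0 \<longleftrightarrow> \<zeta> \<in> {upper_pt q, cnj (upper_pt q)}"
  by (simp add: qchar_factor)

lemma continuous_on_upper_pt: "continuous_on S upper_pt"
  unfolding upper_pt_def Complex_eq by (intro continuous_intros)

lemma continuous_on_qchar:
  "continuous_on S f \<Longrightarrow> continuous_on S g \<Longrightarrow> continuous_on S (\<lambda>x. qchar (f x) (g x))"
proof -
  assume c: "continuous_on S f" "continuous_on S g"
  have "continuous_on S (\<lambda>x. Q0 (f x))" "continuous_on S (\<lambda>x. Q1 (f x))"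
       "continuous_on S (\<lambda>x. Q2 (f x))" "continuous_on S (\<lambda>x. Q3 (f x))"
    using c by (auto intro: continuous_intros)
  with c show ?thesis unfolding qchar_def by (intro continuous_intros)
qed

lemma holomorphic_on_qchar [holomorphic_intros]: "qchar q holomorphic_on S"
  unfolding qchar_def[abs_def] by (intro holomorphic_intros)

lemma open_double_domain: "open D \<Longrightarrow> open (double_domain D)"
proof -
  assume D: "open D"
  have "open (upper_pt -` D \<inter> (\<lambda>q. cnj (upper_pt q)) -` D)"
    by (intro open_Int open_vimage D continuous_on_upper_pt continuous_on_cnj)
  then show ?thesis by (simp add: double_domain_def vimage_def Collect_conj_eq)
qed

text \<open>
  The cycles over which Cauchy's formula for the points \<open>upper_pt q\<close> and \<open>cnj (upper_pt q)\<close> may be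
  applied to functions holomorphic on \<open>D\<close>. If \<open>q\<close> is real, the two points coincide and are counted once.
\<close>

definition encloses :: "complex set \<Rightarrow> (real \<Rightarrow> complex) set \<Rightarrow> quat \<Rightarrow> bool" where
  "encloses D \<Gamma> q \<longleftrightarrow> cycle_in (D - {upper_pt q, cnj (upper_pt q)}) \<Gamma> \<and>
     cycle_winding \<Gamma> (upper_pt q) = 1 \<and> cycle_winding \<Gamma> (cnj (upper_pt q)) = 1 \<and>
     (\<forall>z. z \<notin> D \<longrightarrow> cycle_winding \<Gamma> z = 0)"

text \<open>
  One family of circles encloses all quaternions near \<open>q\<close>. It consists of a circle around each of the two
  representatives; for real \<open>q\<close> these are the same path, and the set of paths collapses to a singleton, as the
  winding number condition requires.
\<close>

lemma exists_enclosing_circles: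
  assumes D: "open D" and q: "q \<in> double_domain D"
  obtains r V where "r > 0" "open V" "q \<in> V"
    "\<And>p. p \<in> V \<Longrightarrow> encloses D {circlepath (upper_pt q) r, circlepath (cnj (upper_pt q)) r} p"
proof -
  define z where "z = upper_pt q"
  have z: "z \<in> D" "cnj z \<in> D" using q by (auto simp: double_domain_def z_def)
  obtain r1 where r1: "r1 > 0" "cball z r1 \<subseteq> D" using open_contains_cball D z by metis
  obtain r2 where r2: "r2 > 0" "cball (cnj z) r2 \<subseteq> D" using open_contains_cball D z by metis
  (* Half of the imaginary part keeps the two disks in opposite half planes. *)
  define r where "r = min (min r1 r2) (if Im z = 0 then 1 else Im z / 2)"
  have Imz: "0 \<le> Im z" by (simp add: z_def Im_upper_pt_nonneg)
  have r: "r > 0" using r1 r2 Imz by (auto simp: r_def)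
  have cb: "cball z r \<subseteq> D" "cball (cnj z) r \<subseteq> D" using r1 r2 by (auto simp: r_def)
  have disj: "cball z r \<inter> cball (cnj z) r = {}" if "Im z \<noteq> 0"
  proof -
    have "r < Im z" using that Imz by (auto simp: r_def)
    have "Im a > 0" if "a \<in> cball z r" for a
      using that abs_Im_le_cmod[of "z - a"] \<open>r < Im z\<close> by (auto simp: dist_norm)
    moreover have "Im a < 0" if "a \<in> cball (cnj z) r" for a
      using that abs_Im_le_cmod[of "cnj z - a"] \<open>r < Im z\<close> by (auto simp: dist_norm)
    ultimately show ?thesis by force
  qed
  define \<Gamma> where "\<Gamma> = {circlepath z r, circlepath (cnj z) r}"
  have out: "winding_number (circlepath c r) a = 0" if "a \<notin> cball c r" for a c
    by (rule winding_number_zero_outside[of _ "cball c r"]) (use that r in \<open>auto simp: sphere_def\<close>)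
  have ins: "winding_number (circlepath c r) a = 1" if "a \<in> ball c r" for a c
    by (rule winding_number_circlepath) (use that in \<open>auto simp: dist_norm norm_minus_commute\<close>)
  have pi: "path_image (circlepath c r) = sphere c r" for c using r by simp
  have ne: "circlepath z r \<noteq> circlepath (cnj z) r" if "Im z \<noteq> 0"
  proof
    assume "circlepath z r = circlepath (cnj z) r"
    then have "sphere z r = sphere (cnj z) r" using pi by metis
    moreover have "z + of_real r \<in> sphere z r" using r by (simp add: dist_norm)
    ultimately show False using disj[OF that] sphere_cball[of z r] sphere_cball[of "cnj z" r] by blast
  qed
  have W0: "cycle_winding \<Gamma> a = (if Im z = 0 then winding_number (circlepath z r) a
     else winding_number (circlepath z r) a + winding_number (circlepath (cnj z) r) a)" for a
  proof (cases "Im z = 0")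
    case True
    then have "cnj z = z" by (simp add: complex_eq_iff)
    then show ?thesis using True by (simp add: cycle_winding_def \<Gamma>_def)
  qed (simp add: cycle_winding_def \<Gamma>_def ne)
  have W1: "cycle_winding \<Gamma> a = 1" if "a \<in> ball z r \<union> ball (cnj z) r" for a
  proof (cases "Im z = 0")
    case True
    then have "cnj z = z" by (simp add: complex_eq_iff)
    then show ?thesis using True that by (simp add: W0 ins)
  next
    case False
    then have "a \<notin> cball (cnj z) r" if "a \<in> ball z r"
      using that disj ball_subset_cball[of z r] by blast
    moreover have "a \<notin> cball z r" if "a \<in> ball (cnj z) r"
      using that disj False ball_subset_cball[of "cnj z" r] by blast
    ultimately show ?thesis using that ins[of a z] ins[of a "cnj z"] out[of a z] out[of a "cnj z"] False
      unfolding W0 by (auto simp del: mem_ball mem_cball)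
  qed
  have W2: "cycle_winding \<Gamma> a = 0" if "a \<notin> D" for a
  proof -
    have "a \<notin> cball z r" "a \<notin> cball (cnj z) r" using that cb by blast+
    then show ?thesis by (simp add: W0 out del: mem_cball)
  qed
  define V where "V = upper_pt -` ball z r"
  have "open V" unfolding V_def by (intro open_vimage continuous_on_upper_pt open_ball)
  moreover have "q \<in> V" using r by (simp add: V_def z_def)
  moreover have "encloses D \<Gamma> p" if "p \<in> V" for p
  proof -
    have a: "upper_pt p \<in> ball z r" using that by (simp add: V_def)
    have b: "cnj (upper_pt p) \<in> ball (cnj z) r"
      using a by (metis complex_cnj_diff complex_mod_cnj dist_norm mem_ball)
    have on: "s \<notin> ball z r \<union> ball (cnj z) r" if "s \<in> sphere z r \<union> sphere (cnj z) r" for s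
    proof (cases "Im z = 0")
      case True
      then have "cnj z = z" by (simp add: complex_eq_iff)
      then show ?thesis using that by auto
    next
      case False
      have "s \<notin> ball z r" if "s \<in> sphere (cnj z) r" for s
        using that disj[OF False] ball_subset_cball[of z r] sphere_cball[of "cnj z" r] by blast
      moreover have "s \<notin> ball (cnj z) r" if "s \<in> sphere z r" for s
        using that disj[OF False] ball_subset_cball[of "cnj z" r] sphere_cball[of z r] by blast
      ultimately show ?thesis using that by auto
    qed
    have "cycle_in (D - {upper_pt p, cnj (upper_pt p)}) \<Gamma>"
      unfolding cycle_in_def \<Gamma>_def using cb on a b pi by (auto simp: subset_iff)
    then show ?thesis using W1 W2 a b by (auto simp: encloses_def)
  qed
  ultimately show ?thesis using that[of r V] r by (simp add: \<Gamma>_def z_def)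
qed

section \<open>Moments\<close>

text \<open>
  The integral of \<open>G / (qchar q)\<^sup>n\<close> around both roots, divided by \<open>2 \<pi> \<i>\<close>. Defining it by residues makes its
  independence of the contour part of the definition. The index set collapses to one point for real \<open>q\<close>.
\<close>

definition moment :: "nat \<Rightarrow> (complex \<Rightarrow> complex) \<Rightarrow> quat \<Rightarrow> complex" where
  "moment n G q = (\<Sum>p\<in>{upper_pt q, cnj (upper_pt q)}. residue (\<lambda>\<zeta>. G \<zeta> / qchar q \<zeta> ^ n) p)"

lemma holomorphic_moment_integrand:
  "G holomorphic_on D \<Longrightarrow>
     (\<lambda>\<zeta>. G \<zeta> / qchar q \<zeta> ^ n) holomorphic_on D - {upper_pt q, cnj (upper_pt q)}"
  by (intro holomorphic_intros) (auto simp: qchar_eq_0_iff elim: holomorphic_on_subset)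

lemma moment_eq_cycle_integral:
  assumes "open D" "G holomorphic_on D" "encloses D \<Gamma> q"
  shows "(\<Sum>\<gamma>\<in>\<Gamma>. contour_integral \<gamma> (\<lambda>\<zeta>. G \<zeta> / qchar q \<zeta> ^ n)) = 2 * pi * \<i> * moment n G q"
proof -
  have "(\<Sum>\<gamma>\<in>\<Gamma>. contour_integral \<gamma> (\<lambda>\<zeta>. G \<zeta> / qchar q \<zeta> ^ n)) =
     2 * pi * \<i> * (\<Sum>p\<in>{upper_pt q, cnj (upper_pt q)}. cycle_winding \<Gamma> p *
        residue (\<lambda>\<zeta>. G \<zeta> / qchar q \<zeta> ^ n) p)"
    by (rule residue_theorem_cycle[OF assms(1) _ holomorphic_moment_integrand[OF assms(2)]])
       (use assms(3) in \<open>auto simp: encloses_def\<close>)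
  also have "\<dots> = 2 * pi * \<i> * moment n G q"
    unfolding moment_def
    by (intro arg_cong2[where f="(*)"] refl sum.cong) (use assms(3) in \<open>auto simp: encloses_def\<close>)
  finally show ?thesis .
qed

lemma continuous_on_moment_integrand:
  assumes G: "G holomorphic_on D" and C: "\<And>p. p \<in> V \<Longrightarrow> C \<subseteq> D - {upper_pt p, cnj (upper_pt p)}"
  shows "continuous_on (V \<times> C) (\<lambda>(p, \<zeta>). G \<zeta> / qchar p \<zeta> ^ n)"
proof -
  have "continuous_on (V \<times> C) (\<lambda>x. G (snd x))"
  proof (cases "V = {}")
    case False
    then have "C \<subseteq> D" using C by auto
    then show ?thesis
      by (intro continuous_on_compose2[OF holomorphic_on_imp_continuous_on[OF G]] continuous_intros) auto
  qed simp
  moreover have "qchar (fst x) (snd x) ^ n \<noteq> 0" if "x \<in> V \<times> C" for x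
    using that C[of "fst x"] by (auto simp: qchar_eq_0_iff)
  ultimately show ?thesis
    unfolding case_prod_unfold by (intro continuous_intros continuous_on_qchar) auto
qed

text \<open>
  Near a given quaternion all moments are integrals over the same circles, on which continuity and
  differentiability can be checked under the integral sign.
\<close>

lemma moment_local_representation:
  assumes D: "open D" and q: "q \<in> double_domain D"
  obtains r Z V where "r > 0" "finite Z" "open V" "q \<in> V"
    "\<And>p c. p \<in> V \<Longrightarrow> c \<in> Z \<Longrightarrow> sphere c r \<subseteq> D - {upper_pt p, cnj (upper_pt p)}"
    "\<And>p n G. p \<in> V \<Longrightarrow> G holomorphic_on D \<Longrightarrow>
       (\<Sum>c\<in>Z. contour_integral (circlepath c r) (\<lambda>\<zeta>. G \<zeta> / qchar p \<zeta> ^ n)) = 2 * pi * \<i> * moment n G p"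
proof -
  obtain r V where r: "r > 0" and V: "open V" "q \<in> V"
    and enc: "\<And>p. p \<in> V \<Longrightarrow> encloses D {circlepath (upper_pt q) r, circlepath (cnj (upper_pt q)) r} p"
    using exists_enclosing_circles[OF D q] by metis
  define Z where "Z = {upper_pt q, cnj (upper_pt q)}"
  have img: "{circlepath (upper_pt q) r, circlepath (cnj (upper_pt q)) r} = (\<lambda>c. circlepath c r) ` Z"
    by (simp add: Z_def)
  have inj: "inj_on (\<lambda>c. circlepath c r) Z"
  proof (rule inj_onI)
    fix c d assume "circlepath c r = circlepath d r"
    from fun_cong[OF this, of 0] show "c = d" by (simp add: circlepath)
  qed
  show thesis
  proof (rule that[of r Z V])
    show "finite Z" by (simp add: Z_def)
    show "sphere c r \<subseteq> D - {upper_pt p, cnj (upper_pt p)}" if "p \<in> V" "c \<in> Z" for p c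
      using enc[OF that(1)] that(2) r unfolding img encloses_def cycle_in_def by auto
    show "(\<Sum>c\<in>Z. contour_integral (circlepath c r) (\<lambda>\<zeta>. G \<zeta> / qchar p \<zeta> ^ n)) = 2 * pi * \<i> * moment n G p"
      if "p \<in> V" "G holomorphic_on D" for p n G
      using moment_eq_cycle_integral[OF D that(2) enc[OF that(1)], of n]
      unfolding img by (simp add: sum.reindex[OF inj])
  qed fact+
qed

lemma continuous_on_moment:
  assumes D: "open D" and G: "G holomorphic_on D"
  shows "continuous_on (double_domain D) (moment n G)"
proof (rule continuous_at_imp_continuous_on, rule ballI)
  fix q assume q: "q \<in> double_domain D"
  obtain r Z V where r: "r > 0" and Z: "finite Z" and V: "open V" "q \<in> V"
    and sph: "\<And>p c. p \<in> V \<Longrightarrow> c \<in> Z \<Longrightarrow> sphere c r \<subseteq> D - {upper_pt p, cnj (upper_pt p)}"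
    and rep: "\<And>p n G. p \<in> V \<Longrightarrow> G holomorphic_on D \<Longrightarrow>
       (\<Sum>c\<in>Z. contour_integral (circlepath c r) (\<lambda>\<zeta>. G \<zeta> / qchar p \<zeta> ^ n)) = 2 * pi * \<i> * moment n G p"
    using moment_local_representation[OF D q] by blast
  have "isCont (\<lambda>p. contour_integral (circlepath c r) (\<lambda>\<zeta>. G \<zeta> / qchar p \<zeta> ^ n)) q" if "c \<in> Z" for c
    by (rule circle_integral_continuous_parameter[OF continuous_on_moment_integrand[OF G] V r])
       (use sph that in blast)
  then have "isCont (\<lambda>p. (\<Sum>c\<in>Z. contour_integral (circlepath c r) (\<lambda>\<zeta>. G \<zeta> / qchar p \<zeta> ^ n)) / (2 * pi * \<i>)) q"
    using Z by (intro continuous_intros) auto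
  moreover have "\<forall>\<^sub>F p in nhds q. (\<Sum>c\<in>Z. contour_integral (circlepath c r) (\<lambda>\<zeta>. G \<zeta> / qchar p \<zeta> ^ n)) / (2 * pi * \<i>)
      = moment n G p"
    using eventually_nhds_in_open[OF V] by eventually_elim (simp add: rep[OF _ G])
  ultimately show "isCont (moment n G) q" by (subst (asm) isCont_cong)
qed

lemma qchar_line_has_vector_derivative:
  "((\<lambda>t. qchar (q + t *\<^sub>R e) \<zeta>) has_vector_derivative
      2 * (of_real (inner (q + t *\<^sub>R e) e) - \<zeta> * of_real (Q0 e))) (at t)"
proof -
  define P where "P w = (\<zeta> - (of_real (Q0 q) + w * of_real (Q0 e)))\<^sup>2 + (of_real (Q1 q) + w * of_real (Q1 e))\<^sup>2
     + (of_real (Q2 q) + w * of_real (Q2 e))\<^sup>2 + (of_real (Q3 q) + w * of_real (Q3 e))\<^sup>2" for w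
  have "(P has_field_derivative 2 * (of_real (inner (q + t *\<^sub>R e) e) - \<zeta> * of_real (Q0 e))) (at (of_real t))"
    unfolding P_def
    by (auto intro!: derivative_eq_intros simp: inner_quat_def algebra_simps power2_eq_square)
  then have "((\<lambda>t. P (of_real t)) has_vector_derivative
      2 * (of_real (inner (q + t *\<^sub>R e) e) - \<zeta> * of_real (Q0 e))) (at t)"
    by (rule has_vector_derivative_real_field)
  moreover have "P (of_real t) = qchar (q + t *\<^sub>R e) \<zeta>" for t :: real
    by (simp add: P_def qchar_def)
  ultimately show ?thesis by simp
qed

text \<open>
  The derivative of \<open>qchar q \<zeta>\<close> as \<open>q\<close> moves in direction \<open>e\<close> is \<open>2 (q \<bullet> e - \<zeta> Re(e))\<close>; hence differentiation
  raises the order of the moment by one and, for the real part of \<open>e\<close>, multiplies \<open>G\<close> by \<open>\<zeta>\<close>.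
\<close>

lemma moment_has_vector_derivative:
  assumes D: "open D" and q: "q \<in> double_domain D" and G: "G holomorphic_on D"
  shows "((\<lambda>t. moment n G (q + t *\<^sub>R e)) has_vector_derivative
     2 * of_nat n * (of_real (Q0 e) * moment (Suc n) (\<lambda>\<zeta>. \<zeta> * G \<zeta>) q
       - of_real (inner q e) * moment (Suc n) G q)) (at 0)"
proof -
  obtain r Z V where r: "r > 0" and Z: "finite Z" and V: "open V" "q \<in> V"
    and sph: "\<And>p c. p \<in> V \<Longrightarrow> c \<in> Z \<Longrightarrow> sphere c r \<subseteq> D - {upper_pt p, cnj (upper_pt p)}"
    and rep: "\<And>p n G. p \<in> V \<Longrightarrow> G holomorphic_on D \<Longrightarrow>
       (\<Sum>c\<in>Z. contour_integral (circlepath c r) (\<lambda>\<zeta>. G \<zeta> / qchar p \<zeta> ^ n)) = 2 * pi * \<i> * moment n G p"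
    using moment_local_representation[OF D q] by blast
  define T where "T = (\<lambda>t. q + t *\<^sub>R e) -` V"
  have T: "open T" "0 \<in> T" unfolding T_def using V by (auto intro!: open_vimage continuous_intros)
  define f where "f t \<zeta> = G \<zeta> / qchar (q + t *\<^sub>R e) \<zeta> ^ n" for t \<zeta>
  define f' where "f' t \<zeta> = 2 * of_nat n * (\<zeta> * of_real (Q0 e) - of_real (inner (q + t *\<^sub>R e) e)) *
      (G \<zeta> / qchar (q + t *\<^sub>R e) \<zeta> ^ Suc n)" for t \<zeta>
  have G1: "(\<lambda>\<zeta>. \<zeta> * G \<zeta>) holomorphic_on D" by (intro holomorphic_intros G)
  have one: "((\<lambda>t. contour_integral (circlepath c r) (f t)) has_vector_derivative
      2 * of_nat n * (of_real (Q0 e) * contour_integral (circlepath c r) (\<lambda>\<zeta>. \<zeta> * G \<zeta> / qchar q \<zeta> ^ Suc n)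
       - of_real (inner q e) * contour_integral (circlepath c r) (\<lambda>\<zeta>. G \<zeta> / qchar q \<zeta> ^ Suc n))) (at 0)"
    if c: "c \<in> Z" for c
  proof -
    have mi: "continuous_on (T \<times> sphere c r) (\<lambda>x. G (snd x) / qchar (q + fst x *\<^sub>R e) (snd x) ^ m)" for m
    proof -
      have "continuous_on (V \<times> sphere c r) (\<lambda>(p, \<zeta>). G \<zeta> / qchar p \<zeta> ^ m)"
        by (rule continuous_on_moment_integrand[OF G]) (use sph c in blast)
      then have "continuous_on (T \<times> sphere c r)
          (\<lambda>x. (\<lambda>(p, \<zeta>). G \<zeta> / qchar p \<zeta> ^ m) (q + fst x *\<^sub>R e, snd x))"
        by (rule continuous_on_compose2) (auto intro!: continuous_intros simp: T_def)
      then show ?thesis by simp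
    qed
    have "((\<lambda>t. contour_integral (circlepath c r) (f t)) has_vector_derivative
             contour_integral (circlepath c r) (f' 0)) (at 0)"
    proof (rule circle_integral_has_vector_derivative[OF T r])
      show "((\<lambda>t. f t \<zeta>) has_vector_derivative f' t \<zeta>) (at t)" if "t \<in> T" "\<zeta> \<in> sphere c r" for t \<zeta>
      proof -
        have "qchar (q + t *\<^sub>R e) \<zeta> \<noteq> 0"
          using sph[of "q + t *\<^sub>R e" c] c that by (auto simp: qchar_eq_0_iff T_def)
        from inverse_power_has_vector_derivative[OF qchar_line_has_vector_derivative this, of "G \<zeta>" n]
        show ?thesis unfolding f_def f'_def by (rule has_vector_derivative_eq_rhs) (simp add: algebra_simps diff_divide_distrib add_divide_distrib)
      qed
      show "continuous_on (sphere c r) (f t)" if "t \<in> T" for t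
      proof -
        have "continuous_on (sphere c r)
            (\<lambda>\<zeta>. (\<lambda>x. G (snd x) / qchar (q + fst x *\<^sub>R e) (snd x) ^ n) (t, \<zeta>))"
          by (rule continuous_on_compose2[OF mi]) (use that in \<open>auto intro!: continuous_intros\<close>)
        then show ?thesis by (simp add: f_def)
      qed
      show "continuous_on (T \<times> sphere c r) (\<lambda>(t, \<zeta>). f' t \<zeta>)"
        unfolding f'_def case_prod_unfold by (intro continuous_intros mi)
    qed
    moreover have "contour_integral (circlepath c r) (f' 0) =
       2 * of_nat n * (of_real (Q0 e) * contour_integral (circlepath c r) (\<lambda>\<zeta>. \<zeta> * G \<zeta> / qchar q \<zeta> ^ Suc n)
       - of_real (inner q e) * contour_integral (circlepath c r) (\<lambda>\<zeta>. G \<zeta> / qchar q \<zeta> ^ Suc n))"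
    proof -
      have int: "(\<lambda>\<zeta>. H \<zeta> / qchar q \<zeta> ^ Suc n) contour_integrable_on circlepath c r"
        if "H holomorphic_on D" for H
        by (rule contour_integrable_holomorphic_simple[OF holomorphic_moment_integrand[OF that]])
           (use D sph[OF V(2) c] r in \<open>auto intro!: open_Diff finite_imp_closed\<close>)
      have "f' 0 = (\<lambda>\<zeta>. 2 * of_nat n * (of_real (Q0 e) * (\<zeta> * G \<zeta> / qchar q \<zeta> ^ Suc n)
         - of_real (inner q e) * (G \<zeta> / qchar q \<zeta> ^ Suc n)))"
        by (simp add: f'_def fun_eq_iff algebra_simps diff_divide_distrib)
      then show ?thesis
        by (simp only: contour_integral_lmul contour_integral_diff contour_integrable_lmul
            contour_integrable_diff int[OF G] int[OF G1])
    qed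
    ultimately show ?thesis by simp
  qed
  have "((\<lambda>t. (\<Sum>c\<in>Z. contour_integral (circlepath c r) (f t))) has_vector_derivative
      (\<Sum>c\<in>Z. 2 * of_nat n * (of_real (Q0 e) * contour_integral (circlepath c r) (\<lambda>\<zeta>. \<zeta> * G \<zeta> / qchar q \<zeta> ^ Suc n)
       - of_real (inner q e) * contour_integral (circlepath c r) (\<lambda>\<zeta>. G \<zeta> / qchar q \<zeta> ^ Suc n)))) (at 0)"
    by (rule has_vector_derivative_sum) (rule one)
  also have "(\<Sum>c\<in>Z. 2 * of_nat n * (of_real (Q0 e) * contour_integral (circlepath c r) (\<lambda>\<zeta>. \<zeta> * G \<zeta> / qchar q \<zeta> ^ Suc n)
       - of_real (inner q e) * contour_integral (circlepath c r) (\<lambda>\<zeta>. G \<zeta> / qchar q \<zeta> ^ Suc n))) =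
     2 * of_nat n * (of_real (Q0 e) * (2 * pi * \<i> * moment (Suc n) (\<lambda>\<zeta>. \<zeta> * G \<zeta>) q)
       - of_real (inner q e) * (2 * pi * \<i> * moment (Suc n) G q))"
    unfolding rep[OF V(2) G, symmetric] rep[OF V(2) G1, symmetric]
    by (simp only: sum_distrib_left[symmetric] sum_subtractf)
  finally have "((\<lambda>t. inverse (2 * pi * \<i>) * (\<Sum>c\<in>Z. contour_integral (circlepath c r) (f t))) has_vector_derivative
      inverse (2 * pi * \<i>) * (2 * of_nat n * (of_real (Q0 e) * (2 * pi * \<i> * moment (Suc n) (\<lambda>\<zeta>. \<zeta> * G \<zeta>) q)
       - of_real (inner q e) * (2 * pi * \<i> * moment (Suc n) G q)))) (at 0)"
    by (rule has_vector_derivative_mult_right)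
  moreover have "inverse (2 * pi * \<i>) * (2 * of_nat n * (of_real (Q0 e) * (2 * pi * \<i> * moment (Suc n) (\<lambda>\<zeta>. \<zeta> * G \<zeta>) q)
       - of_real (inner q e) * (2 * pi * \<i> * moment (Suc n) G q))) =
      2 * of_nat n * (of_real (Q0 e) * moment (Suc n) (\<lambda>\<zeta>. \<zeta> * G \<zeta>) q
       - of_real (inner q e) * moment (Suc n) G q)"
    by (simp add: field_simps)
  ultimately have "((\<lambda>t. inverse (2 * pi * \<i>) * (\<Sum>c\<in>Z. contour_integral (circlepath c r) (f t))) has_vector_derivative
      2 * of_nat n * (of_real (Q0 e) * moment (Suc n) (\<lambda>\<zeta>. \<zeta> * G \<zeta>) q
       - of_real (inner q e) * moment (Suc n) G q)) (at 0)"
    by simp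
  then show ?thesis
  proof (rule has_vector_derivative_transform_within_open[OF _ T])
    show "inverse (2 * pi * \<i>) * (\<Sum>c\<in>Z. contour_integral (circlepath c r) (f t)) = moment n G (q + t *\<^sub>R e)"
      if "t \<in> T" for t
      using that rep[OF _ G, of "q + t *\<^sub>R e" n] by (simp add: T_def f_def[abs_def] field_simps)
  qed
qed

lemma moment_linear:
  assumes D: "open D" and q: "q \<in> double_domain D"
    and G: "G holomorphic_on D" and H: "H holomorphic_on D"
  shows "moment n (\<lambda>\<zeta>. a * G \<zeta> + b * H \<zeta>) q = a * moment n G q + b * moment n H q"
proof -
  obtain r Z V where r: "r > 0" and Z: "finite Z" and V: "open V" "q \<in> V"
    and sph: "\<And>p c. p \<in> V \<Longrightarrow> c \<in> Z \<Longrightarrow> sphere c r \<subseteq> D - {upper_pt p, cnj (upper_pt p)}"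
    and rep: "\<And>p n G. p \<in> V \<Longrightarrow> G holomorphic_on D \<Longrightarrow>
       (\<Sum>c\<in>Z. contour_integral (circlepath c r) (\<lambda>\<zeta>. G \<zeta> / qchar p \<zeta> ^ n)) = 2 * pi * \<i> * moment n G p"
    using moment_local_representation[OF D q] by blast
  have GH: "(\<lambda>\<zeta>. a * G \<zeta> + b * H \<zeta>) holomorphic_on D"
    by (intro holomorphic_intros G H)
  have "contour_integral (circlepath c r) (\<lambda>\<zeta>. (a * G \<zeta> + b * H \<zeta>) / qchar q \<zeta> ^ n) =
      a * contour_integral (circlepath c r) (\<lambda>\<zeta>. G \<zeta> / qchar q \<zeta> ^ n)
      + b * contour_integral (circlepath c r) (\<lambda>\<zeta>. H \<zeta> / qchar q \<zeta> ^ n)" if c: "c \<in> Z" for c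
  proof -
    have int: "(\<lambda>\<zeta>. K \<zeta> / qchar q \<zeta> ^ n) contour_integrable_on circlepath c r"
      if "K holomorphic_on D" for K
      by (rule contour_integrable_holomorphic_simple[OF holomorphic_moment_integrand[OF that]])
         (use D sph[OF V(2) c] r in \<open>auto intro!: open_Diff finite_imp_closed\<close>)
    have "(\<lambda>\<zeta>. (a * G \<zeta> + b * H \<zeta>) / qchar q \<zeta> ^ n) =
        (\<lambda>\<zeta>. a * (G \<zeta> / qchar q \<zeta> ^ n) + b * (H \<zeta> / qchar q \<zeta> ^ n))"
      by (simp add: add_divide_distrib)
    then show ?thesis
      by (simp only: contour_integral_lmul contour_integral_add contour_integrable_lmul int[OF G] int[OF H])
  qed
  then have "2 * pi * \<i> * moment n (\<lambda>\<zeta>. a * G \<zeta> + b * H \<zeta>) q =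
     a * (2 * pi * \<i> * moment n G q) + b * (2 * pi * \<i> * moment n H q)"
    unfolding rep[OF V(2) G, symmetric] rep[OF V(2) H, symmetric] rep[OF V(2) GH, symmetric]
    by (simp only: sum.distrib sum_distrib_left cong: sum.cong)
  also have "\<dots> = 2 * pi * \<i> * (a * moment n G q + b * moment n H q)"
    by (simp add: algebra_simps)
  finally show ?thesis by simp
qed

lemma moment_shift:
  assumes D: "open D" and q: "q \<in> double_domain D" and G: "G holomorphic_on D"
  shows "moment n (\<lambda>\<zeta>. (\<zeta> - c) * G \<zeta>) q = moment n (\<lambda>\<zeta>. \<zeta> * G \<zeta>) q - c * moment n G q"
proof -
  have "(\<lambda>\<zeta>. \<zeta> * G \<zeta>) holomorphic_on D" by (intro holomorphic_intros G)
  from moment_linear[OF D q this G, of n 1 "- c"] show ?thesis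
    by (simp add: left_diff_distrib)
qed

text \<open>
  Off the two roots of \<open>qchar q\<close> the integrands agree, and a residue does not see the value at the point itself.
\<close>

lemma moment_cancel_qchar: "moment (Suc n) (\<lambda>\<zeta>. qchar q \<zeta> * G \<zeta>) q = moment n G q"
  unfolding moment_def
proof (intro sum.cong refl residue_cong)
  fix p
  have "\<forall>\<^sub>F \<zeta> in at p. \<zeta> \<noteq> upper_pt q \<and> \<zeta> \<noteq> cnj (upper_pt q)"
    by (intro eventually_conj eventually_neq_at_within)
  then show "\<forall>\<^sub>F \<zeta> in at p. qchar q \<zeta> * G \<zeta> / qchar q \<zeta> ^ Suc n = G \<zeta> / qchar q \<zeta> ^ n"
    by eventually_elim (simp add: qchar_factor)
qed

lemma moment_recurrence:
  assumes D: "open D" and q: "q \<in> double_domain D" and G: "G holomorphic_on D"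
  shows "moment n G q = moment (Suc n) (\<lambda>\<zeta>. \<zeta>\<^sup>2 * G \<zeta>) q
     - 2 * of_real (Q0 q) * moment (Suc n) (\<lambda>\<zeta>. \<zeta> * G \<zeta>) q
     + of_real ((norm q)\<^sup>2) * moment (Suc n) G q"
proof -
  have G1: "(\<lambda>\<zeta>. \<zeta> * G \<zeta>) holomorphic_on D" and G2: "(\<lambda>\<zeta>. \<zeta>\<^sup>2 * G \<zeta>) holomorphic_on D"
    by (intro holomorphic_intros G)+
  define H where "H = (\<lambda>\<zeta>. - 2 * of_real (Q0 q) * (\<zeta> * G \<zeta>) + of_real ((norm q)\<^sup>2) * G \<zeta>)"
  have H: "H holomorphic_on D" unfolding H_def by (intro holomorphic_intros G)
  have "moment n G q = moment (Suc n) (\<lambda>\<zeta>. qchar q \<zeta> * G \<zeta>) q"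
    by (rule moment_cancel_qchar[symmetric])
  also have "(\<lambda>\<zeta>. qchar q \<zeta> * G \<zeta>) = (\<lambda>\<zeta>. 1 * (\<zeta>\<^sup>2 * G \<zeta>) + 1 * H \<zeta>)"
    by (simp add: fun_eq_iff qchar_eq H_def algebra_simps)
  also have "moment (Suc n) \<dots> q = moment (Suc n) (\<lambda>\<zeta>. \<zeta>\<^sup>2 * G \<zeta>) q + moment (Suc n) H q"
    by (subst moment_linear[OF D q G2 H]) simp
  also have "moment (Suc n) H q = - 2 * of_real (Q0 q) * moment (Suc n) (\<lambda>\<zeta>. \<zeta> * G \<zeta>) q
      + of_real ((norm q)\<^sup>2) * moment (Suc n) G q"
    unfolding H_def by (rule moment_linear[OF D q G1 G])
  finally show ?thesis by simp
qed

text \<open>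
  Off the real axis the two poles are simple.
\<close>

lemma moment_one_nonreal:
  assumes D: "open D" and q: "q \<in> double_domain D" and G: "G holomorphic_on D"
    and y: "Im (upper_pt q) \<noteq> 0"
  shows "moment 1 G q = (G (upper_pt q) - G (cnj (upper_pt q))) / (2 * \<i> * Im (upper_pt q))"
proof -
  define z where "z = upper_pt q"
  have z: "z \<in> D" "cnj z \<in> D" "z \<noteq> cnj z" "Im z \<noteq> 0"
    using q y by (auto simp: double_domain_def z_def complex_eq_iff)
  have diff: "z - cnj z = 2 * \<i> * Im z" "cnj z - z = - (2 * \<i> * Im z)"
    by (simp_all add: complex_eq_iff)
  have res: "residue (\<lambda>\<zeta>. G \<zeta> / ((\<zeta> - a) * (\<zeta> - b))) a = G a / (a - b)" if "a \<in> D" "a \<noteq> b" for a b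
  proof -
    have "residue (\<lambda>\<zeta>. (G \<zeta> / (\<zeta> - b)) / (\<zeta> - a)) a = G a / (a - b)"
    proof (rule residue_simple[of "D - {b}"])
      show "(\<lambda>\<zeta>. G \<zeta> / (\<zeta> - b)) holomorphic_on D - {b}"
        by (intro holomorphic_intros holomorphic_on_subset[OF G]) auto
    qed (use D that in auto)
    then show ?thesis by (simp add: mult.commute)
  qed
  have "moment 1 G q = G z / (z - cnj z) + G (cnj z) / (cnj z - z)"
    using res[of z "cnj z"] res[of "cnj z" z] z
    by (simp add: moment_def z_def[symmetric] qchar_factor mult.commute)
  then show ?thesis unfolding diff z_def[symmetric] by (simp add: diff_divide_distrib)
qed

text \<open>
  Together with \<open>moment_one_shifted\<close> this recovers a symmetric \<open>G\<close> from its moments of order one: the two lemmas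
  give the imaginary and the real part of \<open>G (upper_pt q)\<close>. Multiplied by the imaginary part, the formula of
  \<open>moment_one_nonreal\<close> remains true for real \<open>q\<close>, where both sides vanish.
\<close>

lemma Im_times_moment_one:
  assumes "open D" "q \<in> double_domain D" "G holomorphic_on D"
  shows "of_real (Im (upper_pt q)) * moment 1 G q = (G (upper_pt q) - G (cnj (upper_pt q))) / (2 * \<i>)"
proof (cases "Im (upper_pt q) = 0")
  case True
  then have "cnj (upper_pt q) = upper_pt q" by (simp add: complex_eq_iff)
  with True show ?thesis by simp
next
  case False
  then show ?thesis using moment_one_nonreal[OF assms False] by simp
qed

text \<open>
  For real \<open>q\<close> the factor \<open>\<zeta> - q\<^sub>0\<close> cancels one of the two equal linear factors of \<open>qchar q\<close>, and Cauchy's formula for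
  a simple pole remains.
\<close>

lemma moment_one_shifted:
  assumes D: "open D" and q: "q \<in> double_domain D" and G: "G holomorphic_on D"
  shows "moment 1 (\<lambda>\<zeta>. (\<zeta> - of_real (Q0 q)) * G \<zeta>) q = (G (upper_pt q) + G (cnj (upper_pt q))) / 2"
proof (cases "Im (upper_pt q) = 0")
  case True
  then have z: "cnj (upper_pt q) = upper_pt q" "of_real (Q0 q) = upper_pt q"
    by (simp_all add: complex_eq_iff)
  have "moment 1 (\<lambda>\<zeta>. (\<zeta> - of_real (Q0 q)) * G \<zeta>) q = residue (\<lambda>\<zeta>. G \<zeta> / (\<zeta> - upper_pt q)) (upper_pt q)"
    unfolding moment_def z qchar_factor
    by simp (rule residue_cong; auto simp: eventually_at_filter)
  also have "\<dots> = G (upper_pt q)"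
    by (rule residue_simple[OF D _ G]) (use q in \<open>auto simp: double_domain_def\<close>)
  finally show ?thesis by (simp add: z)
next
  case False
  have "upper_pt q - of_real (Q0 q) = \<i> * Im (upper_pt q)"
       "cnj (upper_pt q) - of_real (Q0 q) = - \<i> * Im (upper_pt q)"
    by (simp_all add: complex_eq_iff)
  moreover have "(\<lambda>\<zeta>. (\<zeta> - of_real (Q0 q)) * G \<zeta>) holomorphic_on D"
    by (intro holomorphic_intros G)
  ultimately have "moment 1 (\<lambda>\<zeta>. (\<zeta> - of_real (Q0 q)) * G \<zeta>) q =
      (\<i> * Im (upper_pt q) * G (upper_pt q) - (- \<i> * Im (upper_pt q)) * G (cnj (upper_pt q)))
        / (2 * \<i> * Im (upper_pt q))"
    using moment_one_nonreal[OF D q _ False, of "\<lambda>\<zeta>. (\<zeta> - of_real (Q0 q)) * G \<zeta>"] by simp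
  also have "\<dots> = \<i> * Im (upper_pt q) * (G (upper_pt q) + G (cnj (upper_pt q))) / (\<i> * Im (upper_pt q) * 2)"
    by (simp add: algebra_simps)
  also have "\<dots> = (G (upper_pt q) + G (cnj (upper_pt q))) / 2"
    using False by (subst mult_divide_mult_cancel_left) auto
  finally show ?thesis .
qed

text \<open>
  A hyperplane has empty interior, so a continuous function cannot be nonzero only there.
\<close>

lemma zero_off_hyperplane_imp_zero:
  fixes h :: "quat \<Rightarrow> real"
  assumes V: "open V" and h: "continuous_on V h" and z: "\<And>q. q \<in> V \<Longrightarrow> Q1 q * h q = 0" and q: "q \<in> V"
  shows "h q = 0"
proof (rule ccontr)
  assume "h q \<noteq> 0"
  define U where "U = V \<inter> h -` (- {0})"
  have "open U" unfolding U_def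
    by (rule continuous_open_preimage[OF h V]) auto
  moreover have "U \<subseteq> {p. inner e1 p = 0}" using z by (auto simp: U_def inner_quat_def)
  ultimately have "U \<subseteq> interior {p. inner e1 p = 0}" by (rule interior_maximal[rotated])
  moreover have "(e1::quat) \<noteq> 0" by (simp add: quat_eq_iff)
  ultimately have "U = {}" using interior_hyperplane by blast
  then show False using q \<open>h q \<noteq> 0\<close> by (auto simp: U_def)
qed

text \<open>
  By induction on the order. In order one the formula for nonreal \<open>q\<close> is a quotient of imaginary numbers. The
  derivative of a real moment in direction \<open>e1\<close> is real, and it is a multiple by \<open>Q1 q\<close> of the moment of the next order.
  Both arguments are used off the hyperplane \<open>Q1 q = 0\<close>, which is filled in by continuity.
\<close>

lemma moment_real:
  assumes D: "open D" and q: "q \<in> double_domain D" and G: "G holomorphic_on D"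
    and sym: "\<And>\<zeta>. \<zeta> \<in> D \<Longrightarrow> cnj \<zeta> \<in> D \<Longrightarrow> G (cnj \<zeta>) = cnj (G \<zeta>)"
  shows "Im (moment (Suc n) G q) = 0"
  using q
proof (induction n arbitrary: q)
  case 0
  show ?case
  proof (rule zero_off_hyperplane_imp_zero[OF open_double_domain[OF D] _ _ 0])
    show "continuous_on (double_domain D) (\<lambda>q. Im (moment (Suc 0) G q))"
      by (intro continuous_intros continuous_on_moment[OF D G])
    fix p assume p: "p \<in> double_domain D"
    show "Q1 p * Im (moment (Suc 0) G p) = 0"
    proof (cases "Q1 p = 0")
      case False
      then have "Im (upper_pt p) \<noteq> 0"
        using Im_upper_pt_square[of p] by (auto simp: sum_power2_eq_zero_iff add_nonneg_eq_0_iff)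
      moreover have "G (cnj (upper_pt p)) = cnj (G (upper_pt p))"
        by (rule sym) (use p in \<open>auto simp: double_domain_def\<close>)
      moreover have "w - cnj w = 2 * \<i> * Im w" for w by (simp add: complex_eq_iff)
      ultimately show ?thesis
        using moment_one_nonreal[OF D p G] by simp
    qed simp
  qed
next
  case (Suc n)
  show ?case
  proof (rule zero_off_hyperplane_imp_zero[OF open_double_domain[OF D] _ _ Suc.prems])
    show "continuous_on (double_domain D) (\<lambda>q. Im (moment (Suc (Suc n)) G q))"
      by (intro continuous_intros continuous_on_moment[OF D G])
    fix p assume p: "p \<in> double_domain D"
    have d: "((\<lambda>t. Im (moment (Suc n) G (p + t *\<^sub>R e1))) has_vector_derivative
          Im (2 * of_nat (Suc n) * (of_real (Q0 e1) * moment (Suc (Suc n)) (\<lambda>\<zeta>. \<zeta> * G \<zeta>) p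
       - of_real (inner p e1) * moment (Suc (Suc n)) G p))) (at 0)"
      by (rule bounded_linear.has_vector_derivative[OF bounded_linear_Im moment_has_vector_derivative[OF D p G]])
    define T where "T = (\<lambda>t. p + t *\<^sub>R e1) -` double_domain D"
    have T: "open T" "0 \<in> T" unfolding T_def using p
      by (auto intro!: open_vimage continuous_intros open_double_domain D)
    have "((\<lambda>t. 0) has_vector_derivative
          Im (2 * of_nat (Suc n) * (of_real (Q0 e1) * moment (Suc (Suc n)) (\<lambda>\<zeta>. \<zeta> * G \<zeta>) p
       - of_real (inner p e1) * moment (Suc (Suc n)) G p))) (at 0)"
      by (rule has_vector_derivative_transform_within_open[OF d T]) (simp add: Suc.IH T_def)
    then have "Im (2 * of_nat (Suc n) * (of_real (Q0 e1) * moment (Suc (Suc n)) (\<lambda>\<zeta>. \<zeta> * G \<zeta>) p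
       - of_real (inner p e1) * moment (Suc (Suc n)) G p)) = 0"
      using vector_derivative_unique_at has_vector_derivative_const by metis
    then have "2 * real (Suc n) * (inner p e1 * Im (moment (Suc (Suc n)) G p)) = 0"
      by (simp del: of_nat_Suc)
    then show "Q1 p * Im (moment (Suc (Suc n)) G p) = 0"
      by (simp add: inner_quat_def del: of_nat_Suc)
  qed
qed

text \<open>
  The quaternion with the moments of \<open>\<zeta>\<^sup>j F\<^sub>b\<close> as coordinates. Taking real parts turns the complex moments, whose imaginary
  parts vanish in the intended use, into coordinates.
\<close>

definition qmoment :: "(quat \<Rightarrow> complex \<Rightarrow> complex) \<Rightarrow> nat \<Rightarrow> nat \<Rightarrow> quat \<Rightarrow> quat" where
  "qmoment F n j q = (\<Sum>b\<in>Basis. Re (moment n (\<lambda>\<zeta>. \<zeta> ^ j * F b \<zeta>) q) *\<^sub>R b)"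

lemma continuous_on_qmoment:
  assumes D: "open D" and F: "\<And>b. b \<in> Basis \<Longrightarrow> F b holomorphic_on D"
  shows "continuous_on (double_domain D) (qmoment F n j)"
  unfolding qmoment_def[abs_def]
  by (intro continuous_intros continuous_on_moment[OF D] holomorphic_intros F)

lemma qmoment_has_vector_derivative:
  assumes D: "open D" and q: "q \<in> double_domain D" and F: "\<And>b. b \<in> Basis \<Longrightarrow> F b holomorphic_on D"
  shows "((\<lambda>t. qmoment F n j (q + t *\<^sub>R e)) has_vector_derivative
     (2 * real n) *\<^sub>R (Q0 e *\<^sub>R qmoment F (Suc n) (Suc j) q - inner q e *\<^sub>R qmoment F (Suc n) j q)) (at 0)"
proof -
  have "((\<lambda>t. qmoment F n j (q + t *\<^sub>R e)) has_vector_derivative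
     (\<Sum>b\<in>Basis. Re (2 * of_nat n * (of_real (Q0 e) * moment (Suc n) (\<lambda>\<zeta>. \<zeta> * (\<zeta> ^ j * F b \<zeta>)) q
       - of_real (inner q e) * moment (Suc n) (\<lambda>\<zeta>. \<zeta> ^ j * F b \<zeta>) q)) *\<^sub>R b)) (at 0)"
    unfolding qmoment_def
    by (intro has_vector_derivative_sum bounded_linear.has_vector_derivative[OF bounded_linear_scaleR_left]
          bounded_linear.has_vector_derivative[OF bounded_linear_Re]
          moment_has_vector_derivative[OF D q] holomorphic_intros F)
  also have "(\<Sum>b\<in>Basis. Re (2 * of_nat n * (of_real (Q0 e) * moment (Suc n) (\<lambda>\<zeta>. \<zeta> * (\<zeta> ^ j * F b \<zeta>)) q
       - of_real (inner q e) * moment (Suc n) (\<lambda>\<zeta>. \<zeta> ^ j * F b \<zeta>) q)) *\<^sub>R b) =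
     (\<Sum>b\<in>Basis. (2 * real n) *\<^sub>R (Q0 e *\<^sub>R (Re (moment (Suc n) (\<lambda>\<zeta>. \<zeta> ^ Suc j * F b \<zeta>) q) *\<^sub>R b)
        - inner q e *\<^sub>R (Re (moment (Suc n) (\<lambda>\<zeta>. \<zeta> ^ j * F b \<zeta>) q) *\<^sub>R b)))"
    by (intro sum.cong refl) (simp add: algebra_simps)
  also have "\<dots> = (2 * real n) *\<^sub>R (Q0 e *\<^sub>R qmoment F (Suc n) (Suc j) q - inner q e *\<^sub>R qmoment F (Suc n) j q)"
    unfolding qmoment_def by (simp only: scaleR_sum_right sum_subtractf scaleR_right_diff_distrib)
  finally show ?thesis .
qed

lemma qmoment_recurrence:
  assumes D: "open D" and q: "q \<in> double_domain D" and F: "\<And>b. b \<in> Basis \<Longrightarrow> F b holomorphic_on D"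
  shows "qmoment F n j q = qmoment F (Suc n) (Suc (Suc j)) q
     - (2 * Q0 q) *\<^sub>R qmoment F (Suc n) (Suc j) q + (norm q)\<^sup>2 *\<^sub>R qmoment F (Suc n) j q"
proof -
  have rec: "Re (moment n (\<lambda>\<zeta>. \<zeta> ^ j * F b \<zeta>) q) = Re (moment (Suc n) (\<lambda>\<zeta>. \<zeta> ^ Suc (Suc j) * F b \<zeta>) q)
     - 2 * Q0 q * Re (moment (Suc n) (\<lambda>\<zeta>. \<zeta> ^ Suc j * F b \<zeta>) q)
     + (norm q)\<^sup>2 * Re (moment (Suc n) (\<lambda>\<zeta>. \<zeta> ^ j * F b \<zeta>) q)" if b: "b \<in> Basis" for b
  proof -
    have "(\<lambda>\<zeta>. \<zeta> ^ j * F b \<zeta>) holomorphic_on D" by (intro holomorphic_intros F b)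
    from moment_recurrence[OF D q this, of n] show ?thesis
      by (simp add: power2_eq_square mult.assoc)
  qed
  have "qmoment F n j q = (\<Sum>b\<in>Basis. Re (moment (Suc n) (\<lambda>\<zeta>. \<zeta> ^ Suc (Suc j) * F b \<zeta>) q) *\<^sub>R b
     - (2 * Q0 q) *\<^sub>R (Re (moment (Suc n) (\<lambda>\<zeta>. \<zeta> ^ Suc j * F b \<zeta>) q) *\<^sub>R b)
     + (norm q)\<^sup>2 *\<^sub>R (Re (moment (Suc n) (\<lambda>\<zeta>. \<zeta> ^ j * F b \<zeta>) q) *\<^sub>R b))"
    unfolding qmoment_def
    by (intro sum.cong refl) (simp only: rec scaleR_left_diff_distrib scaleR_left_distrib scaleR_scaleR)
  then show ?thesis unfolding qmoment_def by (simp only: scaleR_sum_right sum_subtractf sum.distrib)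
qed

section \<open>Functions with continuous partial derivatives\<close>

lemma eventually_line_in_open:
  fixes q e :: "'a::real_normed_vector"
  assumes "open V" "q \<in> V"
  shows "\<forall>\<^sub>F t in nhds 0. q + t *\<^sub>R e \<in> V"
proof -
  have "open ((\<lambda>t. q + t *\<^sub>R e) -` V)" by (intro open_vimage assms continuous_intros)
  from eventually_nhds_in_open[OF this, of 0] assms show ?thesis by simp
qed

lemma partial_deriv_cong:
  assumes "open V" "\<And>q. q \<in> V \<Longrightarrow> g q = h q" "q \<in> V"
  shows "partial_deriv e g q = partial_deriv e h q"
  unfolding partial_deriv_def
  by (rule vector_derivative_cong_eq)
     (use eventually_line_in_open[OF assms(1,3), of e] assms(2) in \<open>auto elim: eventually_mono\<close>)

lemma differentiable_line_cong:
  fixes g h :: "'a::real_normed_vector \<Rightarrow> 'b::real_normed_vector"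
  assumes "open V" "\<And>q. q \<in> V \<Longrightarrow> g q = h q" "q \<in> V"
    "(\<lambda>t. g (q + t *\<^sub>R e)) differentiable (at (0::real))"
  shows "(\<lambda>t. h (q + t *\<^sub>R e)) differentiable (at (0::real))"
proof -
  define T where "T = (\<lambda>t::real. q + t *\<^sub>R e) -` V"
  have T: "open T" "0 \<in> T"
    unfolding T_def using assms(3) by (auto intro!: open_vimage[OF assms(1)] continuous_intros)
  have "((\<lambda>t. h (q + t *\<^sub>R e)) has_vector_derivative vector_derivative (\<lambda>t. g (q + t *\<^sub>R e)) (at 0)) (at 0)"
    by (rule has_vector_derivative_transform_within_open[OF assms(4)[unfolded vector_derivative_works] T])
       (use assms(2) in \<open>simp add: T_def\<close>)
  then show ?thesis by (rule differentiableI_vector)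
qed

lemma fueter_cong:
  assumes "open V" "\<And>q. q \<in> V \<Longrightarrow> g q = h q" "q \<in> V"
  shows "fueter_left g q = fueter_left h q" "fueter_conj_left g q = fueter_conj_left h q"
    "fueter_right g q = fueter_right h q" "fueter_conj_right g q = fueter_conj_right h q"
  using partial_deriv_cong[OF assms]
  by (simp_all add: fueter_left_def fueter_conj_left_def fueter_right_def fueter_conj_right_def)

lemma C_diff_cong:
  assumes "open V" "\<And>q. q \<in> V \<Longrightarrow> g q = h q"
  shows "C_diff n V g \<longleftrightarrow> C_diff n V h"
  using assms(2)
proof (induction n arbitrary: g h)
  case 0
  then show ?case using continuous_on_cong[OF refl, of V g h] by simp
next
  case (Suc n)
  have "C_diff n V (partial_deriv e g) \<longleftrightarrow> C_diff n V (partial_deriv e h)" for e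
    by (rule Suc.IH) (rule partial_deriv_cong[OF assms(1)], use Suc.prems in auto)
  moreover have "(\<lambda>t::real. g (q + t *\<^sub>R e)) differentiable (at 0) \<longleftrightarrow>
       (\<lambda>t::real. h (q + t *\<^sub>R e)) differentiable (at 0)" if "q \<in> V" for q e
    using differentiable_line_cong[OF assms(1) _ that, of g h e]
      differentiable_line_cong[OF assms(1) _ that, of h g e] Suc.prems by auto
  moreover have "continuous_on V g \<longleftrightarrow> continuous_on V h"
    using continuous_on_cong[OF refl, of V g h] Suc.prems by simp
  ultimately show ?case by simp
qed

lemma C_diff_continuous_on: "C_diff n V g \<Longrightarrow> continuous_on V g"
  by (cases n) auto

lemma C_diff_SucD: "C_diff (Suc n) V g \<Longrightarrow> C_diff n V g"
proof (induction n arbitrary: g)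
  case (Suc n)
  from Suc.prems have "C_diff n V (partial_deriv e g)" if "e \<in> {1, e1, e2, e3}" for e
    using that by (intro Suc.IH) (subst (asm) C_diff.simps(2), blast)
  with Suc.prems show ?case by simp
qed simp

lemma partial_deriv_eqI:
  "((\<lambda>t. g (q + t *\<^sub>R e)) has_vector_derivative d) (at 0) \<Longrightarrow> partial_deriv e g q = d"
  unfolding partial_deriv_def by (rule vector_derivative_at)

text \<open>
  In the inductions below the partial derivatives come from derivative rules. The openness of \<open>V\<close> allows
  \<^const>\<open>partial_deriv\<close> to be replaced by such a derivative known on \<open>V\<close> only.
\<close>

lemma C_diff_SucI:
  assumes "open V" "continuous_on V g"
    and d: "\<And>e q. e \<in> {1, e1, e2, e3} \<Longrightarrow> q \<in> V \<Longrightarrow> ((\<lambda>t. g (q + t *\<^sub>R e)) has_vector_derivative g' e q) (at 0)"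
    and C: "\<And>e. e \<in> {1, e1, e2, e3} \<Longrightarrow> C_diff n V (g' e)"
  shows "C_diff (Suc n) V g"
proof -
  have "C_diff n V (partial_deriv e g)" if "e \<in> {1, e1, e2, e3}" for e
    using C_diff_cong[where n = n, OF assms(1) partial_deriv_eqI[OF d[OF that]]] C[OF that] by simp
  moreover have "(\<lambda>t::real. g (q + t *\<^sub>R e)) differentiable (at 0)" if "e \<in> {1, e1, e2, e3}" "q \<in> V" for e q
    using d[OF that] by (rule differentiableI_vector)
  ultimately show ?thesis using assms(2) by simp
qed

lemma C_diff_SucE:
  assumes "C_diff (Suc n) V g" "e \<in> {1, e1, e2, e3}"
  shows "C_diff n V (partial_deriv e g)"
    and "q \<in> V \<Longrightarrow> ((\<lambda>t. g (q + t *\<^sub>R e)) has_vector_derivative partial_deriv e g q) (at 0)"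
proof -
  show "C_diff n V (partial_deriv e g)" using assms by auto
  have "(\<lambda>t. g (q + t *\<^sub>R e)) differentiable (at 0)" if "q \<in> V"
    using assms that by auto
  then show "q \<in> V \<Longrightarrow> ((\<lambda>t. g (q + t *\<^sub>R e)) has_vector_derivative partial_deriv e g q) (at 0)"
    unfolding partial_deriv_def by (simp add: vector_derivative_works)
qed

lemma C_diff_add:
  assumes V: "open V"
  shows "C_diff n V g \<Longrightarrow> C_diff n V h \<Longrightarrow> C_diff n V (\<lambda>q. g q + h q)"
proof (induction n arbitrary: g h)
  case 0
  then show ?case by (auto intro: continuous_intros)
next
  case (Suc n)
  note c = Suc.prems[THEN C_diff_continuous_on]
  show ?case
    by (rule C_diff_SucI[OF V, where g' = "\<lambda>e q. partial_deriv e g q + partial_deriv e h q"])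
       (use c Suc.IH C_diff_SucE[OF Suc.prems(1)] C_diff_SucE[OF Suc.prems(2)] in
         \<open>auto intro!: continuous_intros has_vector_derivative_add\<close>)
qed

lemma C_diff_mult:
  assumes V: "open V"
  shows "C_diff n V g \<Longrightarrow> C_diff n V h \<Longrightarrow> C_diff n V (\<lambda>q. g q * h q)"
proof (induction n arbitrary: g h)
  case 0
  then show ?case by (auto intro: continuous_intros)
next
  case (Suc n)
  note c = Suc.prems[THEN C_diff_continuous_on]
  note l = Suc.prems[THEN C_diff_SucD]
  show ?case
  proof (rule C_diff_SucI[OF V, where g' = "\<lambda>e q. g q * partial_deriv e h q + partial_deriv e g q * h q"])
    show "continuous_on V (\<lambda>q. g q * h q)" using c by (intro continuous_intros)
    fix e :: quat assume e: "e \<in> {1, e1, e2, e3}"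
    note C = C_diff_SucE[OF Suc.prems(1) e] C_diff_SucE[OF Suc.prems(2) e]
    show "C_diff n V (\<lambda>q. g q * partial_deriv e h q + partial_deriv e g q * h q)"
      by (intro C_diff_add V Suc.IH l C(1) C(3))
    fix q assume q: "q \<in> V"
    show "((\<lambda>t. g (q + t *\<^sub>R e) * h (q + t *\<^sub>R e)) has_vector_derivative
              g q * partial_deriv e h q + partial_deriv e g q * h q) (at 0)"
      using has_vector_derivative_mult[OF C(2)[OF q] C(4)[OF q]] by simp
  qed
qed

lemma C_diff_const:
  assumes V: "open V"
  shows "C_diff n V (\<lambda>q. c)"
proof (induction n arbitrary: c)
  case (Suc n)
  show ?case
    by (rule C_diff_SucI[OF V, where g' = "\<lambda>e q. 0"]) (use Suc in auto)
qed simp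

lemma C_diff_linear:
  assumes V: "open V" and f: "bounded_linear f"
  shows "C_diff n V f"
proof (cases n)
  case 0
  then show ?thesis using bounded_linear.continuous_on[OF f continuous_on_id] by simp
next
  case (Suc m)
  have d: "((\<lambda>t. f (q + t *\<^sub>R e)) has_vector_derivative f e) (at 0)" for q e
  proof -
    have "((\<lambda>t. q + t *\<^sub>R e) has_vector_derivative e) (at 0)"
      by (auto intro!: derivative_eq_intros)
    from bounded_linear.has_vector_derivative[OF f this] show ?thesis .
  qed
  show ?thesis unfolding Suc
    by (rule C_diff_SucI[OF V, where g' = "\<lambda>e q. f e"])
       (use d C_diff_const[OF V] bounded_linear.continuous_on[OF f continuous_on_id] in auto)
qed

lemma C_diff_diff:
  assumes "open V" "C_diff n V g" "C_diff n V h"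
  shows "C_diff n V (\<lambda>q. g q - h q)"
proof -
  have "C_diff n V (\<lambda>q. g q + (-1) * h q)"
    by (intro C_diff_add C_diff_mult C_diff_const assms)
  then show ?thesis by simp
qed

lemma bounded_linear_qcnj: "bounded_linear qcnj"
  by (rule linear_conv_bounded_linear[THEN iffD1], rule linearI) (simp_all add: quat_eq_iff qcnj_def)

lemma norm_quat_square: "(norm q)\<^sup>2 = (Q0 q)\<^sup>2 + (Q1 q)\<^sup>2 + (Q2 q)\<^sup>2 + (Q3 q)\<^sup>2"
  by (simp add: norm_quat_def)

lemma qcnj_sel [simp]:
  "Q0 (qcnj q) = Q0 q" "Q1 (qcnj q) = - Q1 q" "Q2 (qcnj q) = - Q2 q" "Q3 (qcnj q) = - Q3 q"
  by (simp_all add: qcnj_def)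

lemma quat_numeral_sel [simp]:
  "Q0 (numeral k) = numeral k" "Q1 (numeral k) = 0" "Q2 (numeral k) = 0" "Q3 (numeral k) = 0"
  using quat_of_real_sel[of "numeral k"] by simp_all

section \<open>Fueter operators on families of moments\<close>

text \<open>
  The two rules for moments, detached from their origin. The computations with Fueter operators use nothing else.
\<close>

locale moment_family =
  fixes V :: "quat set" and K :: "nat \<Rightarrow> nat \<Rightarrow> quat \<Rightarrow> quat"
  assumes open_V: "open V"
    and cont: "continuous_on V (K n j)"
    and deriv: "q \<in> V \<Longrightarrow> ((\<lambda>t. K n j (q + t *\<^sub>R e)) has_vector_derivative
      (2 * real n) *\<^sub>R (Q0 e *\<^sub>R K (Suc n) (Suc j) q - inner q e *\<^sub>R K (Suc n) j q)) (at 0)"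
    and rec: "q \<in> V \<Longrightarrow> K n j q = K (Suc n) (Suc (Suc j)) q
      - (2 * Q0 q) *\<^sub>R K (Suc n) (Suc j) q + (norm q)\<^sup>2 *\<^sub>R K (Suc n) j q"
begin

text \<open>
  The derivatives of a moment are combinations, with linear coefficients, of moments of the next order, so the family is closed
  under differentiation.
\<close>

lemma C_diff_K: "C_diff m V (K n j)"
proof (induction m arbitrary: n j)
  case 0
  then show ?case using cont by simp
next
  case (Suc m)
  show ?case
  proof (rule C_diff_SucI[OF open_V cont deriv])
    fix e :: quat
    have bl: "bounded_linear (\<lambda>q. of_real (inner q e) :: quat)"
      by (intro bounded_linear_of_real[THEN bounded_linear_compose] bounded_linear_inner_left)
    have "C_diff m V (\<lambda>q. of_real (2 * real n * Q0 e) * K (Suc n) (Suc j) q -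
        of_real (2 * real n) * (of_real (inner q e) * K (Suc n) j q))"
      by (intro C_diff_diff C_diff_mult C_diff_const C_diff_linear open_V Suc.IH bl)
    also have "(\<lambda>q. of_real (2 * real n * Q0 e) * K (Suc n) (Suc j) q -
        of_real (2 * real n) * (of_real (inner q e) * K (Suc n) j q)) =
       (\<lambda>q. (2 * real n) *\<^sub>R (Q0 e *\<^sub>R K (Suc n) (Suc j) q - inner q e *\<^sub>R K (Suc n) j q))"
      by (simp only: fun_eq_iff scaleR_conv_of_real of_real_mult right_diff_distrib mult.assoc simp_thms)
    finally show "C_diff m V (\<lambda>q. (2 * real n) *\<^sub>R (Q0 e *\<^sub>R K (Suc n) (Suc j) q - inner q e *\<^sub>R K (Suc n) j q))" .
  qed
qed

definition dK :: "nat \<Rightarrow> nat \<Rightarrow> quat \<Rightarrow> quat \<Rightarrow> quat" where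
  "dK n j e q = (2 * real n) *\<^sub>R (Q0 e *\<^sub>R K (Suc n) (Suc j) q - inner q e *\<^sub>R K (Suc n) j q)"

lemma line_derivs:
  assumes "q \<in> V"
  shows "((\<lambda>t. K n j (q + t *\<^sub>R e)) has_vector_derivative dK n j e q) (at 0)"
    "((\<lambda>t. qcnj (q + t *\<^sub>R e)) has_vector_derivative qcnj e) (at 0)"
    "((\<lambda>t. of_real (Q0 (q + t *\<^sub>R e)) :: quat) has_vector_derivative of_real (Q0 e)) (at 0)"
proof -
  show "((\<lambda>t. K n j (q + t *\<^sub>R e)) has_vector_derivative dK n j e q) (at 0)"
    unfolding dK_def by (rule deriv[OF assms])
  have l: "((\<lambda>t. q + t *\<^sub>R e) has_vector_derivative e) (at 0)"
    by (auto intro!: derivative_eq_intros)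
  show "((\<lambda>t. qcnj (q + t *\<^sub>R e)) has_vector_derivative qcnj e) (at 0)"
    by (rule bounded_linear.has_vector_derivative[OF bounded_linear_qcnj l])
  show "((\<lambda>t. of_real (Q0 (q + t *\<^sub>R e)) :: quat) has_vector_derivative of_real (Q0 e)) (at 0)"
    by (rule bounded_linear.has_vector_derivative[OF _ l])
       (intro bounded_linear_of_real[THEN bounded_linear_compose] bounded_linear_Q)
qed

text \<open>
  The rule \<open>rec\<close> rewrites the moment of order one that the product rule leaves behind into moments of order two.
  The same device, one order higher, proves the next two lemmas; after it, each claim is a polynomial identity in coordinates.
\<close>

lemma fueter_conj_left_cauchy:
  assumes q: "q \<in> V"
  shows "fueter_conj_left (\<lambda>q. K 1 1 q - qcnj q * K 1 0 q) q =
     4 * (K 2 2 q - (of_real (Q0 q) + qcnj q) * K 2 1 q + of_real (Q0 q) * qcnj q * K 2 0 q)"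
proof -
  have d: "partial_deriv e (\<lambda>q. K 1 1 q - qcnj q * K 1 0 q) q =
      dK 1 1 e q - (qcnj q * dK 1 0 e q + qcnj e * K 1 0 q)" for e
    by (rule partial_deriv_eqI)
       (use has_vector_derivative_diff[OF line_derivs(1)[OF q]
           has_vector_derivative_mult[OF line_derivs(2)[OF q] line_derivs(1)[OF q]]] in simp)
  have r: "K 1 0 q = K 2 2 q - (2 * Q0 q) *\<^sub>R K 2 1 q + (norm q)\<^sup>2 *\<^sub>R K 2 0 q"
    using rec[OF q, of 1 0] by (simp add: numeral_2_eq_2)
  have k: "dK 1 1 e q = 2 *\<^sub>R (Q0 e *\<^sub>R K 2 2 q - inner q e *\<^sub>R K 2 1 q)"
     "dK 1 0 e q = 2 *\<^sub>R (Q0 e *\<^sub>R K 2 1 q - inner q e *\<^sub>R K 2 0 q)" for e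
    by (simp_all add: dK_def numeral_2_eq_2)
  show ?thesis
    unfolding fueter_conj_left_def d k r norm_quat_square
    by (simp add: quat_eq_iff inner_quat_def algebra_simps power2_eq_square)
qed

lemma fueter_left_conj_cauchy:
  assumes q: "q \<in> V"
  shows "fueter_left (\<lambda>q. 4 * (K 2 2 q - (of_real (Q0 q) + qcnj q) * K 2 1 q + of_real (Q0 q) * qcnj q * K 2 0 q)) q
    = - 4 * (K 2 1 q - qcnj q * K 2 0 q)"
proof -
  have d: "partial_deriv e (\<lambda>q. 4 * (K 2 2 q - (of_real (Q0 q) + qcnj q) * K 2 1 q + of_real (Q0 q) * qcnj q * K 2 0 q)) q =
      4 * (dK 2 2 e q - ((of_real (Q0 q) + qcnj q) * dK 2 1 e q + (of_real (Q0 e) + qcnj e) * K 2 1 q) +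
        (of_real (Q0 q) * qcnj q * dK 2 0 e q + (of_real (Q0 q) * qcnj e + of_real (Q0 e) * qcnj q) * K 2 0 q))" for e
    by (rule partial_deriv_eqI, rule has_vector_derivative_eq_rhs,
        (rule has_vector_derivative_mult_right has_vector_derivative_add has_vector_derivative_diff
          has_vector_derivative_mult line_derivs[OF q])+)
       (simp add: algebra_simps)
  have r: "K 2 0 q = K 3 2 q - (2 * Q0 q) *\<^sub>R K 3 1 q + (norm q)\<^sup>2 *\<^sub>R K 3 0 q"
     "K 2 1 q = K 3 3 q - (2 * Q0 q) *\<^sub>R K 3 2 q + (norm q)\<^sup>2 *\<^sub>R K 3 1 q"
    using rec[OF q, of 2 0] rec[OF q, of 2 1] by (simp_all add: eval_nat_numeral)
  have k: "dK 2 j e q = 4 *\<^sub>R (Q0 e *\<^sub>R K 3 (Suc j) q - inner q e *\<^sub>R K 3 j q)" for e j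
    by (simp add: dK_def eval_nat_numeral)
  have s: "Suc 0 = 1" "Suc 1 = 2" "Suc 2 = 3" by auto
  show ?thesis
    unfolding fueter_left_def d k r norm_quat_square s
    by (simp add: quat_eq_iff inner_quat_def algebra_simps power2_eq_square)
qed

text \<open>
  With the kernel of the moments restored, \<open>- 4 (K 2 1 - qcnj q K 2 0)\<close> is, up to the factor
  \<open>2 \<pi>\<close>, the integral of the F-kernel against \<open>f\<close>, and this identity is the Fueter regularity of that kernel.
\<close>

lemma fueter_left_F:
  assumes q: "q \<in> V"
  shows "fueter_left (\<lambda>q. - 4 * (K 2 1 q - qcnj q * K 2 0 q)) q = 0"
proof -
  have d: "partial_deriv e (\<lambda>q. - 4 * (K 2 1 q - qcnj q * K 2 0 q)) q =
      - 4 * (dK 2 1 e q - (qcnj q * dK 2 0 e q + qcnj e * K 2 0 q))" for e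
    by (rule partial_deriv_eqI, rule has_vector_derivative_eq_rhs,
        (rule has_vector_derivative_mult_right has_vector_derivative_add has_vector_derivative_diff
          has_vector_derivative_mult line_derivs[OF q])+)
       (simp add: algebra_simps)
  have r: "K 2 0 q = K 3 2 q - (2 * Q0 q) *\<^sub>R K 3 1 q + (norm q)\<^sup>2 *\<^sub>R K 3 0 q"
    using rec[OF q, of 2 0] by (simp_all add: eval_nat_numeral)
  have k: "dK 2 j e q = 4 *\<^sub>R (Q0 e *\<^sub>R K 3 (Suc j) q - inner q e *\<^sub>R K 3 j q)" for e j
    by (simp add: dK_def eval_nat_numeral)
  have s: "Suc 0 = 1" "Suc 1 = 2" "Suc 2 = 3" by auto
  show ?thesis
    unfolding fueter_left_def d k r norm_quat_square s
    by (simp add: quat_eq_iff inner_quat_def algebra_simps power2_eq_square)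
qed

text \<open>
  The right-hand versions have the moments to the left of the conjugate.
\<close>

lemma fueter_conj_right_cauchy:
  assumes q: "q \<in> V"
  shows "fueter_conj_right (\<lambda>q. K 1 1 q - K 1 0 q * qcnj q) q =
     4 * (K 2 2 q - K 2 1 q * (of_real (Q0 q) + qcnj q) + K 2 0 q * (of_real (Q0 q) * qcnj q))"
proof -
  have d: "partial_deriv e (\<lambda>q. K 1 1 q - K 1 0 q * qcnj q) q =
      dK 1 1 e q - (K 1 0 q * qcnj e + dK 1 0 e q * qcnj q)" for e
    by (rule partial_deriv_eqI)
       (use has_vector_derivative_diff[OF line_derivs(1)[OF q]
           has_vector_derivative_mult[OF line_derivs(1)[OF q] line_derivs(2)[OF q]]] in simp)
  have r: "K 1 0 q = K 2 2 q - (2 * Q0 q) *\<^sub>R K 2 1 q + (norm q)\<^sup>2 *\<^sub>R K 2 0 q"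
    using rec[OF q, of 1 0] by (simp add: numeral_2_eq_2)
  have k: "dK 1 1 e q = 2 *\<^sub>R (Q0 e *\<^sub>R K 2 2 q - inner q e *\<^sub>R K 2 1 q)"
     "dK 1 0 e q = 2 *\<^sub>R (Q0 e *\<^sub>R K 2 1 q - inner q e *\<^sub>R K 2 0 q)" for e
    by (simp_all add: dK_def numeral_2_eq_2)
  show ?thesis
    unfolding fueter_conj_right_def d k r norm_quat_square
    by (simp add: quat_eq_iff inner_quat_def algebra_simps power2_eq_square)
qed

lemma fueter_right_conj_cauchy:
  assumes q: "q \<in> V"
  shows "fueter_right (\<lambda>q. 4 * (K 2 2 q - K 2 1 q * (of_real (Q0 q) + qcnj q) + K 2 0 q * (of_real (Q0 q) * qcnj q))) q
    = - 4 * (K 2 1 q - K 2 0 q * qcnj q)"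
proof -
  have d: "partial_deriv e (\<lambda>q. 4 * (K 2 2 q - K 2 1 q * (of_real (Q0 q) + qcnj q) + K 2 0 q * (of_real (Q0 q) * qcnj q))) q =
      4 * (dK 2 2 e q - (dK 2 1 e q * (of_real (Q0 q) + qcnj q) + K 2 1 q * (of_real (Q0 e) + qcnj e)) +
        (dK 2 0 e q * (of_real (Q0 q) * qcnj q) + K 2 0 q * (of_real (Q0 q) * qcnj e + of_real (Q0 e) * qcnj q)))" for e
    by (rule partial_deriv_eqI, rule has_vector_derivative_eq_rhs,
        (rule has_vector_derivative_mult_right has_vector_derivative_add has_vector_derivative_diff
          has_vector_derivative_mult line_derivs[OF q])+)
       (simp add: algebra_simps)
  have r: "K 2 0 q = K 3 2 q - (2 * Q0 q) *\<^sub>R K 3 1 q + (norm q)\<^sup>2 *\<^sub>R K 3 0 q"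
     "K 2 1 q = K 3 3 q - (2 * Q0 q) *\<^sub>R K 3 2 q + (norm q)\<^sup>2 *\<^sub>R K 3 1 q"
    using rec[OF q, of 2 0] rec[OF q, of 2 1] by (simp_all add: eval_nat_numeral)
  have k: "dK 2 j e q = 4 *\<^sub>R (Q0 e *\<^sub>R K 3 (Suc j) q - inner q e *\<^sub>R K 3 j q)" for e j
    by (simp add: dK_def eval_nat_numeral)
  have s: "Suc 0 = 1" "Suc 1 = 2" "Suc 2 = 3" by auto
  show ?thesis
    unfolding fueter_right_def d k r norm_quat_square s
    by (simp add: quat_eq_iff inner_quat_def algebra_simps power2_eq_square)
qed

lemma fueter_right_F:
  assumes q: "q \<in> V"
  shows "fueter_right (\<lambda>q. - 4 * (K 2 1 q - K 2 0 q * qcnj q)) q = 0"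
proof -
  have d: "partial_deriv e (\<lambda>q. - 4 * (K 2 1 q - K 2 0 q * qcnj q)) q =
      - 4 * (dK 2 1 e q - (K 2 0 q * qcnj e + dK 2 0 e q * qcnj q))" for e
    by (rule partial_deriv_eqI, rule has_vector_derivative_eq_rhs,
        (rule has_vector_derivative_mult_right has_vector_derivative_add has_vector_derivative_diff
          has_vector_derivative_mult line_derivs[OF q])+)
       (simp add: algebra_simps)
  have r: "K 2 0 q = K 3 2 q - (2 * Q0 q) *\<^sub>R K 3 1 q + (norm q)\<^sup>2 *\<^sub>R K 3 0 q"
    using rec[OF q, of 2 0] by (simp_all add: eval_nat_numeral)
  have k: "dK 2 j e q = 4 *\<^sub>R (Q0 e *\<^sub>R K 3 (Suc j) q - inner q e *\<^sub>R K 3 j q)" for e j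
    by (simp add: dK_def eval_nat_numeral)
  have s: "Suc 0 = 1" "Suc 1 = 2" "Suc 2 = 3" by auto
  show ?thesis
    unfolding fueter_right_def d k r norm_quat_square s
    by (simp add: quat_eq_iff inner_quat_def algebra_simps power2_eq_square)
qed

text \<open>
  The Fueter operators depend only on the germ of a function, so the three identities can be chained for any \<open>f\<close> that
  is given on \<open>V\<close> by the Cauchy formula.
\<close>

lemma left_polyanalytic2_cauchy:
  assumes f: "\<And>q. q \<in> V \<Longrightarrow> f q = K 1 1 q - qcnj q * K 1 0 q"
  shows "q \<in> V \<Longrightarrow> fueter_conj_left f q =
           4 * (K 2 2 q - (of_real (Q0 q) + qcnj q) * K 2 1 q + of_real (Q0 q) * qcnj q * K 2 0 q)"
    and "left_polyanalytic2 V (fueter_conj_left f)"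
proof -
  let ?g = "\<lambda>q. 4 * (K 2 2 q - (of_real (Q0 q) + qcnj q) * K 2 1 q + of_real (Q0 q) * qcnj q * K 2 0 q)"
  show g: "fueter_conj_left f q = ?g q" if q: "q \<in> V" for q
    using fueter_cong[OF open_V f q] fueter_conj_left_cauchy[OF q] by simp
  have C0: "C_diff 2 V (\<lambda>q. of_real (Q0 q))"
    by (intro C_diff_linear open_V bounded_linear_of_real[THEN bounded_linear_compose] bounded_linear_Q)
  have "C_diff 2 V ?g"
    by (intro C_diff_add C_diff_diff C_diff_mult C_diff_const C_diff_linear[OF _ bounded_linear_qcnj]
          C_diff_K open_V C0)
  then have "C_diff 2 V (fueter_conj_left f)"
    by (subst C_diff_cong[OF open_V g])
  moreover have h: "fueter_left (fueter_conj_left f) q = - 4 * (K 2 1 q - qcnj q * K 2 0 q)" if q: "q \<in> V" for q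
    using fueter_cong[OF open_V g q] fueter_left_conj_cauchy[OF q] by simp
  have "fueter_left (fueter_left (fueter_conj_left f)) q = 0" if q: "q \<in> V" for q
    using fueter_cong[OF open_V h q] fueter_left_F[OF q] by simp
  ultimately show "left_polyanalytic2 V (fueter_conj_left f)"
    by (simp add: left_polyanalytic2_def)
qed

lemma right_polyanalytic2_cauchy:
  assumes f: "\<And>q. q \<in> V \<Longrightarrow> f q = K 1 1 q - K 1 0 q * qcnj q"
  shows "q \<in> V \<Longrightarrow> fueter_conj_right f q =
           4 * (K 2 2 q - K 2 1 q * (of_real (Q0 q) + qcnj q) + K 2 0 q * (of_real (Q0 q) * qcnj q))"
    and "right_polyanalytic2 V (fueter_conj_right f)"
proof -
  let ?g = "\<lambda>q. 4 * (K 2 2 q - K 2 1 q * (of_real (Q0 q) + qcnj q) + K 2 0 q * (of_real (Q0 q) * qcnj q))"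
  show g: "fueter_conj_right f q = ?g q" if q: "q \<in> V" for q
    using fueter_cong[OF open_V f q] fueter_conj_right_cauchy[OF q] by simp
  have C0: "C_diff 2 V (\<lambda>q. of_real (Q0 q))"
    by (intro C_diff_linear open_V bounded_linear_of_real[THEN bounded_linear_compose] bounded_linear_Q)
  have "C_diff 2 V ?g"
    by (intro C_diff_add C_diff_diff C_diff_mult C_diff_const C_diff_linear[OF _ bounded_linear_qcnj]
          C_diff_K open_V C0)
  then have "C_diff 2 V (fueter_conj_right f)"
    by (subst C_diff_cong[OF open_V g])
  moreover have h: "fueter_right (fueter_conj_right f) q = - 4 * (K 2 1 q - K 2 0 q * qcnj q)" if q: "q \<in> V" for q
    using fueter_cong[OF open_V g q] fueter_right_conj_cauchy[OF q] by simp
  have "fueter_right (fueter_right (fueter_conj_right f)) q = 0" if q: "q \<in> V" for q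
    using fueter_cong[OF open_V h q] fueter_right_F[OF q] by simp
  ultimately show "right_polyanalytic2 V (fueter_conj_right f)"
    by (simp add: right_polyanalytic2_def)
qed

end

lemma moment_family_qmoment:
  assumes "open D" "\<And>b. b \<in> Basis \<Longrightarrow> F b holomorphic_on D"
  shows "moment_family (double_domain D) (qmoment F)"
proof
  show "open (double_domain D)" by (rule open_double_domain[OF assms(1)])
  show "continuous_on (double_domain D) (qmoment F n j)" for n j
    by (rule continuous_on_qmoment[OF assms])
  fix q n j e assume q: "q \<in> double_domain D"
  show "((\<lambda>t. qmoment F n j (q + t *\<^sub>R e)) has_vector_derivative (2 * real n) *\<^sub>R
      (Q0 e *\<^sub>R qmoment F (Suc n) (Suc j) q - inner q e *\<^sub>R qmoment F (Suc n) j q)) (at 0)"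
    by (rule qmoment_has_vector_derivative[OF assms(1) q assms(2)])
  show "qmoment F n j q = qmoment F (Suc n) (Suc (Suc j)) q
      - (2 * Q0 q) *\<^sub>R qmoment F (Suc n) (Suc j) q + (norm q)\<^sup>2 *\<^sub>R qmoment F (Suc n) j q"
    by (rule qmoment_recurrence[OF assms(1) q assms(2)])
qed

section \<open>Slices and stem functions\<close>

text \<open>
  The planar domain of a slice function. For an axially symmetric set it is the slice by every imaginary unit.
\<close>

definition stem_domain :: "quat set \<Rightarrow> complex set" where
  "stem_domain W = {z. (Re z, Im z) \<in> slice_domain W}"

lemma imag_unit_square: "J \<in> imag_units \<Longrightarrow> J * J = -1"
proof -
  assume "J \<in> imag_units"
  then have "Q0 J = 0" "norm J = 1" by (auto simp: imag_units_def)
  then have "(Q1 J)\<^sup>2 + (Q2 J)\<^sup>2 + (Q3 J)\<^sup>2 = 1" by (simp add: norm_quat_def)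
  with \<open>Q0 J = 0\<close> show ?thesis by (simp add: quat_eq_iff power2_eq_square)
qed

lemma e1_imag_unit: "e1 \<in> imag_units"
  by (simp add: imag_units_def norm_quat_def)

lemma uminus_imag_unit: "J \<in> imag_units \<Longrightarrow> - J \<in> imag_units"
  by (simp add: imag_units_def)

lemma bounded_linear_in_slice: "bounded_linear (in_slice J)"
  unfolding in_slice_def[abs_def]
  by (intro bounded_linear_add bounded_linear_of_real[THEN bounded_linear_compose] bounded_linear_Re
        bounded_linear_const_mult bounded_linear_Im)

lemma in_slice_diff: "in_slice J (a - b) = in_slice J a - in_slice J b"
  and in_slice_add: "in_slice J (a + b) = in_slice J a + in_slice J b"
  and in_slice_sum: "in_slice J (sum g S) = (\<Sum>x\<in>S. in_slice J (g x))"
  using bounded_linear.linear[OF bounded_linear_in_slice[of J]]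
  by (simp_all add: linear_diff linear_add linear_sum)

lemma of_real_commute_quat: "of_real r * (x :: quat) = x * of_real r"
  by (simp add: quat_eq_iff)

lemma in_slice_of_real [simp]: "in_slice J (of_real r) = of_real r"
  and in_slice_0 [simp]: "in_slice J 0 = 0" and in_slice_1 [simp]: "in_slice J 1 = 1"
  and in_slice_ii [simp]: "in_slice J \<i> = J"
  and in_slice_numeral [simp]: "in_slice J (numeral k) = numeral k"
  using in_slice_def[of J "of_real (numeral k)"] by (simp_all add: in_slice_def)

text \<open>
  The plane of \<open>J\<close> is a copy of the complex field because \<open>J\<close> squares to \<open>-1\<close>. This and the next two lemmas move
  computations with the kernels into the complex numbers.
\<close>

lemma in_slice_mult:
  assumes "J \<in> imag_units"
  shows "in_slice J (a * b) = in_slice J a * in_slice J b"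
proof -
  define x y u v where "x = Re a" "y = Im a" "u = Re b" "v = Im b"
  have "in_slice J a * in_slice J b = of_real (x * u) + of_real (x * v) * J + of_real (y * u) * J + of_real (y * v) * (J * J)"
    by (simp add: in_slice_def x_y_u_v_def quat_eq_iff algebra_simps)
  also have "\<dots> = in_slice J (a * b)"
    unfolding imag_unit_square[OF assms] by (simp add: in_slice_def x_y_u_v_def quat_eq_iff algebra_simps)
  finally show ?thesis ..
qed

lemma in_slice_power:
  "J \<in> imag_units \<Longrightarrow> in_slice J (a ^ n) = in_slice J a ^ n"
  by (induction n) (simp_all add: in_slice_mult)

lemma in_slice_inverse:
  assumes "J \<in> imag_units"
  shows "in_slice J (inverse a) = inverse (in_slice J a)"
proof (cases "a = 0")
  case False
  then have "in_slice J a * in_slice J (inverse a) = 1"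
    by (simp add: in_slice_mult[OF assms, symmetric])
  then show ?thesis by (rule inverse_unique[symmetric])
qed simp

lemma slice_eq_stem_domain:
  assumes "axially_symmetric W" "J \<in> imag_units"
  shows "slice W J = stem_domain W"
  using assms unfolding axially_symmetric_def slice_def stem_domain_def slice_domain_def in_slice_def
  by auto

text \<open>
  A real quaternion lies in every slice; \<open>e1\<close> is an arbitrary choice in that case.
\<close>

lemma polar_quat:
  obtains I where "I \<in> imag_units" "q = in_slice I (upper_pt q)"
proof (cases "Im (upper_pt q) = 0")
  case True
  then have "Q1 q = 0" "Q2 q = 0" "Q3 q = 0"
    using Im_upper_pt_square[of q] by (auto simp: add_nonneg_eq_0_iff)
  then have "q = in_slice e1 (upper_pt q)" using True by (simp add: in_slice_def quat_eq_iff)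
  with e1_imag_unit that show ?thesis by blast
next
  case False
  define y where "y = Im (upper_pt q)"
  have y: "y \<noteq> 0" "y\<^sup>2 = (Q1 q)\<^sup>2 + (Q2 q)\<^sup>2 + (Q3 q)\<^sup>2"
    using False Im_upper_pt_square by (auto simp: y_def)
  define I where "I = Quat 0 (Q1 q / y) (Q2 q / y) (Q3 q / y)"
  have "(Q1 q / y)\<^sup>2 + (Q2 q / y)\<^sup>2 + (Q3 q / y)\<^sup>2 = ((Q1 q)\<^sup>2 + (Q2 q)\<^sup>2 + (Q3 q)\<^sup>2) / y\<^sup>2"
    by (simp only: power_divide add_divide_distrib)
  also have "\<dots> = 1" using y(1) unfolding y(2)[symmetric] by simp
  finally have "norm I = 1" using y(1) by (simp add: norm_quat_def I_def)
  then have "I \<in> imag_units" by (simp add: imag_units_def I_def)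
  moreover have "q = in_slice I (upper_pt q)"
    using y by (simp add: in_slice_def quat_eq_iff I_def y_def[symmetric])
  ultimately show ?thesis by (rule that)
qed

lemma cnj_in_stem_domain:
  assumes "axially_symmetric W" "z \<in> stem_domain W"
  shows "cnj z \<in> stem_domain W"
proof -
  have "in_slice (- e1) (cnj z) = in_slice e1 z" by (simp add: in_slice_def)
  moreover have "z \<in> slice W e1" using assms slice_eq_stem_domain[OF assms(1) e1_imag_unit] by simp
  ultimately have "cnj z \<in> slice W (- e1)" by (simp add: slice_def)
  then show ?thesis using slice_eq_stem_domain[OF assms(1) uminus_imag_unit[OF e1_imag_unit]] by simp
qed

lemma upper_pt_in_stem_domain_iff:
  assumes "axially_symmetric W"
  shows "upper_pt q \<in> stem_domain W \<longleftrightarrow> q \<in> W"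
proof -
  obtain I where I: "I \<in> imag_units" "q = in_slice I (upper_pt q)" by (rule polar_quat)
  have "upper_pt q \<in> slice W I \<longleftrightarrow> q \<in> W" unfolding slice_def by (simp add: I(2)[symmetric])
  then show ?thesis using slice_eq_stem_domain[OF assms I(1)] by simp
qed

lemma double_domain_stem_domain:
  assumes "axially_symmetric W"
  shows "double_domain (stem_domain W) = W"
  using upper_pt_in_stem_domain_iff[OF assms] cnj_in_stem_domain[OF assms]
  by (auto simp: double_domain_def)

lemma open_stem_domain:
  assumes "axially_symmetric W" "open W"
  shows "open (stem_domain W)"
proof -
  have "open (in_slice e1 -` W)"
    by (intro open_vimage assms bounded_linear.continuous_on[OF bounded_linear_in_slice] continuous_on_id)
  then show ?thesis
    using slice_eq_stem_domain[OF assms(1) e1_imag_unit] by (simp add: slice_def vimage_def)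
qed

text \<open>
  One coordinate of the pair \<open>(\<alpha>, \<beta>)\<close>, packed into a complex function.
\<close>

definition stem :: "(real \<times> real \<Rightarrow> quat) \<Rightarrow> (real \<times> real \<Rightarrow> quat) \<Rightarrow> quat \<Rightarrow> complex \<Rightarrow> complex" where
  "stem \<alpha> \<beta> b z = Complex (inner (\<alpha> (Re z, Im z)) b) (inner (\<beta> (Re z, Im z)) b)"

lemma stem_sel [simp]:
  "Re (stem \<alpha> \<beta> b z) = inner (\<alpha> (Re z, Im z)) b" "Im (stem \<alpha> \<beta> b z) = inner (\<beta> (Re z, Im z)) b"
  by (simp_all add: stem_def)

text \<open>
  The system satisfied by \<open>\<alpha>\<close> and \<open>\<beta>\<close> has real coefficients, hence holds for each coordinate; there it is the
  system of Cauchy and Riemann.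
\<close>

lemma stem_holomorphic_on:
  assumes W: "axially_symmetric W" "open W" and c: "slice_components W \<alpha> \<beta>"
  shows "stem \<alpha> \<beta> b holomorphic_on stem_domain W"
proof (rule holomorphic_onI)
  fix z assume z: "z \<in> stem_domain W"
  obtain u v where uv: "u = Re z" "v = Im z" by auto
  from z c have diff: "\<alpha> differentiable (at (u, v))" "\<beta> differentiable (at (u, v))"
    and CR: "partial_deriv (1, 0) \<alpha> (u, v) = partial_deriv (0, 1) \<beta> (u, v)"
        "partial_deriv (0, 1) \<alpha> (u, v) = - partial_deriv (1, 0) \<beta> (u, v)"
    by (auto simp: stem_domain_def slice_components_def uv add_eq_0_iff2)
  obtain A where A: "(\<alpha> has_derivative A) (at (u, v))" using diff by (auto simp: differentiable_def)
  obtain B where B: "(\<beta> has_derivative B) (at (u, v))" using diff by (auto simp: differentiable_def)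
  have pd: "partial_deriv e g (u, v) = G e" if "(g has_derivative G) (at (u, v))"
    for e :: "real \<times> real" and g :: "real \<times> real \<Rightarrow> quat" and G
  proof -
    have l: "((\<lambda>t. (u, v) + t *\<^sub>R e) has_derivative (\<lambda>t. t *\<^sub>R e)) (at 0)"
      by (auto intro!: derivative_eq_intros)
    have "(g has_derivative G) (at ((u, v) + 0 *\<^sub>R e))" using that by simp
    from has_derivative_compose[OF l this] have "((\<lambda>t. g ((u, v) + t *\<^sub>R e)) has_derivative (\<lambda>t. t *\<^sub>R G e)) (at 0)"
      by (simp add: linear_scale[OF has_derivative_linear[OF that]])
    then show ?thesis
      unfolding partial_deriv_def by (intro vector_derivative_at) (simp add: has_vector_derivative_def)
  qed
  have AB: "A (1, 0) = B (0, 1)" "A (0, 1) = - B (1, 0)"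
    using CR pd[OF A] pd[OF B] by auto
  have split: "G (x, y) = x *\<^sub>R G (1, 0) + y *\<^sub>R G (0, 1)" if "linear G"
    for G :: "real \<times> real \<Rightarrow> quat" and x y
  proof -
    have "G (x, y) = G (x *\<^sub>R (1, 0) + y *\<^sub>R (0, 1))" by simp
    also have "\<dots> = x *\<^sub>R G (1, 0) + y *\<^sub>R G (0, 1)"
      by (simp only: linear_add[OF that] linear_scale[OF that])
    finally show ?thesis .
  qed
  have r: "((\<lambda>z. (Re z, Im z)) has_derivative (\<lambda>h. (Re h, Im h))) (at z)"
    by (auto intro!: derivative_eq_intros)
  have dA: "((\<lambda>z. \<alpha> (Re z, Im z)) has_derivative (\<lambda>h. A (Re h, Im h))) (at z)"
    and dB: "((\<lambda>z. \<beta> (Re z, Im z)) has_derivative (\<lambda>h. B (Re h, Im h))) (at z)"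
    using has_derivative_compose[OF r] A B by (auto simp: uv)
  have "((\<lambda>z. of_real (inner (\<alpha> (Re z, Im z)) b) + \<i> * of_real (inner (\<beta> (Re z, Im z)) b)) has_derivative
     (\<lambda>h. of_real (inner (A (Re h, Im h)) b) + \<i> * of_real (inner (B (Re h, Im h)) b))) (at z)"
    by (intro has_derivative_add has_derivative_mult_right has_derivative_of_real has_derivative_inner_left dA dB)
  also have "(\<lambda>h. of_real (inner (A (Re h, Im h)) b) + \<i> * of_real (inner (B (Re h, Im h)) b)) =
     (*) (of_real (inner (A (1, 0)) b) + \<i> * of_real (inner (B (1, 0)) b))"
  proof
    fix h
    have AA: "A (Re h, Im h) = Re h *\<^sub>R A (1, 0) - Im h *\<^sub>R B (1, 0)"
      using split[OF has_derivative_linear[OF A], of "Re h" "Im h"] AB by simp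
    have BB: "B (Re h, Im h) = Re h *\<^sub>R B (1, 0) + Im h *\<^sub>R A (1, 0)"
      using split[OF has_derivative_linear[OF B], of "Re h" "Im h"] AB by simp
    show "of_real (inner (A (Re h, Im h)) b) + \<i> * of_real (inner (B (Re h, Im h)) b) =
        (of_real (inner (A (1, 0)) b) + \<i> * of_real (inner (B (1, 0)) b)) * h"
      unfolding AA BB by (simp add: complex_eq_iff inner_add_left inner_diff_left algebra_simps)
  qed
  finally have "(stem \<alpha> \<beta> b has_field_derivative (of_real (inner (A (1, 0)) b) + \<i> * of_real (inner (B (1, 0)) b))) (at z)"
    unfolding has_field_derivative_def stem_def[abs_def] Complex_eq .
  then show "stem \<alpha> \<beta> b field_differentiable at z within stem_domain W"
    by (rule field_differentiable_at_within[OF exI[where P="\<lambda>D. (_ has_field_derivative D) _", folded field_differentiable_def]])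
qed

lemma stem_cnj:
  assumes c: "slice_components W \<alpha> \<beta>" and z: "z \<in> stem_domain W"
  shows "stem \<alpha> \<beta> b (cnj z) = cnj (stem \<alpha> \<beta> b z)"
proof -
  have "\<alpha> (Re z, Im z) = \<alpha> (Re z, - Im z)" "\<beta> (Re z, Im z) = - \<beta> (Re z, - Im z)"
    using c z unfolding slice_components_def stem_domain_def by blast+
  then show ?thesis by (simp add: stem_def complex_eq_iff)
qed

text \<open>
  Cauchy's formula, coordinate by coordinate: since \<open>stem\<close> commutes with conjugation, the half sum and half difference
  of its values at the two representatives are its real and imaginary part.
\<close>

lemma slice_components_qmoment:
  fixes q W \<alpha> \<beta>
  defines "K \<equiv> qmoment (stem \<alpha> \<beta>)" and "z \<equiv> upper_pt q"
  assumes W: "axially_symmetric W" "open W" and c: "slice_components W \<alpha> \<beta>" and q: "q \<in> W"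
  shows "\<alpha> (Re z, Im z) = K 1 1 q - Q0 q *\<^sub>R K 1 0 q"
    and "\<beta> (Re z, Im z) = Im z *\<^sub>R K 1 0 q"
proof -
  note D = open_stem_domain[OF W]
  have qD: "q \<in> double_domain (stem_domain W)" using q double_domain_stem_domain[OF W(1)] by simp
  then have zD: "z \<in> stem_domain W" by (simp add: double_domain_def z_def)
  note h = stem_holomorphic_on[OF W c]
  note sym = stem_cnj[OF c zD]
  have a: "Re (moment 1 (\<lambda>\<zeta>. \<zeta> * stem \<alpha> \<beta> b \<zeta>) q) - Q0 q * Re (moment 1 (stem \<alpha> \<beta> b) q) =
      inner (\<alpha> (Re z, Im z)) b" for b
  proof -
    have "moment 1 (\<lambda>\<zeta>. \<zeta> * stem \<alpha> \<beta> b \<zeta>) q - of_real (Q0 q) * moment 1 (stem \<alpha> \<beta> b) q =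
        of_real (Re (stem \<alpha> \<beta> b z))"
      using moment_one_shifted[OF D qD h, of b]
      unfolding moment_shift[OF D qD h] z_def[symmetric] sym by (simp add: complex_eq_iff)
    from arg_cong[OF this, of Re] show ?thesis by simp
  qed
  have b: "Im z * Re (moment 1 (stem \<alpha> \<beta> b) q) = inner (\<beta> (Re z, Im z)) b" for b
  proof -
    have "of_real (Im z) * moment 1 (stem \<alpha> \<beta> b) q = of_real (Im (stem \<alpha> \<beta> b z))"
      using Im_times_moment_one[OF D qD h, of b] unfolding z_def[symmetric] sym
      by (simp add: complex_eq_iff)
    from arg_cong[OF this, of Re] show ?thesis by simp
  qed
  have "\<alpha> (Re z, Im z) = (\<Sum>b\<in>Basis. (Re (moment 1 (\<lambda>\<zeta>. \<zeta> * stem \<alpha> \<beta> b \<zeta>) q) - Q0 q * Re (moment 1 (stem \<alpha> \<beta> b) q)) *\<^sub>R b)"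
    unfolding a by (simp add: euclidean_representation)
  then show "\<alpha> (Re z, Im z) = K 1 1 q - Q0 q *\<^sub>R K 1 0 q"
    by (simp add: K_def qmoment_def scaleR_left_diff_distrib sum_subtractf scaleR_sum_right)
  have "\<beta> (Re z, Im z) = (\<Sum>b\<in>Basis. (Im z * Re (moment 1 (stem \<alpha> \<beta> b) q)) *\<^sub>R b)"
    unfolding b by (simp add: euclidean_representation)
  then show "\<beta> (Re z, Im z) = Im z *\<^sub>R K 1 0 q"
    by (simp add: K_def qmoment_def scaleR_sum_right)
qed

text \<open>
  In \<open>\<alpha> + I \<beta>\<close> the moment of order one and index \<open>0\<close> is multiplied by \<open>- q\<^sub>0 + I y\<close>, which is \<open>- qcnj q\<close>.
\<close>

lemma left_slice_cauchy:
  assumes W: "axially_symmetric W" "open W" and c: "slice_components W \<alpha> \<beta>" and q: "q \<in> W"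
    and f: "\<forall>u v. (u, v) \<in> slice_domain W \<longrightarrow>
        (\<forall>J\<in>imag_units. f (of_real u + J * of_real v) = \<alpha> (u, v) + J * \<beta> (u, v))"
  shows "f q = qmoment (stem \<alpha> \<beta>) 1 1 q - qcnj q * qmoment (stem \<alpha> \<beta>) 1 0 q"
proof -
  obtain I where I: "I \<in> imag_units" "q = in_slice I (upper_pt q)" by (rule polar_quat)
  define z where "z = upper_pt q"
  have z: "q = of_real (Re z) + I * of_real (Im z)" using I(2) by (simp add: in_slice_def z_def)
  have "(Re z, Im z) \<in> slice_domain W"
    using upper_pt_in_stem_domain_iff[OF W(1), of q] q by (simp add: stem_domain_def z_def)
  with f I(1) have "f (of_real (Re z) + I * of_real (Im z)) = \<alpha> (Re z, Im z) + I * \<beta> (Re z, Im z)" by blast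
  then have fq: "f q = \<alpha> (Re z, Im z) + I * \<beta> (Re z, Im z)" using z by simp
  have qc: "qcnj q = of_real (Re z) - I * of_real (Im z)"
    using I(1) by (subst z) (simp add: quat_eq_iff imag_units_def)
  show ?thesis
    unfolding fq slice_components_qmoment[OF W c q, folded z_def] qc
    by (simp add: z_def[symmetric] scaleR_conv_of_real algebra_simps) (simp add: z_def)
qed

lemma right_slice_cauchy:
  assumes W: "axially_symmetric W" "open W" and c: "slice_components W \<alpha> \<beta>" and q: "q \<in> W"
    and f: "\<forall>u v. (u, v) \<in> slice_domain W \<longrightarrow>
        (\<forall>J\<in>imag_units. f (of_real u + J * of_real v) = \<alpha> (u, v) + \<beta> (u, v) * J)"
  shows "f q = qmoment (stem \<alpha> \<beta>) 1 1 q - qmoment (stem \<alpha> \<beta>) 1 0 q * qcnj q"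
proof -
  obtain I where I: "I \<in> imag_units" "q = in_slice I (upper_pt q)" by (rule polar_quat)
  define z where "z = upper_pt q"
  have z: "q = of_real (Re z) + I * of_real (Im z)" using I(2) by (simp add: in_slice_def z_def)
  have "(Re z, Im z) \<in> slice_domain W"
    using upper_pt_in_stem_domain_iff[OF W(1), of q] q by (simp add: stem_domain_def z_def)
  with f I(1) have "f (of_real (Re z) + I * of_real (Im z)) = \<alpha> (Re z, Im z) + \<beta> (Re z, Im z) * I" by blast
  then have fq: "f q = \<alpha> (Re z, Im z) + \<beta> (Re z, Im z) * I" using z by simp
  have qc: "qcnj q = of_real (Re z) - of_real (Im z) * I"
    using I(1) by (subst z) (simp add: quat_eq_iff imag_units_def)
  show ?thesis
    unfolding fq slice_components_qmoment[OF W c q, folded z_def] qc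
    by (simp add: quat_eq_iff z_def[symmetric] algebra_simps) (simp add: z_def)
qed

text \<open>
  The boundary of a slice of \<open>U\<close> stays in the domain of the stem function since the closure of \<open>U\<close> lies in \<open>W\<close>, and it
  avoids the representatives of \<open>q\<close>, which are interior points of the slice.
\<close>

lemma pos_boundary_encloses:
  assumes W: "axially_symmetric W" and U: "axially_symmetric U" "open U" "closure U \<subseteq> W"
    and J: "J \<in> imag_units" and \<Gamma>: "pos_boundary U J \<Gamma>" and q: "q \<in> U"
  shows "encloses (stem_domain W) \<Gamma> q"
proof -
  define S where "S = slice U J"
  have S: "S = stem_domain U" unfolding S_def by (rule slice_eq_stem_domain[OF U(1) J])
  have oS: "open S" unfolding S by (rule open_stem_domain[OF U(1,2)])
  have zS: "upper_pt q \<in> S" "cnj (upper_pt q) \<in> S"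
    using upper_pt_in_stem_domain_iff[OF U(1)] cnj_in_stem_domain[OF U(1)] q by (auto simp: S)
  have "closure S \<subseteq> in_slice J -` closure U"
    by (rule closure_minimal)
       (auto simp: S_def slice_def closure_subset[THEN subsetD]
         intro!: closed_vimage bounded_linear.continuous_on[OF bounded_linear_in_slice])
  then have clS: "closure S \<subseteq> stem_domain W"
    using U(3) unfolding slice_eq_stem_domain[OF W J, symmetric] slice_def by auto
  note P = \<Gamma>[unfolded pos_boundary_def S_def[symmetric]]
  have im: "path_image \<gamma> \<subseteq> frontier S" if "\<gamma> \<in> \<Gamma>" for \<gamma> using P that by blast
  moreover have "frontier S \<subseteq> stem_domain W - {upper_pt q, cnj (upper_pt q)}"
    using clS zS oS by (auto simp: frontier_def interior_open)
  ultimately have "cycle_in (stem_domain W - {upper_pt q, cnj (upper_pt q)}) \<Gamma>"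
    using P unfolding cycle_in_def by blast
  moreover have "cycle_winding \<Gamma> z = 0" if "z \<notin> stem_domain W" for z
    using P clS that unfolding cycle_winding_def by blast
  moreover have "cycle_winding \<Gamma> z = 1" if "z \<in> S" for z
    using P that unfolding cycle_winding_def by blast
  ultimately show ?thesis using zS by (simp add: encloses_def)
qed

section \<open>Slice integrals of the F-kernels\<close>

lemma F_kernel_denominator_in_slice:
  assumes J: "J \<in> imag_units"
  shows "(in_slice J \<zeta> ^ 2 - 2 * of_real (Q0 q) * in_slice J \<zeta> + of_real ((norm q)\<^sup>2)) powi (- 2)
           = in_slice J (inverse (qchar q \<zeta> ^ 2))"
proof -
  have "in_slice J (qchar q \<zeta>) = in_slice J \<zeta> ^ 2 - 2 * of_real (Q0 q) * in_slice J \<zeta> + of_real ((norm q)\<^sup>2)"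
    unfolding qchar_eq in_slice_add in_slice_diff
    by (simp only: in_slice_mult[OF J] in_slice_power[OF J] in_slice_of_real in_slice_numeral)
  then show ?thesis
    by (simp only: in_slice_inverse[OF J] in_slice_power[OF J]) (simp add: power_int_def power_inverse)
qed

lemma slice_value_left:
  assumes J: "J \<in> imag_units" and z: "\<zeta> \<in> stem_domain W"
    and f: "\<forall>u v. (u, v) \<in> slice_domain W \<longrightarrow>
        (\<forall>J\<in>imag_units. f (of_real u + J * of_real v) = \<alpha> (u, v) + J * \<beta> (u, v))"
  shows "f (in_slice J \<zeta>) = (\<Sum>b\<in>Basis. in_slice J (stem \<alpha> \<beta> b \<zeta>) * b)"
proof -
  have "f (in_slice J \<zeta>) = \<alpha> (Re \<zeta>, Im \<zeta>) + J * \<beta> (Re \<zeta>, Im \<zeta>)"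
    using f J z by (simp add: in_slice_def stem_domain_def)
  also have "\<dots> = (\<Sum>b\<in>Basis. inner (\<alpha> (Re \<zeta>, Im \<zeta>)) b *\<^sub>R b) +
       J * (\<Sum>b\<in>Basis. inner (\<beta> (Re \<zeta>, Im \<zeta>)) b *\<^sub>R b)"
    by (simp add: euclidean_representation)
  also have "\<dots> = (\<Sum>b\<in>Basis. in_slice J (stem \<alpha> \<beta> b \<zeta>) * b)"
    by (simp add: in_slice_def sum_distrib_left sum.distrib distrib_right scaleR_conv_of_real mult.assoc)
  finally show ?thesis .
qed

lemma slice_value_right:
  assumes J: "J \<in> imag_units" and z: "\<zeta> \<in> stem_domain W"
    and f: "\<forall>u v. (u, v) \<in> slice_domain W \<longrightarrow>
        (\<forall>J\<in>imag_units. f (of_real u + J * of_real v) = \<alpha> (u, v) + \<beta> (u, v) * J)"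
  shows "f (in_slice J \<zeta>) = (\<Sum>b\<in>Basis. b * in_slice J (stem \<alpha> \<beta> b \<zeta>))"
proof -
  have "f (in_slice J \<zeta>) = \<alpha> (Re \<zeta>, Im \<zeta>) + \<beta> (Re \<zeta>, Im \<zeta>) * J"
    using f J z by (simp add: in_slice_def stem_domain_def)
  also have "\<dots> = (\<Sum>b\<in>Basis. inner (\<alpha> (Re \<zeta>, Im \<zeta>)) b *\<^sub>R b) +
       (\<Sum>b\<in>Basis. inner (\<beta> (Re \<zeta>, Im \<zeta>)) b *\<^sub>R b) * J"
    by (simp add: euclidean_representation)
  also have "\<dots> = (\<Sum>b\<in>Basis. b * in_slice J (stem \<alpha> \<beta> b \<zeta>))"
    unfolding sum_distrib_right sum.distrib[symmetric]
    by (intro sum.cong refl) (simp add: in_slice_def quat_eq_iff algebra_simps)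
  finally show ?thesis .
qed

text \<open>
  All factors between \<open>qcnj q\<close> on the left and the coordinate vector \<open>b\<close> on the right commute, so they collect into
  the image of one complex number. The constant \<open>4 \<i>\<close> is the product of \<open>- 4\<close> from the kernel and \<open>- \<i>\<close> from the
  factor \<open>- J\<close> of \<open>ds\<^sub>J\<close>.
\<close>

lemma slice_integrand_left:
  assumes J: "J \<in> imag_units" and fs: "f (in_slice J \<zeta>) = (\<Sum>b\<in>Basis. in_slice J (F b) * b)"
  shows "F_L (in_slice J \<zeta>) q * in_slice J \<zeta> ^ m * (in_slice J d * (- J)) * f (in_slice J \<zeta>) =
    (\<Sum>b\<in>Basis. (in_slice J (4 * \<i> * (\<zeta> ^ Suc m * F b / qchar q \<zeta> ^ 2 * d))
        - qcnj q * in_slice J (4 * \<i> * (\<zeta> ^ m * F b / qchar q \<zeta> ^ 2 * d))) * b)"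
proof -
  define X where "X = - 4 * inverse (qchar q \<zeta> ^ 2) * \<zeta> ^ m * (d * (- \<i>))"
  have mJ: "- J = in_slice J (- \<i>)" by (simp add: in_slice_def)
  have m4: "- 4 * x = x * in_slice J (- 4)" for x
    using of_real_commute_quat[of "- 4" x] in_slice_of_real[of J "- 4"] by simp
  have "F_L (in_slice J \<zeta>) q * in_slice J \<zeta> ^ m * (in_slice J d * (- J)) =
     (in_slice J \<zeta> - qcnj q) * in_slice J X"
    unfolding F_L_def F_kernel_denominator_in_slice[OF J] mJ m4 X_def
    by (simp only: in_slice_mult[OF J] in_slice_power[OF J] mult.assoc)
  then have "F_L (in_slice J \<zeta>) q * in_slice J \<zeta> ^ m * (in_slice J d * (- J)) * f (in_slice J \<zeta>) =
      (\<Sum>b\<in>Basis. (in_slice J \<zeta> - qcnj q) * in_slice J X * (in_slice J (F b) * b))"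
    unfolding fs by (simp only: sum_distrib_left)
  also have "\<dots> = (\<Sum>b\<in>Basis. (in_slice J (\<zeta> * X * F b) - qcnj q * in_slice J (X * F b)) * b)"
    by (simp add: in_slice_mult[OF J] left_diff_distrib mult.assoc)
  also have "\<dots> = (\<Sum>b\<in>Basis. (in_slice J (4 * \<i> * (\<zeta> ^ Suc m * F b / qchar q \<zeta> ^ 2 * d))
        - qcnj q * in_slice J (4 * \<i> * (\<zeta> ^ m * F b / qchar q \<zeta> ^ 2 * d))) * b)"
  proof (intro sum.cong refl)
    fix b :: quat
    have "\<zeta> * X * F b = 4 * \<i> * (\<zeta> ^ Suc m * F b / qchar q \<zeta> ^ 2 * d)"
      "X * F b = 4 * \<i> * (\<zeta> ^ m * F b / qchar q \<zeta> ^ 2 * d)"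
      by (simp_all add: X_def divide_inverse mult_ac)
    then show "(in_slice J (\<zeta> * X * F b) - qcnj q * in_slice J (X * F b)) * b =
      (in_slice J (4 * \<i> * (\<zeta> ^ Suc m * F b / qchar q \<zeta> ^ 2 * d))
        - qcnj q * in_slice J (4 * \<i> * (\<zeta> ^ m * F b / qchar q \<zeta> ^ 2 * d))) * b" by (simp only:)
  qed
  finally show ?thesis .
qed

lemma slice_integrand_right:
  assumes J: "J \<in> imag_units" and fs: "f (in_slice J \<zeta>) = (\<Sum>b\<in>Basis. b * in_slice J (F b))"
  shows "f (in_slice J \<zeta>) * (in_slice J d * (- J)) * (in_slice J \<zeta> ^ m * F_R (in_slice J \<zeta>) q) =
    (\<Sum>b\<in>Basis. b * (in_slice J (4 * \<i> * (\<zeta> ^ Suc m * F b / qchar q \<zeta> ^ 2 * d))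
        - in_slice J (4 * \<i> * (\<zeta> ^ m * F b / qchar q \<zeta> ^ 2 * d)) * qcnj q))"
proof -
  define X where "X = (d * (- \<i>)) * \<zeta> ^ m * (- 4 * inverse (qchar q \<zeta> ^ 2))"
  have mJ: "- J = in_slice J (- \<i>)" by (simp add: in_slice_def)
  have m4: "- 4 = in_slice J (- 4)" using in_slice_of_real[of J "- 4"] by simp
  have "(in_slice J d * (- J)) * (in_slice J \<zeta> ^ m * F_R (in_slice J \<zeta>) q) =
     in_slice J X * (in_slice J \<zeta> - qcnj q)"
    unfolding F_R_def F_kernel_denominator_in_slice[OF J] mJ m4 X_def
    by (simp only: in_slice_mult[OF J] in_slice_power[OF J] mult.assoc)
  then have "f (in_slice J \<zeta>) * (in_slice J d * (- J)) * (in_slice J \<zeta> ^ m * F_R (in_slice J \<zeta>) q) =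
      (\<Sum>b\<in>Basis. b * in_slice J (F b) * (in_slice J X * (in_slice J \<zeta> - qcnj q)))"
    unfolding fs by (simp only: sum_distrib_right mult.assoc)
  also have "\<dots> = (\<Sum>b\<in>Basis. b * (in_slice J (F b * X * \<zeta>) - in_slice J (F b * X) * qcnj q))"
    by (simp add: in_slice_mult[OF J] right_diff_distrib mult.assoc)
  also have "\<dots> = (\<Sum>b\<in>Basis. b * (in_slice J (4 * \<i> * (\<zeta> ^ Suc m * F b / qchar q \<zeta> ^ 2 * d))
        - in_slice J (4 * \<i> * (\<zeta> ^ m * F b / qchar q \<zeta> ^ 2 * d)) * qcnj q))"
  proof (intro sum.cong refl)
    fix b :: quat
    have "F b * X * \<zeta> = 4 * \<i> * (\<zeta> ^ Suc m * F b / qchar q \<zeta> ^ 2 * d)"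
      "F b * X = 4 * \<i> * (\<zeta> ^ m * F b / qchar q \<zeta> ^ 2 * d)"
      by (simp_all add: X_def divide_inverse mult_ac)
    then show "b * (in_slice J (F b * X * \<zeta>) - in_slice J (F b * X) * qcnj q) =
      b * (in_slice J (4 * \<i> * (\<zeta> ^ Suc m * F b / qchar q \<zeta> ^ 2 * d))
        - in_slice J (4 * \<i> * (\<zeta> ^ m * F b / qchar q \<zeta> ^ 2 * d)) * qcnj q)" by (simp only:)
  qed
  finally show ?thesis .
qed

text \<open>
  At the finitely many breakpoints of \<open>\<gamma>\<close> the value of \<^const>\<open>vector_derivative\<close> is unspecified; they do not affect integrals.
\<close>

lemma vector_derivative_in_slice_path:
  assumes \<gamma>: "valid_path \<gamma>"
  obtains S where "finite S"
    "\<And>t. t \<in> {0..1} - S \<Longrightarrow> vector_derivative (in_slice J \<circ> \<gamma>) (at t within {0..1}) =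
       in_slice J (vector_derivative \<gamma> (at t within {0..1}))"
proof -
  obtain S where S: "finite S" "\<And>t. t \<in> {0..1} - S \<Longrightarrow> \<gamma> differentiable at t"
    using \<gamma> unfolding valid_path_def piecewise_C1_differentiable_on_def C1_differentiable_on_eq by blast
  show thesis
  proof (rule that[OF S(1)])
    fix t assume t: "t \<in> {0..1} - S"
    have d: "(\<gamma> has_vector_derivative vector_derivative \<gamma> (at t)) (at t)"
      using S(2)[OF t] by (simp add: vector_derivative_works)
    have "(in_slice J \<circ> \<gamma> has_vector_derivative in_slice J (vector_derivative \<gamma> (at t))) (at t)"
      unfolding o_def by (rule bounded_linear.has_vector_derivative[OF bounded_linear_in_slice d])
    then show "vector_derivative (in_slice J \<circ> \<gamma>) (at t within {0..1}) =
       in_slice J (vector_derivative \<gamma> (at t within {0..1}))"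
      using vector_derivative_at_within_ivl[of "in_slice J \<circ> \<gamma>" _ t 0 1]
        vector_derivative_at_within_ivl[OF d, of 0 1] t by simp
  qed
qed

lemma encloses_path_has_integral:
  assumes D: "open D" and enc: "encloses D \<Gamma> q" and \<gamma>: "\<gamma> \<in> \<Gamma>" and G: "G holomorphic_on D"
  shows "((\<lambda>t. in_slice J (c * (G (\<gamma> t) / qchar q (\<gamma> t) ^ n * vector_derivative \<gamma> (at t within {0..1}))))
     has_integral in_slice J (c * contour_integral \<gamma> (\<lambda>\<zeta>. G \<zeta> / qchar q \<zeta> ^ n))) {0..1}"
proof -
  have "(\<lambda>\<zeta>. G \<zeta> / qchar q \<zeta> ^ n) contour_integrable_on \<gamma>"
    by (rule contour_integrable_holomorphic_simple[OF holomorphic_moment_integrand[OF G]])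
       (use D enc \<gamma> in \<open>auto simp: encloses_def cycle_in_def intro!: open_Diff finite_imp_closed\<close>)
  then have "((\<lambda>t. G (\<gamma> t) / qchar q (\<gamma> t) ^ n * vector_derivative \<gamma> (at t within {0..1}))
     has_integral contour_integral \<gamma> (\<lambda>\<zeta>. G \<zeta> / qchar q \<zeta> ^ n)) {0..1}"
    using has_contour_integral_integral unfolding has_contour_integral_def by blast
  then have "((\<lambda>t. c * (G (\<gamma> t) / qchar q (\<gamma> t) ^ n * vector_derivative \<gamma> (at t within {0..1})))
     has_integral c * contour_integral \<gamma> (\<lambda>\<zeta>. G \<zeta> / qchar q \<zeta> ^ n)) {0..1}"
    by (rule has_integral_mult_right)
  from has_integral_linear[OF this bounded_linear_in_slice[of J]] show ?thesis by (simp add: o_def)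
qed

text \<open>
  The constant is \<open>4 \<i> * 2 \<pi> \<i> = - 8 \<pi>\<close>. Reality of the moment makes the image independent of \<open>J\<close>.
\<close>

lemma in_slice_cycle_integral:
  assumes W: "axially_symmetric W" "open W" and c: "slice_components W \<alpha> \<beta>"
    and enc: "encloses (stem_domain W) \<Gamma> q" and q: "q \<in> W"
  shows "(\<Sum>\<gamma>\<in>\<Gamma>. in_slice J (4 * \<i> * contour_integral \<gamma> (\<lambda>\<zeta>. \<zeta> ^ j * stem \<alpha> \<beta> b \<zeta> / qchar q \<zeta> ^ 2)))
      = of_real (- 8 * pi * Re (moment 2 (\<lambda>\<zeta>. \<zeta> ^ j * stem \<alpha> \<beta> b \<zeta>) q))"
proof -
  note D = open_stem_domain[OF W]
  have G: "(\<lambda>\<zeta>. \<zeta> ^ j * stem \<alpha> \<beta> b \<zeta>) holomorphic_on stem_domain W"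
    by (intro holomorphic_intros stem_holomorphic_on[OF W c])
  have qD: "q \<in> double_domain (stem_domain W)" using q double_domain_stem_domain[OF W(1)] by simp
  have "Im (moment (Suc 1) (\<lambda>\<zeta>. \<zeta> ^ j * stem \<alpha> \<beta> b \<zeta>) q) = 0"
    by (rule moment_real[OF D qD G]) (simp add: stem_cnj[OF c])
  then have real: "moment 2 (\<lambda>\<zeta>. \<zeta> ^ j * stem \<alpha> \<beta> b \<zeta>) q =
      of_real (Re (moment 2 (\<lambda>\<zeta>. \<zeta> ^ j * stem \<alpha> \<beta> b \<zeta>) q))"
    by (simp add: complex_eq_iff numeral_2_eq_2)
  have "(\<Sum>\<gamma>\<in>\<Gamma>. in_slice J (4 * \<i> * contour_integral \<gamma> (\<lambda>\<zeta>. \<zeta> ^ j * stem \<alpha> \<beta> b \<zeta> / qchar q \<zeta> ^ 2)))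
     = in_slice J (4 * \<i> * (\<Sum>\<gamma>\<in>\<Gamma>. contour_integral \<gamma> (\<lambda>\<zeta>. \<zeta> ^ j * stem \<alpha> \<beta> b \<zeta> / qchar q \<zeta> ^ 2)))"
    by (simp add: in_slice_sum sum_distrib_left)
  also have "4 * \<i> * (\<Sum>\<gamma>\<in>\<Gamma>. contour_integral \<gamma> (\<lambda>\<zeta>. \<zeta> ^ j * stem \<alpha> \<beta> b \<zeta> / qchar q \<zeta> ^ 2)) =
      of_real (- 8 * pi * Re (moment 2 (\<lambda>\<zeta>. \<zeta> ^ j * stem \<alpha> \<beta> b \<zeta>) q))"
    unfolding moment_eq_cycle_integral[OF D G enc] by (subst real) (simp add: complex_eq_iff)
  finally show ?thesis by (simp only: in_slice_of_real)
qed

text \<open>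
  The value on the right mentions neither \<open>J\<close> nor \<open>\<Gamma>\<close>, which is the asserted independence of the slice and of the domain.
\<close>

lemma slice_integral_F_L:
  assumes W: "axially_symmetric W" "open W" and c: "slice_components W \<alpha> \<beta>" and J: "J \<in> imag_units"
    and f: "\<forall>u v. (u, v) \<in> slice_domain W \<longrightarrow>
        (\<forall>J\<in>imag_units. f (of_real u + J * of_real v) = \<alpha> (u, v) + J * \<beta> (u, v))"
    and enc: "encloses (stem_domain W) \<Gamma> q" and q: "q \<in> W"
  shows "slice_integrable J \<Gamma> (\<lambda>s. F_L s q * s ^ m) f"
    and "slice_integral J \<Gamma> (\<lambda>s. F_L s q * s ^ m) f = (- 8 * pi) *\<^sub>R
      (qmoment (stem \<alpha> \<beta>) 2 (Suc m) q - qcnj q * qmoment (stem \<alpha> \<beta>) 2 m q)"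
proof -
  note D = open_stem_domain[OF W]
  define C where "C \<gamma> j b = in_slice J (4 * \<i> * contour_integral \<gamma> (\<lambda>\<zeta>. \<zeta> ^ j * stem \<alpha> \<beta> b \<zeta> / qchar q \<zeta> ^ 2))"
    for \<gamma> j b
  have int: "(slice_integrand J \<gamma> (\<lambda>s. F_L s q * s ^ m) f has_integral
      (\<Sum>b\<in>Basis. (C \<gamma> (Suc m) b - qcnj q * C \<gamma> m b) * b)) {0..1}" if \<gamma>: "\<gamma> \<in> \<Gamma>" for \<gamma>
  proof -
    have vp: "valid_path \<gamma>" and im: "path_image \<gamma> \<subseteq> stem_domain W"
      using enc \<gamma> by (auto simp: encloses_def cycle_in_def)
    obtain S where S: "finite S"
      "\<And>t. t \<in> {0..1} - S \<Longrightarrow> vector_derivative (in_slice J \<circ> \<gamma>) (at t within {0..1}) =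
         in_slice J (vector_derivative \<gamma> (at t within {0..1}))"
      using vector_derivative_in_slice_path[OF vp] by blast
    let ?h = "\<lambda>j b t. in_slice J (4 * \<i> * (\<gamma> t ^ j * stem \<alpha> \<beta> b (\<gamma> t) / qchar q (\<gamma> t) ^ 2 *
        vector_derivative \<gamma> (at t within {0..1})))"
    have h: "(?h j b has_integral C \<gamma> j b) {0..1}" for j b
      unfolding C_def
      by (rule encloses_path_has_integral[OF D enc \<gamma>]) (intro holomorphic_intros stem_holomorphic_on[OF W c])
    have "((\<lambda>t. \<Sum>b\<in>Basis. (?h (Suc m) b t - qcnj q * ?h m b t) * b) has_integral
       (\<Sum>b\<in>Basis. (C \<gamma> (Suc m) b - qcnj q * C \<gamma> m b) * b)) {0..1}"
      by (intro has_integral_sum has_integral_mult_left has_integral_diff has_integral_mult_right h) simp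
    then show ?thesis
    proof (rule has_integral_spike_finite[OF S(1), rotated])
      fix t assume t: "t \<in> {0..1} - S"
      have "\<gamma> t \<in> stem_domain W" using im t by (auto simp: path_image_def)
      from slice_integrand_left[where d = "vector_derivative \<gamma> (at t within {0..1})"
          and f = f and F = "\<lambda>b. stem \<alpha> \<beta> b (\<gamma> t)" and \<zeta> = "\<gamma> t", OF J slice_value_left[OF J this f]]
      show "slice_integrand J \<gamma> (\<lambda>s. F_L s q * s ^ m) f t =
          (\<Sum>b\<in>Basis. (?h (Suc m) b t - qcnj q * ?h m b t) * b)"
        unfolding slice_integrand_def Let_def S(2)[OF t] o_apply .
    qed
  qed
  then show "slice_integrable J \<Gamma> (\<lambda>s. F_L s q * s ^ m) f"
    unfolding slice_integrable_def by blast
  have "slice_integral J \<Gamma> (\<lambda>s. F_L s q * s ^ m) f =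
      (\<Sum>\<gamma>\<in>\<Gamma>. \<Sum>b\<in>Basis. (C \<gamma> (Suc m) b - qcnj q * C \<gamma> m b) * b)"
    unfolding slice_integral_def by (intro sum.cong refl integral_unique int)
  also have "\<dots> = (\<Sum>b\<in>Basis. ((\<Sum>\<gamma>\<in>\<Gamma>. C \<gamma> (Suc m) b) - qcnj q * (\<Sum>\<gamma>\<in>\<Gamma>. C \<gamma> m b)) * b)"
    by (subst sum.swap) (simp only: sum_distrib_left sum_distrib_right sum_subtractf left_diff_distrib)
  also have "\<dots> = (\<Sum>b\<in>Basis. (- 8 * pi) *\<^sub>R
      (Re (moment 2 (\<lambda>\<zeta>. \<zeta> ^ Suc m * stem \<alpha> \<beta> b \<zeta>) q) *\<^sub>R b
        - qcnj q * (Re (moment 2 (\<lambda>\<zeta>. \<zeta> ^ m * stem \<alpha> \<beta> b \<zeta>) q) *\<^sub>R b)))"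
    unfolding C_def in_slice_cycle_integral[OF W c enc q]
    by (intro sum.cong refl) (simp add: quat_eq_iff algebra_simps)
  also have "\<dots> = (- 8 * pi) *\<^sub>R
      (qmoment (stem \<alpha> \<beta>) 2 (Suc m) q - qcnj q * qmoment (stem \<alpha> \<beta>) 2 m q)"
    unfolding qmoment_def by (simp only: scaleR_sum_right sum_subtractf sum_distrib_left scaleR_right_diff_distrib)
  finally show "slice_integral J \<Gamma> (\<lambda>s. F_L s q * s ^ m) f = (- 8 * pi) *\<^sub>R
      (qmoment (stem \<alpha> \<beta>) 2 (Suc m) q - qcnj q * qmoment (stem \<alpha> \<beta>) 2 m q)" .
qed

lemma slice_integral_F_R:
  assumes W: "axially_symmetric W" "open W" and c: "slice_components W \<alpha> \<beta>" and J: "J \<in> imag_units"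
    and f: "\<forall>u v. (u, v) \<in> slice_domain W \<longrightarrow>
        (\<forall>J\<in>imag_units. f (of_real u + J * of_real v) = \<alpha> (u, v) + \<beta> (u, v) * J)"
    and enc: "encloses (stem_domain W) \<Gamma> q" and q: "q \<in> W"
  shows "slice_integrable J \<Gamma> f (\<lambda>s. s ^ m * F_R s q)"
    and "slice_integral J \<Gamma> f (\<lambda>s. s ^ m * F_R s q) = (- 8 * pi) *\<^sub>R
      (qmoment (stem \<alpha> \<beta>) 2 (Suc m) q - qmoment (stem \<alpha> \<beta>) 2 m q * qcnj q)"
proof -
  note D = open_stem_domain[OF W]
  define C where "C \<gamma> j b = in_slice J (4 * \<i> * contour_integral \<gamma> (\<lambda>\<zeta>. \<zeta> ^ j * stem \<alpha> \<beta> b \<zeta> / qchar q \<zeta> ^ 2))"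
    for \<gamma> j b
  have int: "(slice_integrand J \<gamma> f (\<lambda>s. s ^ m * F_R s q) has_integral
      (\<Sum>b\<in>Basis. b * (C \<gamma> (Suc m) b - C \<gamma> m b * qcnj q))) {0..1}" if \<gamma>: "\<gamma> \<in> \<Gamma>" for \<gamma>
  proof -
    have vp: "valid_path \<gamma>" and im: "path_image \<gamma> \<subseteq> stem_domain W"
      using enc \<gamma> by (auto simp: encloses_def cycle_in_def)
    obtain S where S: "finite S"
      "\<And>t. t \<in> {0..1} - S \<Longrightarrow> vector_derivative (in_slice J \<circ> \<gamma>) (at t within {0..1}) =
         in_slice J (vector_derivative \<gamma> (at t within {0..1}))"
      using vector_derivative_in_slice_path[OF vp] by blast
    let ?h = "\<lambda>j b t. in_slice J (4 * \<i> * (\<gamma> t ^ j * stem \<alpha> \<beta> b (\<gamma> t) / qchar q (\<gamma> t) ^ 2 *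
        vector_derivative \<gamma> (at t within {0..1})))"
    have h: "(?h j b has_integral C \<gamma> j b) {0..1}" for j b
      unfolding C_def
      by (rule encloses_path_has_integral[OF D enc \<gamma>]) (intro holomorphic_intros stem_holomorphic_on[OF W c])
    have "((\<lambda>t. \<Sum>b\<in>Basis. b * (?h (Suc m) b t - ?h m b t * qcnj q)) has_integral
       (\<Sum>b\<in>Basis. b * (C \<gamma> (Suc m) b - C \<gamma> m b * qcnj q))) {0..1}"
      by (intro has_integral_sum has_integral_mult_right has_integral_diff has_integral_mult_left h) simp
    then show ?thesis
    proof (rule has_integral_spike_finite[OF S(1), rotated])
      fix t assume t: "t \<in> {0..1} - S"
      have "\<gamma> t \<in> stem_domain W" using im t by (auto simp: path_image_def)
      from slice_integrand_right[where d = "vector_derivative \<gamma> (at t within {0..1})"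
          and f = f and F = "\<lambda>b. stem \<alpha> \<beta> b (\<gamma> t)" and \<zeta> = "\<gamma> t", OF J slice_value_right[OF J this f]]
      show "slice_integrand J \<gamma> f (\<lambda>s. s ^ m * F_R s q) t =
          (\<Sum>b\<in>Basis. b * (?h (Suc m) b t - ?h m b t * qcnj q))"
        unfolding slice_integrand_def Let_def S(2)[OF t] o_apply .
    qed
  qed
  then show "slice_integrable J \<Gamma> f (\<lambda>s. s ^ m * F_R s q)"
    unfolding slice_integrable_def by blast
  have "slice_integral J \<Gamma> f (\<lambda>s. s ^ m * F_R s q) =
      (\<Sum>\<gamma>\<in>\<Gamma>. \<Sum>b\<in>Basis. b * (C \<gamma> (Suc m) b - C \<gamma> m b * qcnj q))"
    unfolding slice_integral_def by (intro sum.cong refl integral_unique int)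
  also have "\<dots> = (\<Sum>b\<in>Basis. b * ((\<Sum>\<gamma>\<in>\<Gamma>. C \<gamma> (Suc m) b) - (\<Sum>\<gamma>\<in>\<Gamma>. C \<gamma> m b) * qcnj q))"
    by (subst sum.swap) (simp only: sum_distrib_left sum_distrib_right sum_subtractf right_diff_distrib)
  also have "\<dots> = (\<Sum>b\<in>Basis. (- 8 * pi) *\<^sub>R
      (Re (moment 2 (\<lambda>\<zeta>. \<zeta> ^ Suc m * stem \<alpha> \<beta> b \<zeta>) q) *\<^sub>R b
        - (Re (moment 2 (\<lambda>\<zeta>. \<zeta> ^ m * stem \<alpha> \<beta> b \<zeta>) q) *\<^sub>R b) * qcnj q))"
    unfolding C_def in_slice_cycle_integral[OF W c enc q]
    by (intro sum.cong refl) (simp add: quat_eq_iff algebra_simps)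
  also have "\<dots> = (- 8 * pi) *\<^sub>R
      (qmoment (stem \<alpha> \<beta>) 2 (Suc m) q - qmoment (stem \<alpha> \<beta>) 2 m q * qcnj q)"
    unfolding qmoment_def by (simp only: scaleR_sum_right sum_subtractf sum_distrib_right scaleR_right_diff_distrib)
  finally show "slice_integral J \<Gamma> f (\<lambda>s. s ^ m * F_R s q) = (- 8 * pi) *\<^sub>R
      (qmoment (stem \<alpha> \<beta>) 2 (Suc m) q - qmoment (stem \<alpha> \<beta>) 2 m q * qcnj q)" .
qed

section \<open>The integral representation\<close>

theorem theorem4p4:
  fixes W U :: "quat set" and J :: quat
  assumes "axially_symmetric W" and "open W"
    and "slice_Cauchy_domain U" and "bounded U" and "closure U \<subseteq> W"
    and "J \<in> imag_units"
  shows
    "(\<forall>f\<in>SH_L W.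
        left_polyanalytic2 W (fueter_conj_left f) \<and>
        (\<forall>\<Gamma> q. pos_boundary U J \<Gamma> \<and> q \<in> U \<longrightarrow>
           (\<forall>k\<in>{0..1}. slice_integrable J \<Gamma> (\<lambda>s. F_L s q * s ^ (1 - k)) f) \<and>
           fueter_conj_left f q =
             (- 1 / (2 * pi)) *\<^sub>R (\<Sum>k = 0..1. (- Q0 q) ^ k *\<^sub>R
                slice_integral J \<Gamma> (\<lambda>s. F_L s q * s ^ (1 - k)) f)) \<and>
        (\<forall>U' J' \<Gamma> \<Gamma>' q k.
           slice_Cauchy_domain U' \<and> bounded U' \<and> closure U' \<subseteq> W \<and> J' \<in> imag_units \<and>
           pos_boundary U J \<Gamma> \<and> pos_boundary U' J' \<Gamma>' \<and> q \<in> U \<and> q \<in> U' \<and> k \<in> {0..1} \<longrightarrow>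
           slice_integral J \<Gamma> (\<lambda>s. F_L s q * s ^ (1 - k)) f =
           slice_integral J' \<Gamma>' (\<lambda>s. F_L s q * s ^ (1 - k)) f)) \<and>
     (\<forall>f\<in>SH_R W.
        right_polyanalytic2 W (fueter_conj_right f) \<and>
        (\<forall>\<Gamma> q. pos_boundary U J \<Gamma> \<and> q \<in> U \<longrightarrow>
           (\<forall>k\<in>{0..1}. slice_integrable J \<Gamma> f (\<lambda>s. s ^ (1 - k) * F_R s q)) \<and>
           fueter_conj_right f q =
             (- 1 / (2 * pi)) *\<^sub>R (\<Sum>k = 0..1. (- Q0 q) ^ k *\<^sub>R
                slice_integral J \<Gamma> f (\<lambda>s. s ^ (1 - k) * F_R s q))) \<and>
        (\<forall>U' J' \<Gamma> \<Gamma>' q k.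
           slice_Cauchy_domain U' \<and> bounded U' \<and> closure U' \<subseteq> W \<and> J' \<in> imag_units \<and>
           pos_boundary U J \<Gamma> \<and> pos_boundary U' J' \<Gamma>' \<and> q \<in> U \<and> q \<in> U' \<and> k \<in> {0..1} \<longrightarrow>
           slice_integral J \<Gamma> f (\<lambda>s. s ^ (1 - k) * F_R s q) =
           slice_integral J' \<Gamma>' f (\<lambda>s. s ^ (1 - k) * F_R s q)))"
proof (intro conjI ballI)
  have enc: "encloses (stem_domain W) \<Gamma> q" "q \<in> W"
    if "slice_Cauchy_domain U" "closure U \<subseteq> W" "J \<in> imag_units" "pos_boundary U J \<Gamma>" "q \<in> U" for U J \<Gamma> q
    using pos_boundary_encloses[OF assms(1) _ _ that(2-5)] that closure_subset[of U]
    by (auto simp: slice_Cauchy_domain_def)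
  have fam: "moment_family W (qmoment (stem \<alpha> \<beta>))" if "slice_components W \<alpha> \<beta>" for \<alpha> \<beta>
    using moment_family_qmoment[OF open_stem_domain[OF assms(1,2)] stem_holomorphic_on[OF assms(1,2) that]]
    by (simp add: double_domain_stem_domain[OF assms(1)])
  note UJ = assms(3,5,6)
  {
    fix f assume "f \<in> SH_L W"
    then obtain \<alpha> \<beta> where c: "slice_components W \<alpha> \<beta>" and f: "\<forall>u v. (u, v) \<in> slice_domain W \<longrightarrow>
        (\<forall>J\<in>imag_units. f (of_real u + J * of_real v) = \<alpha> (u, v) + J * \<beta> (u, v))"
      unfolding SH_L_def by blast
    interpret moment_family W "qmoment (stem \<alpha> \<beta>)" by (rule fam[OF c])
    note cauchy = left_slice_cauchy[OF assms(1,2) c _ f]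
    note int = slice_integral_F_L[OF assms(1,2) c _ f]
    have conj_formula: "fueter_conj_left f q = 4 * (qmoment (stem \<alpha> \<beta>) 2 2 q
        - (of_real (Q0 q) + qcnj q) * qmoment (stem \<alpha> \<beta>) 2 1 q
        + of_real (Q0 q) * qcnj q * qmoment (stem \<alpha> \<beta>) 2 0 q)" if "q \<in> W" for q
      by (rule left_polyanalytic2_cauchy(1)[OF cauchy]) (use that in auto)
    show "left_polyanalytic2 W (fueter_conj_left f)"
      by (rule left_polyanalytic2_cauchy(2)[OF cauchy])
    show "\<forall>\<Gamma> q. pos_boundary U J \<Gamma> \<and> q \<in> U \<longrightarrow>
           (\<forall>k\<in>{0..1}. slice_integrable J \<Gamma> (\<lambda>s. F_L s q * s ^ (1 - k)) f) \<and>
           fueter_conj_left f q =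
             (- 1 / (2 * pi)) *\<^sub>R (\<Sum>k = 0..1. (- Q0 q) ^ k *\<^sub>R
                slice_integral J \<Gamma> (\<lambda>s. F_L s q * s ^ (1 - k)) f)"
    proof (intro allI impI conjI ballI; elim conjE)
      fix \<Gamma> q k assume a: "pos_boundary U J \<Gamma>" "q \<in> U"
      note e = enc[OF UJ a]
      show "slice_integrable J \<Gamma> (\<lambda>s. F_L s q * s ^ (1 - k)) f" by (rule int(1)[OF assms(6) e])
      show "fueter_conj_left f q =
             (- 1 / (2 * pi)) *\<^sub>R (\<Sum>k = 0..1. (- Q0 q) ^ k *\<^sub>R
                slice_integral J \<Gamma> (\<lambda>s. F_L s q * s ^ (1 - k)) f)"
        unfolding conj_formula[OF e(2)] int(2)[OF assms(6) e]
        by (simp add: numeral_2_eq_2 quat_eq_iff field_simps)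
    qed
    show "\<forall>U' J' \<Gamma> \<Gamma>' q k.
           slice_Cauchy_domain U' \<and> bounded U' \<and> closure U' \<subseteq> W \<and> J' \<in> imag_units \<and>
           pos_boundary U J \<Gamma> \<and> pos_boundary U' J' \<Gamma>' \<and> q \<in> U \<and> q \<in> U' \<and> k \<in> {0..1} \<longrightarrow>
           slice_integral J \<Gamma> (\<lambda>s. F_L s q * s ^ (1 - k)) f =
           slice_integral J' \<Gamma>' (\<lambda>s. F_L s q * s ^ (1 - k)) f"
      using int(2)[OF assms(6) enc[OF UJ]] int(2)[OF _ enc] by auto
  }
  {
    fix f assume "f \<in> SH_R W"
    then obtain \<alpha> \<beta> where c: "slice_components W \<alpha> \<beta>" and f: "\<forall>u v. (u, v) \<in> slice_domain W \<longrightarrow>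
        (\<forall>J\<in>imag_units. f (of_real u + J * of_real v) = \<alpha> (u, v) + \<beta> (u, v) * J)"
      unfolding SH_R_def by blast
    interpret moment_family W "qmoment (stem \<alpha> \<beta>)" by (rule fam[OF c])
    note cauchy = right_slice_cauchy[OF assms(1,2) c _ f]
    note int = slice_integral_F_R[OF assms(1,2) c _ f]
    have conj_formula: "fueter_conj_right f q = 4 * (qmoment (stem \<alpha> \<beta>) 2 2 q
        - qmoment (stem \<alpha> \<beta>) 2 1 q * (of_real (Q0 q) + qcnj q)
        + qmoment (stem \<alpha> \<beta>) 2 0 q * (of_real (Q0 q) * qcnj q))" if "q \<in> W" for q
      by (rule right_polyanalytic2_cauchy(1)[OF cauchy]) (use that in auto)
    show "right_polyanalytic2 W (fueter_conj_right f)"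
      by (rule right_polyanalytic2_cauchy(2)[OF cauchy])
    show "\<forall>\<Gamma> q. pos_boundary U J \<Gamma> \<and> q \<in> U \<longrightarrow>
           (\<forall>k\<in>{0..1}. slice_integrable J \<Gamma> f (\<lambda>s. s ^ (1 - k) * F_R s q)) \<and>
           fueter_conj_right f q =
             (- 1 / (2 * pi)) *\<^sub>R (\<Sum>k = 0..1. (- Q0 q) ^ k *\<^sub>R
                slice_integral J \<Gamma> f (\<lambda>s. s ^ (1 - k) * F_R s q))"
    proof (intro allI impI conjI ballI; elim conjE)
      fix \<Gamma> q k assume a: "pos_boundary U J \<Gamma>" "q \<in> U"
      note e = enc[OF UJ a]
      show "slice_integrable J \<Gamma> f (\<lambda>s. s ^ (1 - k) * F_R s q)" by (rule int(1)[OF assms(6) e])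
      show "fueter_conj_right f q =
             (- 1 / (2 * pi)) *\<^sub>R (\<Sum>k = 0..1. (- Q0 q) ^ k *\<^sub>R
                slice_integral J \<Gamma> f (\<lambda>s. s ^ (1 - k) * F_R s q))"
        unfolding conj_formula[OF e(2)] int(2)[OF assms(6) e]
        by (simp add: numeral_2_eq_2 quat_eq_iff field_simps)
    qed
    show "\<forall>U' J' \<Gamma> \<Gamma>' q k.
           slice_Cauchy_domain U' \<and> bounded U' \<and> closure U' \<subseteq> W \<and> J' \<in> imag_units \<and>
           pos_boundary U J \<Gamma> \<and> pos_boundary U' J' \<Gamma>' \<and> q \<in> U \<and> q \<in> U' \<and> k \<in> {0..1} \<longrightarrow>
           slice_integral J \<Gamma> f (\<lambda>s. s ^ (1 - k) * F_R s q) =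
           slice_integral J' \<Gamma>' f (\<lambda>s. s ^ (1 - k) * F_R s q)"
      using int(2)[OF assms(6) enc[OF UJ]] int(2)[OF _ enc] by auto
  }
qed

end
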